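(* Let $Q$ be a Buchsteiner loop such that $Q/N(Q)$ is not a boolean group. Then $|A(Q)|\ge 8$ and $|Q:N(Q)|\ge 8$. If $|Q|=64$, then $|A(Q)|=8$ and $Q/N(Q)\cong C_4\times C_2$.
   Context: A Buchsteiner loop is a loop $Q$ satisfying $x\backslash (xy\cdot z) = (y\cdot zx)/x$ for all $x,y,z$, where $\backslash$ and $/$ are left and right division. The nucleus $N(Q)$ is the set of all $a$ such that $a(xy)=(ax)y$, $x(ay)=(xa)y$ and $x(ya)=(xy)a$ for all $x,y\in Q$; in a Buchsteiner loop it is a normal subloop and $Q/N(Q)$ is an abelian group of exponent dividing $4$. A boolean group is a group in which $g^2=1$ for all $g$. $A(Q)$ is the least normal subloop $A$ of $Q$ such that $Q/A$ is a group; in a Buchsteiner loop $A(Q)\le N(Q)$ is the subgroup generated by all associators $[x,y,z]=(x\cdot yz)\backslash(xy\cdot z)$. $C_n$ is the cyclic group of order $n$. *)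

theory Defs
  imports "HOL-Algebra.Elementary_Groups"
begin

text \<open>Loops are carried by the record type \<^type>\<open>monoid_scheme\<close>, so that cosets, quotients
  (\<open>Q Mod N\<close>) and isomorphism are those of HOL-Algebra.\<close>

locale loop =
  fixes Q (structure)
  assumes m_closed: "\<lbrakk>x \<in> carrier Q; y \<in> carrier Q\<rbrakk> \<Longrightarrow> x \<otimes> y \<in> carrier Q"
    and one_closed: "\<one> \<in> carrier Q"
    and l_one: "x \<in> carrier Q \<Longrightarrow> \<one> \<otimes> x = x"
    and r_one: "x \<in> carrier Q \<Longrightarrow> x \<otimes> \<one> = x"
    and ldiv_ex1: "\<lbrakk>x \<in> carrier Q; y \<in> carrier Q\<rbrakk> \<Longrightarrow> \<exists>!z. z \<in> carrier Q \<and> x \<otimes> z = y"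
    and rdiv_ex1: "\<lbrakk>x \<in> carrier Q; y \<in> carrier Q\<rbrakk> \<Longrightarrow> \<exists>!z. z \<in> carrier Q \<and> z \<otimes> x = y"

text \<open>\<open>ldiv Q x y\<close> is x\y, and \<open>rdiv Q y x\<close> is y/x.\<close>

definition ldiv :: "('a, 'b) monoid_scheme \<Rightarrow> 'a \<Rightarrow> 'a \<Rightarrow> 'a"
  where "ldiv Q x y = (THE z. z \<in> carrier Q \<and> x \<otimes>\<^bsub>Q\<^esub> z = y)"

definition rdiv :: "('a, 'b) monoid_scheme \<Rightarrow> 'a \<Rightarrow> 'a \<Rightarrow> 'a"
  where "rdiv Q y x = (THE z. z \<in> carrier Q \<and> z \<otimes>\<^bsub>Q\<^esub> x = y)"

locale buchsteiner_loop = loop +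
  assumes buchsteiner: "\<lbrakk>x \<in> carrier Q; y \<in> carrier Q; z \<in> carrier Q\<rbrakk> \<Longrightarrow>
    ldiv Q x ((x \<otimes> y) \<otimes> z) = rdiv Q (y \<otimes> (z \<otimes> x)) x"

definition nucleus :: "('a, 'b) monoid_scheme \<Rightarrow> 'a set"
  where "nucleus Q = {a \<in> carrier Q. \<forall>x \<in> carrier Q. \<forall>y \<in> carrier Q.
    a \<otimes>\<^bsub>Q\<^esub> (x \<otimes>\<^bsub>Q\<^esub> y) = (a \<otimes>\<^bsub>Q\<^esub> x) \<otimes>\<^bsub>Q\<^esub> y \<and>
    x \<otimes>\<^bsub>Q\<^esub> (a \<otimes>\<^bsub>Q\<^esub> y) = (x \<otimes>\<^bsub>Q\<^esub> a) \<otimes>\<^bsub>Q\<^esub> y \<and>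
    x \<otimes>\<^bsub>Q\<^esub> (y \<otimes>\<^bsub>Q\<^esub> a) = (x \<otimes>\<^bsub>Q\<^esub> y) \<otimes>\<^bsub>Q\<^esub> a}"

definition subloop :: "'a set \<Rightarrow> ('a, 'b) monoid_scheme \<Rightarrow> bool"
  where "subloop H Q \<longleftrightarrow> H \<subseteq> carrier Q \<and> \<one>\<^bsub>Q\<^esub> \<in> H \<and>
    (\<forall>x \<in> H. \<forall>y \<in> H. x \<otimes>\<^bsub>Q\<^esub> y \<in> H \<and> ldiv Q x y \<in> H \<and> rdiv Q x y \<in> H)"

text \<open>Bruck's conditions xN = Nx, x(yN) = (xy)N and (Nx)y = N(xy).  They make the product of the
  cosets Nx and Ny equal to N(xy), so that \<open>Q Mod N\<close> is the quotient loop.\<close>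

definition normal_subloop :: "'a set \<Rightarrow> ('a, 'b) monoid_scheme \<Rightarrow> bool"
  where "normal_subloop N Q \<longleftrightarrow> subloop N Q \<and>
    (\<forall>x \<in> carrier Q. x <#\<^bsub>Q\<^esub> N = N #>\<^bsub>Q\<^esub> x) \<and>
    (\<forall>x \<in> carrier Q. \<forall>y \<in> carrier Q.
      x <#\<^bsub>Q\<^esub> (y <#\<^bsub>Q\<^esub> N) = (x \<otimes>\<^bsub>Q\<^esub> y) <#\<^bsub>Q\<^esub> N \<and>
      (N #>\<^bsub>Q\<^esub> x) #>\<^bsub>Q\<^esub> y = N #>\<^bsub>Q\<^esub> (x \<otimes>\<^bsub>Q\<^esub> y))"

text \<open>A(Q): least with respect to inclusion.\<close>

definition assoc_subloop :: "('a, 'b) monoid_scheme \<Rightarrow> 'a set"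
  where "assoc_subloop Q = (LEAST A. normal_subloop A Q \<and> group (Q Mod A))"

text \<open>The least such normal subloop exists in every loop, so \<open>LEAST\<close> is well-defined here.\<close>

context loop
begin

lemma ldiv_closed: "\<lbrakk>x \<in> carrier Q; y \<in> carrier Q\<rbrakk> \<Longrightarrow> ldiv Q x y \<in> carrier Q"
  and mult_ldiv: "\<lbrakk>x \<in> carrier Q; y \<in> carrier Q\<rbrakk> \<Longrightarrow> x \<otimes> ldiv Q x y = y"
  unfolding ldiv_def using theI'[OF ldiv_ex1[of x y]] by simp_all

lemma rdiv_closed: "\<lbrakk>x \<in> carrier Q; y \<in> carrier Q\<rbrakk> \<Longrightarrow> rdiv Q y x \<in> carrier Q"
  and rdiv_mult: "\<lbrakk>x \<in> carrier Q; y \<in> carrier Q\<rbrakk> \<Longrightarrow> rdiv Q y x \<otimes> x = y"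
  unfolding rdiv_def using theI'[OF rdiv_ex1[of x y]] by simp_all

lemma ldiv_mult: "\<lbrakk>x \<in> carrier Q; z \<in> carrier Q\<rbrakk> \<Longrightarrow> ldiv Q x (x \<otimes> z) = z"
  using ldiv_ex1[of x "x \<otimes> z"] by (metis ldiv_closed mult_ldiv m_closed)

lemma mult_rdiv: "\<lbrakk>x \<in> carrier Q; z \<in> carrier Q\<rbrakk> \<Longrightarrow> rdiv Q (z \<otimes> x) x = z"
  using rdiv_ex1[of x "z \<otimes> x"] by (metis rdiv_closed rdiv_mult m_closed)

lemma l_coset_iff:
  "\<lbrakk>N \<subseteq> carrier Q; x \<in> carrier Q\<rbrakk> \<Longrightarrow> w \<in> x <# N \<longleftrightarrow> w \<in> carrier Q \<and> ldiv Q x w \<in> N"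
  unfolding l_coset_def
  by (auto simp: ldiv_mult m_closed subset_iff) (metis mult_ldiv)

lemma r_coset_iff:
  "\<lbrakk>N \<subseteq> carrier Q; x \<in> carrier Q\<rbrakk> \<Longrightarrow> w \<in> N #> x \<longleftrightarrow> w \<in> carrier Q \<and> rdiv Q w x \<in> N"
  unfolding r_coset_def
  by (auto simp: mult_rdiv m_closed subset_iff) (metis rdiv_mult)

lemma l_coset_closed: "\<lbrakk>N \<subseteq> carrier Q; x \<in> carrier Q\<rbrakk> \<Longrightarrow> x <# N \<subseteq> carrier Q"
  and r_coset_closed: "\<lbrakk>N \<subseteq> carrier Q; x \<in> carrier Q\<rbrakk> \<Longrightarrow> N #> x \<subseteq> carrier Q"
  by (auto simp: l_coset_iff r_coset_iff)

lemma normal_subloop_iff: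
  "normal_subloop N Q \<longleftrightarrow> subloop N Q \<and>
    (\<forall>x \<in> carrier Q. \<forall>w \<in> carrier Q. ldiv Q x w \<in> N \<longleftrightarrow> rdiv Q w x \<in> N) \<and>
    (\<forall>x \<in> carrier Q. \<forall>y \<in> carrier Q. \<forall>w \<in> carrier Q.
      (ldiv Q y (ldiv Q x w) \<in> N \<longleftrightarrow> ldiv Q (x \<otimes> y) w \<in> N) \<and>
      (rdiv Q (rdiv Q w y) x \<in> N \<longleftrightarrow> rdiv Q w (x \<otimes> y) \<in> N))"
proof (cases "subloop N Q")
  case True
  then have N: "N \<subseteq> carrier Q" by (simp add: subloop_def)
  have sets_eq: "A = B \<longleftrightarrow> (\<forall>w \<in> carrier Q. w \<in> A \<longleftrightarrow> w \<in> B)"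
    if "A \<subseteq> carrier Q" "B \<subseteq> carrier Q" for A B
    using that by blast
  show ?thesis
    using True N unfolding normal_subloop_def
    by (simp add: sets_eq l_coset_iff r_coset_iff l_coset_closed r_coset_closed m_closed
        ldiv_closed rdiv_closed ball_conj_distrib)
qed (simp add: normal_subloop_def)

lemma subloop_carrier: "subloop (carrier Q) Q"
  by (simp add: subloop_def one_closed m_closed ldiv_closed rdiv_closed)

lemma normal_subloop_carrier: "normal_subloop (carrier Q) Q"
  by (simp add: normal_subloop_iff subloop_carrier m_closed ldiv_closed rdiv_closed)

lemma subloop_r_coset:
  assumes sl: "subloop N Q" and n: "n \<in> N" shows "N #> n = N"
proof
  show "N #> n \<subseteq> N" using sl n by (auto simp: r_coset_def subloop_def)
  have "N \<subseteq> carrier Q" and "\<And>w. w \<in> N \<Longrightarrow> rdiv Q w n \<in> N"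
    using sl n by (auto simp: subloop_def)
  then show "N \<subseteq> N #> n" using n by (auto simp: r_coset_iff subset_iff)
qed

lemma normal_subloopD:
  assumes "normal_subloop N Q" "x \<in> carrier Q"
  shows "x <# N = N #> x"
    and "y \<in> carrier Q \<Longrightarrow> x <# (y <# N) = (x \<otimes> y) <# N"
    and "y \<in> carrier Q \<Longrightarrow> (N #> x) #> y = N #> (x \<otimes> y)"
  using assms unfolding normal_subloop_def by blast+

lemma r_coset_eq_iff:
  assumes N: "normal_subloop N Q" and a: "a \<in> carrier Q" and b: "b \<in> carrier Q"
  shows "N #> a = N #> b \<longleftrightarrow> rdiv Q a b \<in> N"
proof -
  have sub: "N \<subseteq> carrier Q" "\<one> \<in> N" and sl: "subloop N Q"
    using N by (auto simp: normal_subloop_def subloop_def)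
  have "a \<in> N #> a"
    using sub a l_one by (force simp: r_coset_def)
  moreover have "N #> a = N #> b" if n: "rdiv Q a b \<in> N"
  proof -
    have "N #> a = N #> (rdiv Q a b \<otimes> b)" using rdiv_mult a b by simp
    also have "\<dots> = (N #> rdiv Q a b) #> b"
      using normal_subloopD(3)[OF N _ b] n sub by auto
    also have "\<dots> = N #> b" using subloop_r_coset[OF sl n] by simp
    finally show ?thesis .
  qed
  ultimately show ?thesis using r_coset_iff[OF sub(1) b] by auto
qed

lemma r_coset_mult:
  assumes N: "normal_subloop N Q" and x: "x \<in> carrier Q" and y: "y \<in> carrier Q"
  shows "(N #> x) <#> (N #> y) = N #> (x \<otimes> y)"
proof -
  have sub: "N \<subseteq> carrier Q" "\<one> \<in> N" and sl: "subloop N Q"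
    using N by (auto simp: normal_subloop_def subloop_def)
  have "u <# (N #> y) = N #> (x \<otimes> y)" if u: "u \<in> N #> x" for u
  proof -
    have uQ: "u \<in> carrier Q" using u r_coset_closed[OF sub(1) x] by blast
    have "u \<otimes> y \<in> (N #> x) #> y" using u by (auto simp: r_coset_def)
    then have uy: "u \<otimes> y \<in> N #> (x \<otimes> y)"
      using normal_subloopD(3)[OF N x y] by simp
    have "u <# (N #> y) = u <# (y <# N)" using normal_subloopD(1)[OF N y] by simp
    also have "\<dots> = (u \<otimes> y) <# N" using normal_subloopD(2)[OF N uQ y] .
    also have "\<dots> = N #> (u \<otimes> y)" using normal_subloopD(1)[OF N m_closed[OF uQ y]] .
    also have "\<dots> = N #> (x \<otimes> y)"
      using uy r_coset_eq_iff[OF N m_closed[OF uQ y] m_closed[OF x y]]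
        r_coset_iff[OF sub(1) m_closed[OF x y]] by simp
    finally show ?thesis .
  qed
  moreover have "x \<in> N #> x"
    using sub x l_one by (force simp: r_coset_def)
  moreover have "(N #> x) <#> (N #> y) = (\<Union>u \<in> N #> x. u <# (N #> y))"
    by (simp add: set_mult_def l_coset_def)
  ultimately show ?thesis by auto
qed

lemma group_Mod_iff:
  assumes N: "normal_subloop N Q"
  shows "group (Q Mod N) \<longleftrightarrow> (\<forall>x \<in> carrier Q. \<forall>y \<in> carrier Q. \<forall>z \<in> carrier Q.
    rdiv Q ((x \<otimes> y) \<otimes> z) (x \<otimes> (y \<otimes> z)) \<in> N)" (is "_ \<longleftrightarrow> ?assoc")
proof -
  have sub: "N \<subseteq> carrier Q" and sl: "subloop N Q"
    using N by (auto simp: normal_subloop_def subloop_def)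
  have carr: "N #> x \<in> carrier (Q Mod N)" if "x \<in> carrier Q" for x
    using that by (auto simp: FactGroup_def RCOSETS_def)
  have N_one: "N = N #> \<one>"
    using subloop_r_coset[OF sl] sl by (simp add: subloop_def)
  show ?thesis
  proof
    assume "group (Q Mod N)"
    then interpret F: group "Q Mod N" .
    show ?assoc
    proof (intro ballI)
      fix x y z assume xyz: "x \<in> carrier Q" "y \<in> carrier Q" "z \<in> carrier Q"
      have "N #> ((x \<otimes> y) \<otimes> z) = N #> (x \<otimes> (y \<otimes> z))"
        using F.m_assoc[OF carr carr carr, OF xyz] xyz
        by (simp add: FactGroup_def r_coset_mult[OF N] m_closed)
      then show "rdiv Q ((x \<otimes> y) \<otimes> z) (x \<otimes> (y \<otimes> z)) \<in> N"
        using r_coset_eq_iff[OF N] xyz m_closed by simp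
    qed
  next
    assume A: ?assoc
    show "group (Q Mod N)"
    proof (rule groupI)
      show "\<one>\<^bsub>Q Mod N\<^esub> \<in> carrier (Q Mod N)"
        using carr[OF one_closed] N_one by (simp add: FactGroup_def)
    next
      fix X Y assume "X \<in> carrier (Q Mod N)" "Y \<in> carrier (Q Mod N)"
      then show "X \<otimes>\<^bsub>Q Mod N\<^esub> Y \<in> carrier (Q Mod N)"
        by (auto simp: FactGroup_def RCOSETS_def r_coset_mult[OF N] m_closed intro!: bexI)
    next
      fix X Y Z assume "X \<in> carrier (Q Mod N)" "Y \<in> carrier (Q Mod N)" "Z \<in> carrier (Q Mod N)"
      then obtain x y z where xyz: "x \<in> carrier Q" "y \<in> carrier Q" "z \<in> carrier Q"
        and "X = N #> x" "Y = N #> y" "Z = N #> z"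
        by (auto simp: FactGroup_def RCOSETS_def)
      moreover have "N #> ((x \<otimes> y) \<otimes> z) = N #> (x \<otimes> (y \<otimes> z))"
        using A r_coset_eq_iff[OF N] xyz m_closed by simp
      ultimately show "X \<otimes>\<^bsub>Q Mod N\<^esub> Y \<otimes>\<^bsub>Q Mod N\<^esub> Z = X \<otimes>\<^bsub>Q Mod N\<^esub> (Y \<otimes>\<^bsub>Q Mod N\<^esub> Z)"
        by (simp add: FactGroup_def r_coset_mult[OF N] m_closed)
    next
      fix X assume "X \<in> carrier (Q Mod N)"
      then obtain x where x: "x \<in> carrier Q" and X: "X = N #> x"
        by (auto simp: FactGroup_def RCOSETS_def)
      have "N <#> X = (N #> \<one>) <#> (N #> x)" using N_one X by simp
      also have "\<dots> = X" by (simp add: r_coset_mult[OF N one_closed x] l_one x X)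
      finally show "\<one>\<^bsub>Q Mod N\<^esub> \<otimes>\<^bsub>Q Mod N\<^esub> X = X" by (simp add: FactGroup_def)
      have "(N #> rdiv Q \<one> x) <#> X = N"
        using r_coset_mult[OF N rdiv_closed x] x one_closed X N_one rdiv_mult by simp
      then show "\<exists>Y \<in> carrier (Q Mod N). Y \<otimes>\<^bsub>Q Mod N\<^esub> X = \<one>\<^bsub>Q Mod N\<^esub>"
        using carr[OF rdiv_closed[OF x one_closed]] by (auto simp: FactGroup_def)
    qed
  qed
qed

lemma assoc_subloop_least:
  shows "normal_subloop (assoc_subloop Q) Q" and "group (Q Mod assoc_subloop Q)"
    and "\<lbrakk>normal_subloop N Q; group (Q Mod N)\<rbrakk> \<Longrightarrow> assoc_subloop Q \<subseteq> N"
proof -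
  let ?P = "\<lambda>A. normal_subloop A Q \<and> group (Q Mod A)"
  let ?I = "\<Inter>{A. ?P A}"
  have car: "?P (carrier Q)"
    by (simp add: normal_subloop_carrier group_Mod_iff m_closed rdiv_closed)
  have "?I \<subseteq> carrier Q" using car by blast
  then have "subloop ?I Q"
    unfolding subloop_def by (auto simp: normal_subloop_def subloop_def)
  then have I: "normal_subloop ?I Q"
    unfolding normal_subloop_iff by auto
  moreover have "group (Q Mod ?I)"
    unfolding group_Mod_iff[OF I] using group_Mod_iff by auto
  ultimately have P: "?P ?I" by blast
  have "assoc_subloop Q = ?I"
    unfolding assoc_subloop_def by (rule Least_equality[where P = ?P, OF P]) blast
  with P show "normal_subloop (assoc_subloop Q) Q" "group (Q Mod assoc_subloop Q)"
    and "\<lbrakk>normal_subloop N Q; group (Q Mod N)\<rbrakk> \<Longrightarrow> assoc_subloop Q \<subseteq> N"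
    by auto
qed

end

definition boolean_group :: "('a, 'b) monoid_scheme \<Rightarrow> bool"
  where "boolean_group G \<longleftrightarrow> group G \<and> (\<forall>g \<in> carrier G. g \<otimes>\<^bsub>G\<^esub> g = \<one>\<^bsub>G\<^esub>)"

end

theory Submission
  imports Defs "HOL-Algebra.Multiplicative_Group"
begin

text \<open>
  Write \<open>N\<close> for the nucleus, \<open>Z\<close> for the centre of the group \<open>N\<close>, and \<open>f(x,y,z)\<close> for the associator
  \<open>(x(yz))\<setminus>(xy\<cdot>z)\<close>.  The proof has two halves: all associators are nuclear
  (\<open>buchsteiner_nuclear\<close>), and a Buchsteiner loop with nuclear associators obeys a linear calculus from
  which the cardinalities can be read off.

  \<^emph>\<open>Associators are nuclear.\<close>  The Buchsteiner law says that
  \<open>(L\<^sub>x, R\<^sub>x\<^sup>-\<^sup>1, L\<^sub>xR\<^sub>x\<^sup>-\<^sup>1)\<close> is an autotopism for every \<open>x\<close>.  The inner mapping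
  \<open>L(x,y) = L\<^bsub>xy\<^esub>\<^sup>-\<^sup>1L\<^sub>xL\<^sub>y\<close> occurs as a first and also as a second component of a product of such
  autotopisms.  Any mapping that fixes \<open>1\<close> and has this double role yields an element that is central
  modulo \<open>N\<close> (\<open>central_mod_nucleus\<close>); for \<open>L(x,y)\<close> this element is \<open>((1/y)/x)(xy)\<close>, the obstruction to
  the weak inverse property.  So \<open>Q\<^sub>2 = Q\<^sub>1/N(Q\<^sub>1)\<close> with \<open>Q\<^sub>1 = Q/N\<close> has the weak inverse property, and in
  its presence autotopisms can be rotated, which makes everything central modulo the nucleus
  (\<open>wip_central\<close>); hence the associators of \<open>Q\<^sub>2\<close> are nuclear.  Nuclearity then climbs from a factor
  loop \<open>Q/N\<close> to \<open>Q\<close> (\<open>assoc_nuclear_step\<close>), and two such steps lead from \<open>Q\<^sub>2\<close> to \<open>Q\<close>.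

  \<^emph>\<open>The calculus.\<close>  Nuclear associators lie in \<open>Z\<close>, on which \<open>Q\<close> acts by conjugation.  Written
  additively, \<open>f\<close> is additive in each argument up to this action, and the Buchsteiner law becomes
  \<open>f(y,z,x) = -f(x,y,z)\<^sup>x\<close>.  It follows that \<open>f\<close> is insensitive to the order of the factors inside an
  argument, that squares act trivially on associators, and that \<open>f\<close> vanishes on fourth powers.  So
  \<open>Q/N\<close> is an abelian group of exponent dividing \<open>4\<close>.

  \<^emph>\<open>Counting.\<close>  If \<open>z\<^sup>2 \<notin> N\<close>, then \<open>e = f(x,y,z\<^sup>2) = a + a\<^sup>z\<close> is nonzero for suitable \<open>x, y\<close>, where
  \<open>a = f(x,y,z)\<close>.  Here \<open>e\<close> has order two and is fixed by the action whereas \<open>a\<close> is not fixed, and a module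
  with fewer than eight elements containing all associators has no room for such a pair
  (\<open>card_associators_ge_8\<close>).  If \<open>Q/N\<close> had fewer than eight elements, it would be cyclic and generated by the class
  of \<open>z\<close>, but \<open>f(z,z,z\<^sup>2) = 0\<close>, so \<open>e = 0\<close> by bilinearity.  Finally \<open>A(Q) \<le> N\<close>, so for \<open>|Q| = 64\<close> both
  bounds are attained, and an abelian group of order \<open>8\<close> and exponent \<open>4\<close> is \<open>C\<^sub>4 \<times> C\<^sub>2\<close>.
\<close>

section \<open>Autotopisms and the nucleus\<close>

context loop
begin

abbreviation ld (infixl "\<setminus>" 70) where "x \<setminus> y \<equiv> ldiv Q x y"
abbreviation rd (infixl "\<div>" 70) where "x \<div> y \<equiv> rdiv Q x y"

declare m_closed [simp] one_closed [simp] l_one [simp] r_one [simp]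
  ldiv_closed [simp] rdiv_closed [simp] mult_ldiv [simp] rdiv_mult [simp]
  ldiv_mult [simp] mult_rdiv [simp]

lemma l_cancel [simp]:
  "\<lbrakk>x \<in> carrier Q; y \<in> carrier Q; z \<in> carrier Q\<rbrakk> \<Longrightarrow> x \<otimes> y = x \<otimes> z \<longleftrightarrow> y = z"
  by (metis ldiv_mult)

lemma r_cancel [simp]:
  "\<lbrakk>x \<in> carrier Q; y \<in> carrier Q; z \<in> carrier Q\<rbrakk> \<Longrightarrow> y \<otimes> x = z \<otimes> x \<longleftrightarrow> y = z"
  by (metis mult_rdiv)

lemma ldiv_eqI: "\<lbrakk>x \<otimes> z = y; x \<in> carrier Q; z \<in> carrier Q\<rbrakk> \<Longrightarrow> x \<setminus> y = z"
  and rdiv_eqI: "\<lbrakk>z \<otimes> x = y; x \<in> carrier Q; z \<in> carrier Q\<rbrakk> \<Longrightarrow> y \<div> x = z"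
  by auto

lemma div_one [simp]:
  assumes "x \<in> carrier Q"
  shows "\<one> \<setminus> x = x" "x \<div> \<one> = x" "x \<setminus> x = \<one>" "x \<div> x = \<one>"
    "(\<one> \<div> x) \<setminus> \<one> = x" "\<one> \<div> (x \<setminus> \<one>) = x"
  using assms by (auto intro!: ldiv_eqI rdiv_eqI)

definition autotopism :: "('a \<Rightarrow> 'a) \<Rightarrow> ('a \<Rightarrow> 'a) \<Rightarrow> ('a \<Rightarrow> 'a) \<Rightarrow> bool"
  where "autotopism \<alpha> \<beta> \<gamma> \<longleftrightarrow>
    bij_betw \<alpha> (carrier Q) (carrier Q) \<and> bij_betw \<beta> (carrier Q) (carrier Q) \<and>
    bij_betw \<gamma> (carrier Q) (carrier Q) \<and>
    (\<forall>x \<in> carrier Q. \<forall>y \<in> carrier Q. \<alpha> x \<otimes> \<beta> y = \<gamma> (x \<otimes> y))"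

lemma autotopismI:
  assumes "\<And>x. x \<in> carrier Q \<Longrightarrow> \<alpha> x \<in> carrier Q \<and> \<alpha>' x \<in> carrier Q \<and> \<alpha> (\<alpha>' x) = x \<and> \<alpha>' (\<alpha> x) = x"
    and "\<And>x. x \<in> carrier Q \<Longrightarrow> \<beta> x \<in> carrier Q \<and> \<beta>' x \<in> carrier Q \<and> \<beta> (\<beta>' x) = x \<and> \<beta>' (\<beta> x) = x"
    and "\<And>x. x \<in> carrier Q \<Longrightarrow> \<gamma> x \<in> carrier Q \<and> \<gamma>' x \<in> carrier Q \<and> \<gamma> (\<gamma>' x) = x \<and> \<gamma>' (\<gamma> x) = x"
    and "\<And>x y. \<lbrakk>x \<in> carrier Q; y \<in> carrier Q\<rbrakk> \<Longrightarrow> \<alpha> x \<otimes> \<beta> y = \<gamma> (x \<otimes> y)"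
  shows "autotopism \<alpha> \<beta> \<gamma>"
proof -
  have "bij_betw \<delta> (carrier Q) (carrier Q)"
    if "\<And>x. x \<in> carrier Q \<Longrightarrow> \<delta> x \<in> carrier Q \<and> \<delta>' x \<in> carrier Q \<and> \<delta> (\<delta>' x) = x \<and> \<delta>' (\<delta> x) = x" for \<delta> \<delta>'
    by (rule bij_betwI[of _ _ _ \<delta>']) (use that in auto)
  from this[of \<alpha> \<alpha>'] this[of \<beta> \<beta>'] this[of \<gamma> \<gamma>'] show ?thesis
    using assms unfolding autotopism_def by blast
qed

lemma autotopismD:
  assumes "autotopism \<alpha> \<beta> \<gamma>"
  shows "x \<in> carrier Q \<Longrightarrow> \<alpha> x \<in> carrier Q" "x \<in> carrier Q \<Longrightarrow> \<beta> x \<in> carrier Q"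
    "x \<in> carrier Q \<Longrightarrow> \<gamma> x \<in> carrier Q"
    "\<lbrakk>x \<in> carrier Q; y \<in> carrier Q\<rbrakk> \<Longrightarrow> \<alpha> x \<otimes> \<beta> y = \<gamma> (x \<otimes> y)"
proof -
  have m: "\<delta> x \<in> carrier Q" if "bij_betw \<delta> (carrier Q) (carrier Q)" "x \<in> carrier Q" for \<delta> :: "'a \<Rightarrow> 'a" and x
    using that bij_betwE by blast
  have A: "bij_betw \<alpha> (carrier Q) (carrier Q)" "bij_betw \<beta> (carrier Q) (carrier Q)"
    "bij_betw \<gamma> (carrier Q) (carrier Q)"
    "\<forall>x \<in> carrier Q. \<forall>y \<in> carrier Q. \<alpha> x \<otimes> \<beta> y = \<gamma> (x \<otimes> y)"
    using assms unfolding autotopism_def by blast+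
  show "x \<in> carrier Q \<Longrightarrow> \<alpha> x \<in> carrier Q" by (rule m[OF A(1)])
  show "x \<in> carrier Q \<Longrightarrow> \<beta> x \<in> carrier Q" by (rule m[OF A(2)])
  show "x \<in> carrier Q \<Longrightarrow> \<gamma> x \<in> carrier Q" by (rule m[OF A(3)])
  show "\<lbrakk>x \<in> carrier Q; y \<in> carrier Q\<rbrakk> \<Longrightarrow> \<alpha> x \<otimes> \<beta> y = \<gamma> (x \<otimes> y)"
    using A(4) by blast
qed

lemma autotopism_surj:
  assumes "autotopism \<alpha> \<beta> \<gamma>" "y \<in> carrier Q"
  obtains x where "x \<in> carrier Q" "\<alpha> x = y"
proof -
  have "y \<in> \<alpha> ` carrier Q"
    using assms bij_betw_imp_surj_on[of \<alpha> "carrier Q" "carrier Q"] by (simp add: autotopism_def)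
  then show thesis using that by blast
qed

lemma autotopism_comp:
  assumes "autotopism \<alpha> \<beta> \<gamma>" "autotopism \<alpha>' \<beta>' \<gamma>'"
  shows "autotopism (\<lambda>x. \<alpha> (\<alpha>' x)) (\<lambda>x. \<beta> (\<beta>' x)) (\<lambda>x. \<gamma> (\<gamma>' x))"
proof -
  have t: "bij_betw (\<lambda>x. \<delta> (\<delta>' x)) (carrier Q) (carrier Q)"
    if "bij_betw \<delta> (carrier Q) (carrier Q)" "bij_betw \<delta>' (carrier Q) (carrier Q)" for \<delta> \<delta>' :: "'a \<Rightarrow> 'a"
    using bij_betw_trans[OF that(2,1)] by (simp add: comp_def)
  show ?thesis
    unfolding autotopism_def
    using assms[unfolded autotopism_def] t autotopismD[OF assms(2)] by simp
qed

lemma autotopism_inverse: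
  assumes "autotopism \<alpha> \<beta> \<gamma>"
    and "\<And>x. x \<in> carrier Q \<Longrightarrow> \<alpha>' x \<in> carrier Q \<and> \<alpha> (\<alpha>' x) = x"
    and "\<And>x. x \<in> carrier Q \<Longrightarrow> \<beta>' x \<in> carrier Q \<and> \<beta> (\<beta>' x) = x"
    and "\<And>x. x \<in> carrier Q \<Longrightarrow> \<gamma>' x \<in> carrier Q \<and> \<gamma> (\<gamma>' x) = x"
  shows "autotopism \<alpha>' \<beta>' \<gamma>'"
proof -
  have inv: "\<delta>' (\<delta> x) = x" if "bij_betw \<delta> (carrier Q) (carrier Q)" "x \<in> carrier Q"
    "\<And>x. x \<in> carrier Q \<Longrightarrow> \<delta>' x \<in> carrier Q \<and> \<delta> (\<delta>' x) = x" for \<delta> \<delta>' x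
    using that unfolding bij_betw_def by (metis image_eqI inj_on_eq_iff)
  have bij: "bij_betw \<alpha> (carrier Q) (carrier Q)" "bij_betw \<beta> (carrier Q) (carrier Q)"
    "bij_betw \<gamma> (carrier Q) (carrier Q)"
    using assms(1) by (auto simp: autotopism_def)
  note D = autotopismD[OF assms(1)]
  show ?thesis
  proof (rule autotopismI[of \<alpha>' \<alpha> \<beta>' \<beta> \<gamma>' \<gamma>])
    fix x y assume xy: "x \<in> carrier Q" "y \<in> carrier Q"
    then have "\<alpha>' x \<otimes> \<beta>' y = \<gamma>' (\<gamma> (\<alpha>' x \<otimes> \<beta>' y))"
      using inv[OF bij(3) _ assms(4)] assms(2,3) by simp
    also have "\<dots> = \<gamma>' (x \<otimes> y)"
      using D(4)[of "\<alpha>' x" "\<beta>' y"] xy assms(2,3) by simp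
    finally show "\<alpha>' x \<otimes> \<beta>' y = \<gamma>' (x \<otimes> y)" .
  qed (use inv[OF bij(1) _ assms(2)] inv[OF bij(2) _ assms(3)] inv[OF bij(3) _ assms(4)] assms D in auto)
qed

lemma autotopism_inv:
  assumes "autotopism \<alpha> \<beta> \<gamma>"
  shows "autotopism (inv_into (carrier Q) \<alpha>) (inv_into (carrier Q) \<beta>) (inv_into (carrier Q) \<gamma>)"
proof -
  have i: "inv_into (carrier Q) \<delta> x \<in> carrier Q \<and> \<delta> (inv_into (carrier Q) \<delta> x) = x"
    if "bij_betw \<delta> (carrier Q) (carrier Q)" "x \<in> carrier Q" for \<delta> :: "'a \<Rightarrow> 'a" and x
    using that unfolding bij_betw_def by (metis f_inv_into_f inv_into_into)
  have bij: "bij_betw \<alpha> (carrier Q) (carrier Q)" "bij_betw \<beta> (carrier Q) (carrier Q)" "bij_betw \<gamma> (carrier Q) (carrier Q)"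
    using assms by (auto simp: autotopism_def)
  show ?thesis
    by (rule autotopism_inverse[OF assms]) (use i bij in auto)
qed

lemma autotopism_inv_apply:
  assumes "autotopism \<alpha> \<beta> \<gamma>" "x \<in> carrier Q"
  shows "\<alpha> (inv_into (carrier Q) \<alpha> x) = x" "\<beta> (inv_into (carrier Q) \<beta> x) = x"
    "inv_into (carrier Q) \<alpha> x \<in> carrier Q" "inv_into (carrier Q) \<beta> x \<in> carrier Q"
  using assms autotopismD(1,2)[OF autotopism_inv[OF assms(1)] assms(2)]
  unfolding autotopism_def bij_betw_def by (metis f_inv_into_f)+

lemma nucleusD:
  assumes "a \<in> nucleus Q"
  shows "a \<in> carrier Q"
    "\<lbrakk>x \<in> carrier Q; y \<in> carrier Q\<rbrakk> \<Longrightarrow> a \<otimes> (x \<otimes> y) = (a \<otimes> x) \<otimes> y"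
    "\<lbrakk>x \<in> carrier Q; y \<in> carrier Q\<rbrakk> \<Longrightarrow> x \<otimes> (a \<otimes> y) = (x \<otimes> a) \<otimes> y"
    "\<lbrakk>x \<in> carrier Q; y \<in> carrier Q\<rbrakk> \<Longrightarrow> x \<otimes> (y \<otimes> a) = (x \<otimes> y) \<otimes> a"
  using assms unfolding nucleus_def by auto

end

context buchsteiner_loop
begin

lemma buchsteiner_mult:
  assumes "x \<in> carrier Q" "y \<in> carrier Q" "z \<in> carrier Q"
  shows "(x \<otimes> y) \<otimes> (z \<div> x) = x \<otimes> ((y \<otimes> z) \<div> x)"
  using buchsteiner[of x y "z \<div> x"] assms by (metis m_closed mult_ldiv rdiv_closed rdiv_mult)

text \<open>The Buchsteiner law in the form \<open>(L\<^sub>x, R\<^sub>x\<^sup>-\<^sup>1, L\<^sub>xR\<^sub>x\<^sup>-\<^sup>1)\<close>: every autotopism below is composed of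
  these and their inverses.\<close>

lemma autotopism_B:
  assumes "x \<in> carrier Q"
  shows "autotopism (\<lambda>y. x \<otimes> y) (\<lambda>y. y \<div> x) (\<lambda>y. x \<otimes> (y \<div> x))"
  by (rule autotopismI[of _ "\<lambda>y. x \<setminus> y" _ "\<lambda>y. y \<otimes> x" _ "\<lambda>y. (x \<setminus> y) \<otimes> x"])
    (use assms buchsteiner_mult in auto)

lemma autotopism_B_inv:
  assumes "x \<in> carrier Q"
  shows "autotopism (\<lambda>y. x \<setminus> y) (\<lambda>y. y \<otimes> x) (\<lambda>y. (x \<setminus> y) \<otimes> x)"
  by (rule autotopism_inverse[OF autotopism_B[OF assms]]) (use assms in auto)

text \<open>The left, middle and right nucleus coincide: with \<open>a\<close> in one of its places, the Buchsteiner law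
  trades one kind of associativity for another.\<close>

lemma nucleus_if_left:
  assumes a: "a \<in> carrier Q"
    and l: "\<And>x y. \<lbrakk>x \<in> carrier Q; y \<in> carrier Q\<rbrakk> \<Longrightarrow> a \<otimes> (x \<otimes> y) = (a \<otimes> x) \<otimes> y"
  shows "a \<in> nucleus Q"
proof -
  have r: "x \<otimes> (y \<otimes> a) = (x \<otimes> y) \<otimes> a" if "x \<in> carrier Q" "y \<in> carrier Q" for x y
  proof -
    have "a \<otimes> (x \<otimes> y) = a \<otimes> ((x \<otimes> (y \<otimes> a)) \<div> a)"
      using buchsteiner_mult[of a x "y \<otimes> a"] that a l[of x y] by simp
    then have "x \<otimes> y = (x \<otimes> (y \<otimes> a)) \<div> a" using that a by simp
    then show ?thesis using that a by simp
  qed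
  have m: "x \<otimes> (a \<otimes> y) = (x \<otimes> a) \<otimes> y" if "x \<in> carrier Q" "y \<in> carrier Q" for x y
    using buchsteiner_mult[of x a "y \<otimes> x"] that a l by simp
  show ?thesis unfolding nucleus_def using a l r m by auto
qed

lemma nucleus_if_middle:
  assumes a: "a \<in> carrier Q"
    and m: "\<And>x y. \<lbrakk>x \<in> carrier Q; y \<in> carrier Q\<rbrakk> \<Longrightarrow> x \<otimes> (a \<otimes> y) = (x \<otimes> a) \<otimes> y"
  shows "a \<in> nucleus Q"
proof (rule nucleus_if_left[OF a])
  fix x y assume xy: "x \<in> carrier Q" "y \<in> carrier Q"
  then have "y \<otimes> (a \<otimes> x) = y \<otimes> ((a \<otimes> (x \<otimes> y)) \<div> y)"
    using buchsteiner_mult[of y a "x \<otimes> y"] a m by simp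
  then show "a \<otimes> (x \<otimes> y) = (a \<otimes> x) \<otimes> y"
    using xy a rdiv_mult[of y "a \<otimes> (x \<otimes> y)"] by simp
qed

lemma nucleus_if_right:
  assumes a: "a \<in> carrier Q"
    and r: "\<And>x y. \<lbrakk>x \<in> carrier Q; y \<in> carrier Q\<rbrakk> \<Longrightarrow> x \<otimes> (y \<otimes> a) = (x \<otimes> y) \<otimes> a"
  shows "a \<in> nucleus Q"
proof (rule nucleus_if_left[OF a])
  fix x y assume xy: "x \<in> carrier Q" "y \<in> carrier Q"
  then show "a \<otimes> (x \<otimes> y) = (a \<otimes> x) \<otimes> y"
    using buchsteiner_mult[of a x "y \<otimes> a"] a r by simp
qed

text \<open>The quotient of the two autotopisms has the form \<open>(id, \<sigma>, \<tau>)\<close>.  Then \<open>\<sigma> = \<tau>\<close> is the right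
  translation by \<open>\<sigma> 1\<close>, and \<open>x \<cdot> y\<sigma>(1) = xy \<cdot> \<sigma>(1)\<close> says that \<open>\<sigma> 1\<close> is nuclear.\<close>

lemma autotopism_ratio:
  assumes A: "autotopism \<alpha> \<beta> \<gamma>" "autotopism \<alpha>' \<beta>' \<gamma>'"
    and eq: "\<And>x. x \<in> carrier Q \<Longrightarrow> \<alpha>' x = \<alpha> x"
  obtains n where "n \<in> nucleus Q" "\<And>y. y \<in> carrier Q \<Longrightarrow> \<beta>' y = \<beta> y \<otimes> n"
proof -
  define i where "i \<delta> = inv_into (carrier Q) \<delta>" for \<delta> :: "'a \<Rightarrow> 'a"
  have T: "autotopism (\<lambda>x. \<alpha>' (i \<alpha> x)) (\<lambda>x. \<beta>' (i \<beta> x)) (\<lambda>x. \<gamma>' (i \<gamma> x))"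
    unfolding i_def by (rule autotopism_comp[OF A(2) autotopism_inv[OF A(1)]])
  define \<sigma> where "\<sigma> = (\<lambda>x. \<beta>' (i \<beta> x))"
  define \<tau> where "\<tau> = (\<lambda>x. \<gamma>' (i \<gamma> x))"
  have st: "\<sigma> x \<in> carrier Q" "x \<otimes> \<sigma> y = \<tau> (x \<otimes> y)" if "x \<in> carrier Q" "y \<in> carrier Q" for x y
  proof -
    show "\<sigma> x \<in> carrier Q" unfolding \<sigma>_def by (rule autotopismD(2)[OF T that(1)])
    have "\<alpha>' (i \<alpha> x) = x" using eq autotopism_inv_apply[OF A(1) that(1)] by (simp add: i_def)
    then show "x \<otimes> \<sigma> y = \<tau> (x \<otimes> y)"
      using autotopismD(4)[OF T that] unfolding \<sigma>_def \<tau>_def by simp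
  qed
  have s: "\<sigma> y = y \<otimes> \<sigma> \<one>" "\<tau> y = y \<otimes> \<sigma> \<one>" if "y \<in> carrier Q" for y
  proof -
    show t: "\<tau> y = y \<otimes> \<sigma> \<one>" using st(2)[of y \<one>] that by simp
    show "\<sigma> y = y \<otimes> \<sigma> \<one>" using st(2)[of \<one> y] st(1)[OF that that] that t by simp
  qed
  have "\<sigma> \<one> \<in> nucleus Q"
  proof (rule nucleus_if_right)
    show "\<sigma> \<one> \<in> carrier Q" using st(1)[of \<one> \<one>] by simp
    fix x y assume xy: "x \<in> carrier Q" "y \<in> carrier Q"
    show "x \<otimes> (y \<otimes> \<sigma> \<one>) = (x \<otimes> y) \<otimes> \<sigma> \<one>"
      unfolding s(1)[OF xy(2), symmetric] s(2)[OF m_closed[OF xy], symmetric] by (rule st(2)[OF xy])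
  qed
  moreover have "\<beta>' y = \<beta> y \<otimes> \<sigma> \<one>" if "y \<in> carrier Q" for y
  proof -
    have "i \<beta> (\<beta> y) = y"
      using A(1) that unfolding i_def autotopism_def bij_betw_def by simp
    then show ?thesis using s(1)[of "\<beta> y"] that autotopismD(2)[OF A(1)] by (simp add: \<sigma>_def)
  qed
  ultimately show thesis using that by blast
qed

end

section \<open>The factor loop over the nucleus\<close>

definition center :: "('a, 'b) monoid_scheme \<Rightarrow> 'a set"
  where "center Q = {a \<in> nucleus Q. \<forall>x \<in> carrier Q. a \<otimes>\<^bsub>Q\<^esub> x = x \<otimes>\<^bsub>Q\<^esub> a}"

text \<open>Factor loops are handled through the projection homomorphism; unfolding them into sets of cosets
  would hide it.\<close>

declare mult_FactGroup [simp del] one_FactGroup [simp del] carrier_FactGroup [simp del]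

context buchsteiner_loop
begin

abbreviation N where "N \<equiv> nucleus Q"

lemma N_carrier: "n \<in> N \<Longrightarrow> n \<in> carrier Q"
  by (rule nucleusD)

lemma N_one: "\<one> \<in> N"
  by (rule nucleus_if_left) auto

lemma N_mult:
  assumes "m \<in> N" "n \<in> N"
  shows "m \<otimes> n \<in> N"
proof (rule nucleus_if_left)
  fix x y assume xy: "x \<in> carrier Q" "y \<in> carrier Q"
  have "(m \<otimes> n) \<otimes> (x \<otimes> y) = m \<otimes> ((n \<otimes> x) \<otimes> y)"
    using nucleusD(3)[OF assms(2), of m "x \<otimes> y"] nucleusD(2)[OF assms(2), of x y] xy assms N_carrier by simp
  also have "\<dots> = (m \<otimes> (n \<otimes> x)) \<otimes> y"
    using nucleusD(2)[OF assms(1), of "n \<otimes> x" y] xy assms N_carrier by simp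
  also have "m \<otimes> (n \<otimes> x) = (m \<otimes> n) \<otimes> x"
    using nucleusD(2)[OF assms(1), of n x] xy assms N_carrier by simp
  finally show "(m \<otimes> n) \<otimes> (x \<otimes> y) = ((m \<otimes> n) \<otimes> x) \<otimes> y" .
qed (use assms N_carrier in auto)

lemma N_ldiv:
  assumes "m \<in> N" "n \<in> N"
  shows "m \<setminus> n \<in> N"
proof (rule nucleus_if_left)
  note mn = N_carrier[OF assms(1)] N_carrier[OF assms(2)]
  fix x y assume xy: "x \<in> carrier Q" "y \<in> carrier Q"
  have "m \<otimes> ((m \<setminus> n) \<otimes> (x \<otimes> y)) = n \<otimes> (x \<otimes> y)"
    using nucleusD(2)[OF assms(1), of "m \<setminus> n" "x \<otimes> y"] xy mn by simp
  moreover have "m \<otimes> (((m \<setminus> n) \<otimes> x) \<otimes> y) = (n \<otimes> x) \<otimes> y"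
    using nucleusD(2)[OF assms(1), of "(m \<setminus> n) \<otimes> x" y] nucleusD(2)[OF assms(1), of "m \<setminus> n" x] xy mn by simp
  ultimately show "(m \<setminus> n) \<otimes> (x \<otimes> y) = ((m \<setminus> n) \<otimes> x) \<otimes> y"
    using nucleusD(2)[OF assms(2), of x y] xy mn by (metis l_cancel m_closed ldiv_closed)
qed (use assms N_carrier in auto)

lemma N_rdiv:
  assumes "m \<in> N" "n \<in> N"
  shows "m \<div> n \<in> N"
proof -
  have i: "n \<setminus> \<one> \<in> N" using N_ldiv[OF assms(2) N_one] .
  have "m \<otimes> (n \<setminus> \<one>) \<otimes> n = m \<otimes> ((n \<setminus> \<one>) \<otimes> n)"
    using nucleusD(3)[OF i, of m n] assms N_carrier by simp
  also have "(n \<setminus> \<one>) \<otimes> n = \<one>"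
    using nucleusD(2)[OF assms(2), of "n \<setminus> \<one>" n] N_carrier[OF assms(2)] N_carrier[OF i]
    by (metis l_cancel l_one m_closed mult_ldiv one_closed r_one)
  finally have "m \<div> n = m \<otimes> (n \<setminus> \<one>)"
    using assms N_carrier i by (intro rdiv_eqI) auto
  then show ?thesis using N_mult[OF assms(1) i] by simp
qed

text \<open>The autotopisms \<open>(L\<^sub>n, id, L\<^sub>n)\<close> with \<open>n\<close> nuclear are those with trivial second component,
  hence conjugation by Buchsteiner's autotopism preserves this family.\<close>

lemma N_conj:
  assumes n: "n \<in> N" and x: "x \<in> carrier Q"
  shows "(x \<otimes> n) \<div> x \<in> N" and "x \<setminus> (n \<otimes> x) \<in> N"
proof -
  note nQ = N_carrier[OF n]
  note nl = nucleusD(2)[OF n]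
  have ndiv: "(n \<otimes> w) \<div> x = n \<otimes> (w \<div> x)" if "w \<in> carrier Q" for w
    using nl[of "w \<div> x" x] that x nQ by simp
  define T where "T u = x \<otimes> (n \<otimes> (x \<setminus> u))" for u
  have TQ: "T u \<in> carrier Q" if "u \<in> carrier Q" for u
    using that x nQ by (simp add: T_def)
  have T: "T u \<otimes> v = T (u \<otimes> v)" if uv: "u \<in> carrier Q" "v \<in> carrier Q" for u v
  proof -
    define y where "y = x \<setminus> u"
    have y: "y \<in> carrier Q" "x \<otimes> y = u" using uv x by (auto simp: y_def)
    have "T u \<otimes> v = (x \<otimes> (n \<otimes> y)) \<otimes> ((v \<otimes> x) \<div> x)"
      using uv x by (simp add: T_def y_def)
    also have "\<dots> = x \<otimes> (n \<otimes> ((y \<otimes> (v \<otimes> x)) \<div> x))"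
      using buchsteiner_mult[of x "n \<otimes> y" "v \<otimes> x"] ndiv[of "y \<otimes> (v \<otimes> x)"] nl[of y "v \<otimes> x"] uv x nQ y by simp
    also have "x \<otimes> ((y \<otimes> (v \<otimes> x)) \<div> x) = u \<otimes> v"
      using buchsteiner_mult[of x y "v \<otimes> x"] uv x y by simp
    then have "(y \<otimes> (v \<otimes> x)) \<div> x = x \<setminus> (u \<otimes> v)"
      using uv x y by (metis ldiv_mult m_closed rdiv_closed)
    finally show ?thesis by (simp add: T_def)
  qed
  have T1: "T u = T \<one> \<otimes> u" if "u \<in> carrier Q" for u
    using T[of \<one> u] that by simp
  have "T \<one> = (x \<otimes> n) \<div> x"
    using T1[of x] x nQ TQ[of \<one>] by (simp add: T_def rdiv_eqI)
  moreover have "T \<one> \<in> N"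
  proof (rule nucleus_if_left)
    fix u v assume uv: "u \<in> carrier Q" "v \<in> carrier Q"
    show "T \<one> \<otimes> (u \<otimes> v) = (T \<one> \<otimes> u) \<otimes> v"
      using T[OF uv] T1[of u] T1[of "u \<otimes> v"] uv by simp
  qed (use TQ in simp)
  ultimately show "(x \<otimes> n) \<div> x \<in> N" by simp
  define S where "S u = x \<setminus> (n \<otimes> (x \<otimes> u))" for u
  have SQ: "S u \<in> carrier Q" if "u \<in> carrier Q" for u
    using that x nQ by (simp add: S_def)
  have S: "S u \<otimes> v = S ((u \<otimes> v) \<div> x) \<otimes> x" if uv: "u \<in> carrier Q" "v \<in> carrier Q" for u v
  proof -
    have "S u \<otimes> v = (x \<setminus> (n \<otimes> ((x \<otimes> u) \<otimes> (v \<div> x)))) \<otimes> x"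
      using autotopismD(4)[OF autotopism_B_inv[OF x], of "n \<otimes> (x \<otimes> u)" "v \<div> x"] nl[of "x \<otimes> u" "v \<div> x"] uv x nQ
      by (simp add: S_def)
    also have "(x \<otimes> u) \<otimes> (v \<div> x) = x \<otimes> ((u \<otimes> v) \<div> x)"
      using buchsteiner_mult uv x by simp
    finally show ?thesis by (simp add: S_def)
  qed
  have S': "S u \<otimes> v = S \<one> \<otimes> (u \<otimes> v)" if uv: "u \<in> carrier Q" "v \<in> carrier Q" for u v
    using S[OF uv] S[of \<one> "u \<otimes> v"] uv x by simp
  have S1: "S u = S \<one> \<otimes> u" if "u \<in> carrier Q" for u
    using S'[OF that one_closed] that SQ by simp
  have "S \<one> \<in> N"
  proof (rule nucleus_if_left)
    fix u v assume uv: "u \<in> carrier Q" "v \<in> carrier Q"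
    show "S \<one> \<otimes> (u \<otimes> v) = (S \<one> \<otimes> u) \<otimes> v"
      using S'[OF uv] S1[of u] uv by simp
  qed (use SQ in simp)
  then show "x \<setminus> (n \<otimes> x) \<in> N" using x nQ by (simp add: S_def)
qed

lemma N_normal: "normal_subloop N Q"
proof -
  have sub: "subloop N Q"
    unfolding subloop_def by (simp add: subset_iff N_carrier N_one N_mult N_ldiv N_rdiv)
  have 1: "x <# N = N #> x" if x: "x \<in> carrier Q" for x
  proof
    show "x <# N \<subseteq> N #> x"
    proof
      fix w assume "w \<in> x <# N"
      then obtain n where n: "n \<in> N" "w = x \<otimes> n" by (auto simp: l_coset_def)
      then have "w = ((x \<otimes> n) \<div> x) \<otimes> x" using x N_carrier by simp
      then show "w \<in> N #> x" using N_conj(1)[OF n(1) x] by (auto simp: r_coset_def)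
    qed
    show "N #> x \<subseteq> x <# N"
    proof
      fix w assume "w \<in> N #> x"
      then obtain n where n: "n \<in> N" "w = n \<otimes> x" by (auto simp: r_coset_def)
      then have "w = x \<otimes> (x \<setminus> (n \<otimes> x))" using x N_carrier by simp
      then show "w \<in> x <# N" using N_conj(2)[OF n(1) x] by (auto simp: l_coset_def)
    qed
  qed
  have 2: "x <# (y <# N) = (x \<otimes> y) <# N" "(N #> x) #> y = N #> (x \<otimes> y)"
    if "x \<in> carrier Q" "y \<in> carrier Q" for x y
  proof -
    have "x \<otimes> (y \<otimes> n) = (x \<otimes> y) \<otimes> n" "(n \<otimes> x) \<otimes> y = n \<otimes> (x \<otimes> y)" if "n \<in> N" for n
      using nucleusD(2,4)[OF that] \<open>x \<in> carrier Q\<close> \<open>y \<in> carrier Q\<close> by simp_all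
    then show "x <# (y <# N) = (x \<otimes> y) <# N" "(N #> x) #> y = N #> (x \<otimes> y)"
      unfolding l_coset_def r_coset_def by simp_all
  qed
  show ?thesis unfolding normal_subloop_def using sub 1 2 by blast
qed

abbreviation \<pi> where "\<pi> x \<equiv> N #> x"
abbreviation Q\<^sub>N where "Q\<^sub>N \<equiv> Q Mod N"

lemma pi_closed [simp]: "x \<in> carrier Q \<Longrightarrow> \<pi> x \<in> carrier Q\<^sub>N"
  by (auto simp: FactGroup_def RCOSETS_def)

lemma pi_cases:
  assumes "X \<in> carrier Q\<^sub>N"
  obtains x where "x \<in> carrier Q" "X = \<pi> x"
  using assms by (auto simp: FactGroup_def RCOSETS_def)

lemma pi_mult: "\<lbrakk>x \<in> carrier Q; y \<in> carrier Q\<rbrakk> \<Longrightarrow> \<pi> (x \<otimes> y) = \<pi> x \<otimes>\<^bsub>Q\<^sub>N\<^esub> \<pi> y"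
  by (simp add: FactGroup_def r_coset_mult[OF N_normal])

lemma pi_one: "\<pi> \<one> = \<one>\<^bsub>Q\<^sub>N\<^esub>"
  using N_carrier by (force simp: FactGroup_def r_coset_def)

lemma pi_eq_iff:
  assumes "x \<in> carrier Q" "y \<in> carrier Q"
  shows "\<pi> x = \<pi> y \<longleftrightarrow> (\<exists>n \<in> N. x = y \<otimes> n)"
proof -
  have "\<pi> x = \<pi> y \<longleftrightarrow> x \<in> y <# N"
    using r_coset_eq_iff[OF N_normal assms] r_coset_iff[of N y x] N_carrier assms
      normal_subloopD(1)[OF N_normal assms(2)] by blast
  also have "x \<in> y <# N \<longleftrightarrow> (\<exists>n \<in> N. x = y \<otimes> n)" by (auto simp: l_coset_def)
  finally show ?thesis .
qed

lemma pi_eq_one_iff: "x \<in> carrier Q \<Longrightarrow> \<pi> x = \<one>\<^bsub>Q\<^sub>N\<^esub> \<longleftrightarrow> x \<in> N"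
  unfolding pi_one[symmetric] using pi_eq_iff[of x \<one>] N_carrier by auto

lemma pi_eqE:
  assumes "\<pi> x = \<pi> y" "x \<in> carrier Q" "y \<in> carrier Q"
  obtains n where "n \<in> N" "x = y \<otimes> n"
  using assms pi_eq_iff by blast

lemma pi_mult_N: "\<lbrakk>x \<in> carrier Q; n \<in> N\<rbrakk> \<Longrightarrow> \<pi> (x \<otimes> n) = \<pi> x"
  using pi_eq_iff[of "x \<otimes> n" x] N_carrier by auto

lemma Q\<^sub>N_loop: "loop Q\<^sub>N"
proof
  show "\<one>\<^bsub>Q\<^sub>N\<^esub> \<in> carrier Q\<^sub>N" by (simp flip: pi_one)
next
  fix X Y assume "X \<in> carrier Q\<^sub>N" "Y \<in> carrier Q\<^sub>N"
  then obtain x y where xy: "x \<in> carrier Q" "y \<in> carrier Q" "X = \<pi> x" "Y = \<pi> y"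
    by (metis pi_cases)
  then show "X \<otimes>\<^bsub>Q\<^sub>N\<^esub> Y \<in> carrier Q\<^sub>N" by (simp flip: pi_mult)
  show "\<exists>!Z. Z \<in> carrier Q\<^sub>N \<and> X \<otimes>\<^bsub>Q\<^sub>N\<^esub> Z = Y"
  proof (rule ex1I[of _ "\<pi> (x \<setminus> y)"])
    fix Z assume "Z \<in> carrier Q\<^sub>N \<and> X \<otimes>\<^bsub>Q\<^sub>N\<^esub> Z = Y"
    then obtain z where z: "z \<in> carrier Q" "Z = \<pi> z" "\<pi> (x \<otimes> z) = \<pi> y"
      using xy by (metis pi_cases pi_mult)
    then obtain n where n: "n \<in> N" "x \<otimes> z = y \<otimes> n"
      using pi_eqE[OF z(3)] xy by auto
    have "x \<otimes> ((x \<setminus> y) \<otimes> n) = y \<otimes> n"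
      using nucleusD(4)[OF n(1)] xy by simp
    then have "z = (x \<setminus> y) \<otimes> n"
      using n z xy N_carrier by (metis ldiv_closed ldiv_mult m_closed)
    then show "Z = \<pi> (x \<setminus> y)" using z xy n by (simp add: pi_mult_N)
  qed (use xy in \<open>simp flip: pi_mult\<close>)
  show "\<exists>!Z. Z \<in> carrier Q\<^sub>N \<and> Z \<otimes>\<^bsub>Q\<^sub>N\<^esub> X = Y"
  proof (rule ex1I[of _ "\<pi> (y \<div> x)"])
    fix Z assume "Z \<in> carrier Q\<^sub>N \<and> Z \<otimes>\<^bsub>Q\<^sub>N\<^esub> X = Y"
    then obtain z where z: "z \<in> carrier Q" "Z = \<pi> z" "\<pi> (z \<otimes> x) = \<pi> y"
      using xy by (metis pi_cases pi_mult)
    then have "z \<otimes> x \<in> N #> y"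
      using r_coset_eq_iff[OF N_normal, of "z \<otimes> x" y] r_coset_iff[of N y "z \<otimes> x"] N_carrier xy by auto
    then obtain n where n: "n \<in> N" "z \<otimes> x = n \<otimes> y" by (auto simp: r_coset_def)
    have "(n \<otimes> (y \<div> x)) \<otimes> x = n \<otimes> y"
      using nucleusD(2)[OF n(1), of "y \<div> x" x] xy by simp
    then have "z = n \<otimes> (y \<div> x)"
      using n z xy N_carrier by (metis rdiv_closed mult_rdiv m_closed)
    moreover have "\<pi> n = \<one>\<^bsub>Q\<^sub>N\<^esub>" using n pi_eq_one_iff N_carrier by blast
    ultimately show "Z = \<pi> (y \<div> x)"
      using z xy n N_carrier pi_mult[of \<one> "y \<div> x"] pi_mult[of n "y \<div> x"] by (simp add: pi_one)
  qed (use xy in \<open>simp flip: pi_mult\<close>)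
next
  fix X assume "X \<in> carrier Q\<^sub>N"
  then obtain x where x: "x \<in> carrier Q" "X = \<pi> x" by (rule pi_cases)
  then show "\<one>\<^bsub>Q\<^sub>N\<^esub> \<otimes>\<^bsub>Q\<^sub>N\<^esub> X = X" "X \<otimes>\<^bsub>Q\<^sub>N\<^esub> \<one>\<^bsub>Q\<^sub>N\<^esub> = X"
    by (simp_all flip: pi_one pi_mult)
qed

lemma pi_ldiv: "\<lbrakk>x \<in> carrier Q; y \<in> carrier Q\<rbrakk> \<Longrightarrow> \<pi> (x \<setminus> y) = ldiv Q\<^sub>N (\<pi> x) (\<pi> y)"
  by (rule sym, rule loop.ldiv_eqI[OF Q\<^sub>N_loop]) (simp_all flip: pi_mult)

lemma pi_rdiv: "\<lbrakk>x \<in> carrier Q; y \<in> carrier Q\<rbrakk> \<Longrightarrow> \<pi> (y \<div> x) = rdiv Q\<^sub>N (\<pi> y) (\<pi> x)"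
  by (rule sym, rule loop.rdiv_eqI[OF Q\<^sub>N_loop]) (simp_all flip: pi_mult)

lemma Q\<^sub>N_buchsteiner: "buchsteiner_loop Q\<^sub>N"
proof (intro buchsteiner_loop.intro Q\<^sub>N_loop buchsteiner_loop_axioms.intro)
  fix X Y Z assume "X \<in> carrier Q\<^sub>N" "Y \<in> carrier Q\<^sub>N" "Z \<in> carrier Q\<^sub>N"
  then obtain x y z where xyz: "x \<in> carrier Q" "y \<in> carrier Q" "z \<in> carrier Q"
    and "X = \<pi> x" "Y = \<pi> y" "Z = \<pi> z"
    by (metis pi_cases)
  then show "ldiv Q\<^sub>N X ((X \<otimes>\<^bsub>Q\<^sub>N\<^esub> Y) \<otimes>\<^bsub>Q\<^sub>N\<^esub> Z) = rdiv Q\<^sub>N (Y \<otimes>\<^bsub>Q\<^sub>N\<^esub> (Z \<otimes>\<^bsub>Q\<^sub>N\<^esub> X)) X"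
    using buchsteiner[OF xyz] by (simp flip: pi_mult pi_ldiv pi_rdiv)
qed

lemmas pi_hom = pi_mult pi_ldiv pi_rdiv pi_one

section \<open>Inner mappings and the centre of the factor loop\<close>

text \<open>As \<open>\<alpha>\<close> fixes \<open>1\<close>, the first autotopism is \<open>(\<alpha>, R\<^sub>b\<alpha>, R\<^sub>b\<alpha>)\<close> with \<open>b = \<beta> 1\<close> and the second is
  \<open>(L\<^sub>c\<alpha>, \<alpha>, L\<^sub>c\<alpha>)\<close> with \<open>c = \<delta> 1\<close>.  Two pairs of autotopisms with equal first components, compared by
  \<open>autotopism_ratio\<close>, show that \<open>b\<close> and \<open>c\<close> agree modulo the nucleus and that \<open>b\<close> commutes there with
  every element.  The autotopisms then say \<open>U(Vb) = (bU)V\<close>, so \<open>b\<close> is middle nuclear modulo the nucleus.\<close>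

lemma central_mod_nucleus:
  assumes X: "autotopism \<alpha> \<beta> \<gamma>" and Y: "autotopism \<delta> \<alpha>' \<epsilon>"
    and eq: "\<And>x. x \<in> carrier Q \<Longrightarrow> \<alpha>' x = \<alpha> x" and \<alpha>1: "\<alpha> \<one> = \<one>"
  shows "\<pi> (\<beta> \<one>) \<in> center Q\<^sub>N"
proof -
  interpret K: buchsteiner_loop Q\<^sub>N by (rule Q\<^sub>N_buchsteiner)
  define b where "b = \<beta> \<one>"
  define c where "c = \<delta> \<one>"
  have \<alpha>Q: "\<alpha> x \<in> carrier Q" if "x \<in> carrier Q" for x by (rule autotopismD(1)[OF X that])
  have bc: "b \<in> carrier Q" "c \<in> carrier Q"
    unfolding b_def c_def by (rule autotopismD[OF X one_closed] autotopismD[OF Y one_closed])+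
  have b: "\<alpha> (x \<otimes> y) \<otimes> b = \<alpha> x \<otimes> (\<alpha> y \<otimes> b)" "\<beta> y = \<alpha> y \<otimes> b"
    if xy: "x \<in> carrier Q" "y \<in> carrier Q" for x y
  proof -
    have \<gamma>: "\<gamma> z = \<alpha> z \<otimes> b" if "z \<in> carrier Q" for z
      using autotopismD(4)[OF X that one_closed] that by (simp add: b_def)
    show \<beta>: "\<beta> y = \<alpha> y \<otimes> b"
      using autotopismD(4)[OF X one_closed xy(2)] \<gamma>[of y] xy \<alpha>1 autotopismD(2)[OF X xy(2)] by simp
    show "\<alpha> (x \<otimes> y) \<otimes> b = \<alpha> x \<otimes> (\<alpha> y \<otimes> b)"
      using autotopismD(4)[OF X xy] \<gamma>[of "x \<otimes> y"] \<beta> xy by simp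
  qed
  have c: "c \<otimes> \<alpha> (x \<otimes> y) = (c \<otimes> \<alpha> x) \<otimes> \<alpha> y" "\<delta> x = c \<otimes> \<alpha> x"
    if xy: "x \<in> carrier Q" "y \<in> carrier Q" for x y
  proof -
    have \<epsilon>: "\<epsilon> z = c \<otimes> \<alpha> z" if "z \<in> carrier Q" for z
      using autotopismD(4)[OF Y one_closed that] that by (simp add: c_def eq)
    show \<delta>: "\<delta> x = c \<otimes> \<alpha> x"
      using autotopismD(4)[OF Y xy(1) one_closed] \<epsilon>[of x] xy \<alpha>1 autotopismD(1)[OF Y xy(1)] by (simp add: eq)
    show "c \<otimes> \<alpha> (x \<otimes> y) = (c \<otimes> \<alpha> x) \<otimes> \<alpha> y"
      using autotopismD(4)[OF Y xy] \<epsilon>[of "x \<otimes> y"] \<delta> xy by (simp add: eq)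
  qed
  \<comment> \<open>both \<open>B\<^sub>c X\<close> and \<open>Y\<close> have first component \<open>L\<^sub>c\<alpha>\<close>\<close>
  obtain n where n: "n \<in> N" "\<And>y. y \<in> carrier Q \<Longrightarrow> \<alpha>' y = (\<beta> y \<div> c) \<otimes> n"
    using autotopism_ratio[OF autotopism_comp[OF autotopism_B[OF bc(2)] X] Y] c(2)[OF _ one_closed] by metis
  have "\<pi> (b \<div> c) = \<one>\<^bsub>Q\<^sub>N\<^esub>"
    using n(2)[of \<one>] \<alpha>1 eq pi_mult_N[OF _ n(1), of "b \<div> c"] bc by (simp add: b_def pi_one)
  then have pbc: "\<pi> b = \<pi> c"
    using bc pi_rdiv[of c b] by (metis K.l_one K.rdiv_mult pi_closed)
  have comm: "\<pi> (\<alpha> z) \<otimes>\<^bsub>Q\<^sub>N\<^esub> \<pi> b = \<pi> b \<otimes>\<^bsub>Q\<^sub>N\<^esub> \<pi> (\<alpha> z)" if z: "z \<in> carrier Q" for z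
  proof -
    have cz: "c \<otimes> \<alpha> z \<in> carrier Q" using bc z \<alpha>Q by simp
    \<comment> \<open>both \<open>X B\<^sub>z\<close> and \<open>B\<^sub>c\<^sup>-\<^sup>1 B\<^bsub>c\<alpha>(z)\<^esub> X\<close> have first component \<open>\<alpha>L\<^sub>z\<close>\<close>
    obtain m where m: "m \<in> N"
      "\<And>y. y \<in> carrier Q \<Longrightarrow> (\<beta> y \<div> (c \<otimes> \<alpha> z)) \<otimes> c = \<beta> (y \<div> z) \<otimes> m"
      using autotopism_ratio[OF autotopism_comp[OF X autotopism_B[OF z]]
          autotopism_comp[OF autotopism_B_inv[OF bc(2)] autotopism_comp[OF autotopism_B[OF cz] X]]]
        c(1)[OF z] bc z \<alpha>Q by (smt (verit) ldiv_mult m_closed)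
    have "((\<alpha> z \<otimes> b) \<div> (c \<otimes> \<alpha> z)) \<otimes> c = b \<otimes> m"
      using m(2)[OF z] b(2)[OF z z] z by (simp add: b_def)
    then have "\<pi> (((\<alpha> z \<otimes> b) \<div> (c \<otimes> \<alpha> z)) \<otimes> c) = \<pi> b"
      using pi_mult_N[OF bc(1) m(1)] by simp
    then have "rdiv Q\<^sub>N (\<pi> (\<alpha> z) \<otimes>\<^bsub>Q\<^sub>N\<^esub> \<pi> b) (\<pi> b \<otimes>\<^bsub>Q\<^sub>N\<^esub> \<pi> (\<alpha> z)) \<otimes>\<^bsub>Q\<^sub>N\<^esub> \<pi> b = \<one>\<^bsub>Q\<^sub>N\<^esub> \<otimes>\<^bsub>Q\<^sub>N\<^esub> \<pi> b"
      using bc z \<alpha>Q by (simp add: pi_hom pbc)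
    then have "rdiv Q\<^sub>N (\<pi> (\<alpha> z) \<otimes>\<^bsub>Q\<^sub>N\<^esub> \<pi> b) (\<pi> b \<otimes>\<^bsub>Q\<^sub>N\<^esub> \<pi> (\<alpha> z)) = \<one>\<^bsub>Q\<^sub>N\<^esub>"
      using bc z \<alpha>Q by (subst (asm) K.r_cancel) simp_all
    then show ?thesis
      using bc z \<alpha>Q K.rdiv_mult[of "\<pi> b \<otimes>\<^bsub>Q\<^sub>N\<^esub> \<pi> (\<alpha> z)" "\<pi> (\<alpha> z) \<otimes>\<^bsub>Q\<^sub>N\<^esub> \<pi> b"] by simp
  qed
  have surj: "\<exists>x \<in> carrier Q. W = \<pi> (\<alpha> x)" if "W \<in> carrier Q\<^sub>N" for W
    using that by (metis X autotopism_surj pi_cases)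
  have mid: "U \<otimes>\<^bsub>Q\<^sub>N\<^esub> (\<pi> b \<otimes>\<^bsub>Q\<^sub>N\<^esub> V) = (U \<otimes>\<^bsub>Q\<^sub>N\<^esub> \<pi> b) \<otimes>\<^bsub>Q\<^sub>N\<^esub> V"
    if UV: "U \<in> carrier Q\<^sub>N" "V \<in> carrier Q\<^sub>N" for U V
  proof -
    obtain x y where xy: "x \<in> carrier Q" "y \<in> carrier Q" "U = \<pi> (\<alpha> x)" "V = \<pi> (\<alpha> y)"
      using surj UV by metis
    have "U \<otimes>\<^bsub>Q\<^sub>N\<^esub> (V \<otimes>\<^bsub>Q\<^sub>N\<^esub> \<pi> b) = \<pi> (\<alpha> (x \<otimes> y)) \<otimes>\<^bsub>Q\<^sub>N\<^esub> \<pi> b"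
      using b(1)[OF xy(1,2)] xy bc \<alpha>Q by (simp flip: pi_mult)
    also have "\<dots> = \<pi> c \<otimes>\<^bsub>Q\<^sub>N\<^esub> \<pi> (\<alpha> (x \<otimes> y))" using comm[of "x \<otimes> y"] xy pbc by simp
    also have "\<dots> = (\<pi> b \<otimes>\<^bsub>Q\<^sub>N\<^esub> U) \<otimes>\<^bsub>Q\<^sub>N\<^esub> V"
      using c(1)[OF xy(1,2)] xy bc \<alpha>Q pbc by (simp flip: pi_mult)
    finally show ?thesis using comm xy by simp
  qed
  have "\<pi> b \<in> nucleus Q\<^sub>N" by (rule K.nucleus_if_middle) (use bc mid in auto)
  then show ?thesis
    unfolding center_def b_def[symmetric] using comm surj by fastforce
qed

end

definition (in loop) assoc :: "'a \<Rightarrow> 'a \<Rightarrow> 'a \<Rightarrow> 'a"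
  where "assoc x y z = (x \<otimes> (y \<otimes> z)) \<setminus> ((x \<otimes> y) \<otimes> z)"

lemma (in loop) assoc_closed [simp]:
  "\<lbrakk>x \<in> carrier Q; y \<in> carrier Q; z \<in> carrier Q\<rbrakk> \<Longrightarrow> assoc x y z \<in> carrier Q"
  by (simp add: assoc_def)

lemma (in loop) mult_assoc:
  "\<lbrakk>x \<in> carrier Q; y \<in> carrier Q; z \<in> carrier Q\<rbrakk> \<Longrightarrow> (x \<otimes> (y \<otimes> z)) \<otimes> assoc x y z = (x \<otimes> y) \<otimes> z"
  by (simp add: assoc_def)

context buchsteiner_loop
begin

definition inner :: "'a \<Rightarrow> 'a \<Rightarrow> 'a \<Rightarrow> 'a"
  where "inner x y z = (x \<otimes> y) \<setminus> (x \<otimes> (y \<otimes> z))"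

lemma inner_closed [simp]:
  "\<lbrakk>x \<in> carrier Q; y \<in> carrier Q; z \<in> carrier Q\<rbrakk> \<Longrightarrow> inner x y z \<in> carrier Q"
  by (simp add: inner_def)

text \<open>The inner mapping \<open>L\<^bsub>xy\<^esub>\<^sup>-\<^sup>1L\<^sub>xL\<^sub>y\<close> is also \<open>R\<^sub>x\<^sup>-\<^sup>1R\<^sub>y\<^sup>-\<^sup>1R\<^bsub>xy\<^esub>\<close>.  Left translations are first components of
  autotopisms and inverse right translations second components, so it has both roles.\<close>

lemma inner_right:
  assumes xyz: "x \<in> carrier Q" "y \<in> carrier Q" "z \<in> carrier Q"
  shows "inner x y z = ((z \<otimes> (x \<otimes> y)) \<div> y) \<div> x"
proof -
  define v where "v = ((z \<otimes> (x \<otimes> y)) \<div> y) \<div> x"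
  have v: "v \<in> carrier Q" "(v \<otimes> x) \<otimes> y = z \<otimes> (x \<otimes> y)" using xyz by (simp_all add: v_def)
  have "(y \<otimes> z) \<otimes> x = y \<otimes> ((z \<otimes> (x \<otimes> y)) \<div> y)"
    using buchsteiner_mult[of y z "x \<otimes> y"] xyz by simp
  also have "(z \<otimes> (x \<otimes> y)) \<div> y = v \<otimes> x" using xyz by (simp add: v_def)
  finally have "(y \<otimes> (v \<otimes> x)) \<div> x = y \<otimes> z" using xyz v by (intro rdiv_eqI) simp_all
  then have "(x \<otimes> y) \<otimes> v = x \<otimes> (y \<otimes> z)"
    using buchsteiner_mult[of x y "v \<otimes> x"] xyz v by simp
  then show ?thesis unfolding inner_def v_def[symmetric] using xyz v by (intro ldiv_eqI) simp_all
qed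

text \<open>The loop has the weak inverse property exactly when all these elements are \<open>1\<close>.\<close>

definition defect :: "'a \<Rightarrow> 'a \<Rightarrow> 'a"
  where "defect x y = ((\<one> \<div> y) \<div> x) \<otimes> (x \<otimes> y)"

lemma defect_closed [simp]: "\<lbrakk>x \<in> carrier Q; y \<in> carrier Q\<rbrakk> \<Longrightarrow> defect x y \<in> carrier Q"
  by (simp add: defect_def)

lemma inner_one: "\<lbrakk>x \<in> carrier Q; y \<in> carrier Q\<rbrakk> \<Longrightarrow> inner x y \<one> = \<one>"
  by (simp add: inner_def)

lemma inner_mult: "\<lbrakk>x \<in> carrier Q; y \<in> carrier Q; z \<in> carrier Q\<rbrakk> \<Longrightarrow> (x \<otimes> y) \<otimes> inner x y z = x \<otimes> (y \<otimes> z)"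
  by (simp add: inner_def)

lemma autotopism_cong:
  assumes "autotopism \<alpha> \<beta> \<gamma>"
    and "\<And>x. x \<in> carrier Q \<Longrightarrow> \<alpha>' x = \<alpha> x" "\<And>x. x \<in> carrier Q \<Longrightarrow> \<beta>' x = \<beta> x"
    and "\<And>x. x \<in> carrier Q \<Longrightarrow> \<gamma>' x = \<gamma> x"
  shows "autotopism \<alpha>' \<beta>' \<gamma>'"
  using assms bij_betw_cong[of "carrier Q" \<alpha>' \<alpha>] bij_betw_cong[of "carrier Q" \<beta>' \<beta>]
    bij_betw_cong[of "carrier Q" \<gamma>' \<gamma>]
  unfolding autotopism_def by simp

lemma inner_autotopism1:
  assumes xy: "x \<in> carrier Q" "y \<in> carrier Q"
  obtains \<gamma> where "autotopism (inner x y) (\<lambda>z. ((z \<div> y) \<div> x) \<otimes> (x \<otimes> y)) \<gamma>"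
  by (rule that, rule autotopism_cong[OF autotopism_comp[OF autotopism_B_inv[OF m_closed[OF xy]]
    autotopism_comp[OF autotopism_B[OF xy(1)] autotopism_B[OF xy(2)]]]])
    (simp_all add: inner_def)

lemma inner_autotopism2:
  assumes xy: "x \<in> carrier Q" "y \<in> carrier Q"
  obtains \<gamma> where "autotopism (\<lambda>z. x \<otimes> (y \<otimes> ((x \<otimes> y) \<setminus> z))) (inner x y) \<gamma>"
  by (rule that, rule autotopism_cong[OF autotopism_comp[OF autotopism_B[OF xy(1)]
    autotopism_comp[OF autotopism_B[OF xy(2)] autotopism_B_inv[OF m_closed[OF xy]]]]])
    (simp_all add: inner_right xy)

lemma defect_central:
  assumes "x \<in> carrier Q" "y \<in> carrier Q"
  shows "\<pi> (defect x y) \<in> center Q\<^sub>N"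
  using inner_autotopism1[OF assms] inner_autotopism2[OF assms] central_mod_nucleus inner_one[OF assms]
  unfolding defect_def by (metis one_closed)

lemma defect_eq:
  assumes "x \<in> carrier Q" "y \<in> carrier Q" "z \<in> carrier Q"
  shows "((z \<div> y) \<div> x) \<otimes> (x \<otimes> y) = inner x y z \<otimes> defect x y"
proof -
  obtain \<gamma> where A: "autotopism (inner x y) (\<lambda>z. ((z \<div> y) \<div> x) \<otimes> (x \<otimes> y)) \<gamma>"
    using inner_autotopism1[OF assms(1,2)] .
  show ?thesis
    using autotopismD(4)[OF A assms(3) one_closed] autotopismD(4)[OF A one_closed assms(3)] assms
    by (simp add: defect_def inner_one)
qed

lemma inner_autotopism_eq:
  assumes xy: "x \<in> carrier Q" "y \<in> carrier Q" and z: "z \<in> carrier Q" and w: "w \<in> carrier Q"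
  shows "inner x y (z \<otimes> w) \<otimes> defect x y = inner x y z \<otimes> (inner x y w \<otimes> defect x y)"
proof -
  obtain \<gamma> where A: "autotopism (inner x y) (\<lambda>z. ((z \<div> y) \<div> x) \<otimes> (x \<otimes> y)) \<gamma>"
    using inner_autotopism1[OF xy] .
  have \<gamma>: "\<gamma> z = inner x y z \<otimes> defect x y" if "z \<in> carrier Q" for z
    using autotopismD(4)[OF A that one_closed] that by (simp add: defect_def)
  show ?thesis using autotopismD(4)[OF A z w] \<gamma>[of "z \<otimes> w"] defect_eq[OF xy w] z w by simp
qed

text \<open>The defect is the companion of the pseudoautomorphism \<open>inner x y\<close>; a nuclear companion is harmless.\<close>

lemma inner_hom:
  assumes xy: "x \<in> carrier Q" "y \<in> carrier Q" and d: "defect x y \<in> N"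
    and zw: "z \<in> carrier Q" "w \<in> carrier Q"
  shows "inner x y (z \<otimes> w) = inner x y z \<otimes> inner x y w"
  using inner_autotopism_eq[OF xy zw] nucleusD(4)[OF d, of "inner x y z" "inner x y w"] xy zw by simp

lemma double_left_inverse:
  assumes "x \<in> carrier Q"
  shows "x \<otimes> ((x \<setminus> \<one>) \<otimes> x) = \<one> \<div> (\<one> \<div> x)"
  using buchsteiner_mult[of x "(x \<setminus> \<one>) \<otimes> x" \<one>] assms by (intro sym[OF rdiv_eqI]) simp_all

lemma bij_inverse: "bij_betw (\<lambda>x. x \<setminus> \<one>) (carrier Q) (carrier Q)" "bij_betw (\<lambda>x. \<one> \<div> x) (carrier Q) (carrier Q)"
  by (rule bij_betwI[of _ _ _ "\<lambda>x. \<one> \<div> x"] bij_betwI[of _ _ _ "\<lambda>x. x \<setminus> \<one>"]; simp)+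

end

lemma (in buchsteiner_loop) center_ldiv_one:
  assumes "a \<in> center Q"
  shows "a \<setminus> \<one> \<in> center Q" "\<one> \<div> a = a \<setminus> \<one>"
proof -
  have a: "a \<in> nucleus Q" "a \<in> carrier Q" "\<And>x. x \<in> carrier Q \<Longrightarrow> a \<otimes> x = x \<otimes> a"
    using assms N_carrier unfolding center_def by auto
  have i: "a \<setminus> \<one> \<in> nucleus Q" using N_ldiv[OF a(1) N_one] .
  have "(a \<setminus> \<one>) \<otimes> x = x \<otimes> (a \<setminus> \<one>)" if x: "x \<in> carrier Q" for x
  proof -
    have "a \<otimes> ((a \<setminus> \<one>) \<otimes> x) = x"
      using nucleusD(2)[OF a(1), of "a \<setminus> \<one>" x] x a by simp
    moreover have "a \<otimes> (x \<otimes> (a \<setminus> \<one>)) = x"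
      using nucleusD(2)[OF a(1), of x "a \<setminus> \<one>"] nucleusD(3)[OF a(1), of x "a \<setminus> \<one>"] x a by simp
    ultimately show ?thesis using a x by (metis l_cancel ldiv_closed m_closed one_closed)
  qed
  then show "a \<setminus> \<one> \<in> center Q" using i by (simp add: center_def)
  show "\<one> \<div> a = a \<setminus> \<one>" using a(3)[of "a \<setminus> \<one>"] a(2) by (intro rdiv_eqI) simp_all
qed

section \<open>The weak inverse property\<close>

text \<open>With trivial defects, an equation \<open>uv = w\<close> is equivalent to \<open>v(w\<setminus>1) = u\<setminus>1\<close>, which permutes the three
  places cyclically.\<close>

context buchsteiner_loop
begin

context
  assumes wip: "\<And>x y. \<lbrakk>x \<in> carrier Q; y \<in> carrier Q\<rbrakk> \<Longrightarrow> defect x y = \<one>"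
begin

lemma wip_left:
  assumes "x \<in> carrier Q" "y \<in> carrier Q"
  shows "(\<one> \<div> (x \<otimes> y)) \<otimes> x = \<one> \<div> y"
proof -
  have "\<one> \<div> (x \<otimes> y) = (\<one> \<div> y) \<div> x"
    using wip[OF assms] assms by (intro rdiv_eqI) (simp_all add: defect_def)
  then show ?thesis using assms by simp
qed

lemma wip_right:
  assumes "x \<in> carrier Q" "y \<in> carrier Q"
  shows "y \<otimes> ((x \<otimes> y) \<setminus> \<one>) = x \<setminus> \<one>"
proof -
  define u where "u = (x \<otimes> y) \<setminus> \<one>"
  have u: "u \<in> carrier Q" "\<one> \<div> u = x \<otimes> y" using assms by (simp_all add: u_def)
  have "(\<one> \<div> (y \<otimes> u)) \<otimes> y = x \<otimes> y" using wip_left[OF assms(2) u(1)] u by simp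
  then have "\<one> \<div> (y \<otimes> u) = x" using assms u by simp
  then have "x \<otimes> (y \<otimes> u) = \<one>" using rdiv_mult[of "y \<otimes> u" \<one>] assms u by simp
  then show ?thesis using assms u by (simp add: u_def[symmetric] ldiv_eqI)
qed

text \<open>The cyclic symmetry of the relation \<open>uv = w\<close> acts on the components of an autotopism.\<close>

lemma autotopism_rotate:
  assumes A: "autotopism \<alpha> \<beta> \<gamma>"
  shows "autotopism \<beta> (\<lambda>x. \<gamma> (\<one> \<div> x) \<setminus> \<one>) (\<lambda>x. \<alpha> (\<one> \<div> x) \<setminus> \<one>)" (is ?l)
    and "autotopism (\<lambda>x. \<one> \<div> \<gamma> (x \<setminus> \<one>)) \<alpha> (\<lambda>x. \<one> \<div> \<beta> (x \<setminus> \<one>))" (is ?r)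
proof -
  have bij: "bij_betw \<alpha> (carrier Q) (carrier Q)" "bij_betw \<beta> (carrier Q) (carrier Q)" "bij_betw \<gamma> (carrier Q) (carrier Q)"
    using A by (simp_all add: autotopism_def)
  have c1: "bij_betw (\<lambda>x. \<delta> (\<one> \<div> x) \<setminus> \<one>) (carrier Q) (carrier Q)"
    and c2: "bij_betw (\<lambda>x. \<one> \<div> \<delta> (x \<setminus> \<one>)) (carrier Q) (carrier Q)"
    if "bij_betw \<delta> (carrier Q) (carrier Q)" for \<delta> :: "'a \<Rightarrow> 'a"
    using bij_betw_trans[OF bij_betw_trans[OF bij_inverse(2) that] bij_inverse(1)]
      bij_betw_trans[OF bij_betw_trans[OF bij_inverse(1) that] bij_inverse(2)] by (simp_all add: comp_def)
  have "\<beta> v \<otimes> (\<gamma> (\<one> \<div> q) \<setminus> \<one>) = \<alpha> (\<one> \<div> (v \<otimes> q)) \<setminus> \<one>"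
    if vq: "v \<in> carrier Q" "q \<in> carrier Q" for v q
  proof -
    have "\<gamma> (\<one> \<div> q) = \<alpha> (\<one> \<div> (v \<otimes> q)) \<otimes> \<beta> v"
      using autotopismD(4)[OF A, of "\<one> \<div> (v \<otimes> q)" v] wip_left[OF vq] vq by simp
    then show ?thesis using wip_right[of "\<alpha> (\<one> \<div> (v \<otimes> q))" "\<beta> v"] autotopismD[OF A] vq by simp
  qed
  then show ?l unfolding autotopism_def using bij c1 by simp
  have "(\<one> \<div> \<gamma> (p \<setminus> \<one>)) \<otimes> \<alpha> u = \<one> \<div> \<beta> ((p \<otimes> u) \<setminus> \<one>)"
    if pu: "p \<in> carrier Q" "u \<in> carrier Q" for p u
  proof -
    have "\<gamma> (p \<setminus> \<one>) = \<alpha> u \<otimes> \<beta> ((p \<otimes> u) \<setminus> \<one>)"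
      using autotopismD(4)[OF A, of u "(p \<otimes> u) \<setminus> \<one>"] wip_right[OF pu] pu by simp
    then show ?thesis using wip_left[of "\<alpha> u" "\<beta> ((p \<otimes> u) \<setminus> \<one>)"] autotopismD[OF A] pu by simp
  qed
  then show ?r unfolding autotopism_def using bij c2 by simp
qed

text \<open>After rotation, \<open>R\<^sub>x\<^sup>-\<^sup>1L\<^sub>x\<close> is both a first and a second component, so \<open>central_mod_nucleus\<close> applies to it.
  With \<open>Jx = 1/x\<close>, the central element it provides is the inverse of \<open>x(J\<^sup>2x/x)\<close>, and the identity
  \<open>J\<^sup>2x = x((x\<setminus>1)x)\<close> of Buchsteiner loops identifies \<open>x(J\<^sup>2x/x)\<close> with \<open>x\<close>.\<close>

lemma wip_central:
  assumes x: "x \<in> carrier Q"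
  shows "\<pi> x \<in> center Q\<^sub>N"
proof -
  interpret K: buchsteiner_loop Q\<^sub>N by (rule Q\<^sub>N_buchsteiner)
  note B = autotopism_B[OF x]
  define X where "X = \<pi> x"
  have XQ: "X \<in> carrier Q\<^sub>N" using x by (simp add: X_def)
  have "\<pi> ((x \<otimes> ((\<one> \<div> (\<one> \<div> x)) \<div> x)) \<setminus> \<one>) \<in> center Q\<^sub>N"
    using central_mod_nucleus[OF autotopism_comp[OF autotopism_rotate(1)[OF B] B]
        autotopism_comp[OF B autotopism_rotate(2)[OF B]]] x by simp
  then have "ldiv Q\<^sub>N (X \<otimes>\<^bsub>Q\<^sub>N\<^esub> rdiv Q\<^sub>N (rdiv Q\<^sub>N \<one>\<^bsub>Q\<^sub>N\<^esub> (rdiv Q\<^sub>N \<one>\<^bsub>Q\<^sub>N\<^esub> X)) X) \<one>\<^bsub>Q\<^sub>N\<^esub> \<in> center Q\<^sub>N"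
    using x by (simp add: pi_hom X_def)
  then have "rdiv Q\<^sub>N \<one>\<^bsub>Q\<^sub>N\<^esub> (ldiv Q\<^sub>N (X \<otimes>\<^bsub>Q\<^sub>N\<^esub> rdiv Q\<^sub>N (rdiv Q\<^sub>N \<one>\<^bsub>Q\<^sub>N\<^esub> (rdiv Q\<^sub>N \<one>\<^bsub>Q\<^sub>N\<^esub> X)) X) \<one>\<^bsub>Q\<^sub>N\<^esub>) \<in> center Q\<^sub>N"
    using K.center_ldiv_one by metis
  then have e: "X \<otimes>\<^bsub>Q\<^sub>N\<^esub> rdiv Q\<^sub>N (rdiv Q\<^sub>N \<one>\<^bsub>Q\<^sub>N\<^esub> (rdiv Q\<^sub>N \<one>\<^bsub>Q\<^sub>N\<^esub> X)) X \<in> center Q\<^sub>N"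
    using XQ by simp
  define h where "h = X \<otimes>\<^bsub>Q\<^sub>N\<^esub> rdiv Q\<^sub>N (rdiv Q\<^sub>N \<one>\<^bsub>Q\<^sub>N\<^esub> (rdiv Q\<^sub>N \<one>\<^bsub>Q\<^sub>N\<^esub> X)) X"
  have h: "h \<in> nucleus Q\<^sub>N" "h \<in> carrier Q\<^sub>N" "\<And>y. y \<in> carrier Q\<^sub>N \<Longrightarrow> h \<otimes>\<^bsub>Q\<^sub>N\<^esub> y = y \<otimes>\<^bsub>Q\<^sub>N\<^esub> h"
    using e K.N_carrier unfolding h_def center_def by auto
  define i where "i = ldiv Q\<^sub>N X \<one>\<^bsub>Q\<^sub>N\<^esub>"
  have i: "i \<in> carrier Q\<^sub>N" "X \<otimes>\<^bsub>Q\<^sub>N\<^esub> i = \<one>\<^bsub>Q\<^sub>N\<^esub>" using XQ by (simp_all add: i_def)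
  have "X \<otimes>\<^bsub>Q\<^sub>N\<^esub> rdiv Q\<^sub>N (rdiv Q\<^sub>N \<one>\<^bsub>Q\<^sub>N\<^esub> (rdiv Q\<^sub>N \<one>\<^bsub>Q\<^sub>N\<^esub> X)) X = X \<otimes>\<^bsub>Q\<^sub>N\<^esub> (i \<otimes>\<^bsub>Q\<^sub>N\<^esub> h)"
    using nucleusD h_def K.nucleusD(4)[OF h(1) XQ i(1)] i h XQ by simp
  then have "rdiv Q\<^sub>N (rdiv Q\<^sub>N \<one>\<^bsub>Q\<^sub>N\<^esub> (rdiv Q\<^sub>N \<one>\<^bsub>Q\<^sub>N\<^esub> X)) X = i \<otimes>\<^bsub>Q\<^sub>N\<^esub> h"
    using XQ i h by (subst (asm) K.l_cancel) simp_all
  then have "rdiv Q\<^sub>N \<one>\<^bsub>Q\<^sub>N\<^esub> (rdiv Q\<^sub>N \<one>\<^bsub>Q\<^sub>N\<^esub> X) = (i \<otimes>\<^bsub>Q\<^sub>N\<^esub> h) \<otimes>\<^bsub>Q\<^sub>N\<^esub> X"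
    using XQ K.rdiv_mult[of X "rdiv Q\<^sub>N \<one>\<^bsub>Q\<^sub>N\<^esub> (rdiv Q\<^sub>N \<one>\<^bsub>Q\<^sub>N\<^esub> X)"] by simp
  also have "\<dots> = h \<otimes>\<^bsub>Q\<^sub>N\<^esub> (i \<otimes>\<^bsub>Q\<^sub>N\<^esub> X)"
    using h(3)[OF i(1)] K.nucleusD(2)[OF h(1) i(1) XQ] by simp
  finally have "X \<otimes>\<^bsub>Q\<^sub>N\<^esub> (i \<otimes>\<^bsub>Q\<^sub>N\<^esub> X) = h \<otimes>\<^bsub>Q\<^sub>N\<^esub> (i \<otimes>\<^bsub>Q\<^sub>N\<^esub> X)"
    using K.double_left_inverse[OF XQ] by (simp add: i_def)
  then have "X = h" using XQ i h by (subst (asm) K.r_cancel) simp_all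
  then show ?thesis using e h_def X_def by simp
qed

lemma wip_assoc_nuclear:
  assumes "x \<in> carrier Q" "y \<in> carrier Q" "z \<in> carrier Q"
  shows "assoc x y z \<in> N"
proof -
  interpret K: buchsteiner_loop Q\<^sub>N by (rule Q\<^sub>N_buchsteiner)
  have "\<pi> x \<in> nucleus Q\<^sub>N" using wip_central[OF assms(1)] by (simp add: center_def)
  then have "\<pi> ((x \<otimes> y) \<otimes> z) = \<pi> (x \<otimes> (y \<otimes> z))"
    using K.nucleusD(2)[of "\<pi> x" "\<pi> y" "\<pi> z"] assms by (simp add: pi_hom)
  then have "\<pi> (assoc x y z) = \<one>\<^bsub>Q\<^sub>N\<^esub>" using assms by (simp add: assoc_def pi_ldiv)
  then show ?thesis using pi_eq_one_iff assms by simp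
qed

end

end

section \<open>The associator calculus\<close>

text \<open>With these rules the method \<open>algebra\<close> normalizes sums in abelian groups.\<close>

lemmas (in abelian_group) [algebra abelian_group "zero R" "add R" "a_inv R" "a_minus R"] =
  a_closed zero_closed a_inv_closed minus_closed l_zero r_zero a_assoc l_neg r_neg a_comm a_lcomm
  r_neg1 r_neg2 minus_add minus_minus minus_eq

text \<open>The rules obeyed by associators \<open>f x y z\<close> with values in the centre \<open>R\<close> of the nucleus, acted on by \<open>Q\<close>:
  additivity in the third argument holds because inner mappings are automorphisms, \<open>f_rot\<close> is the
  Buchsteiner law, and \<open>f_pent\<close> compares the five bracketings of four factors.\<close>

locale associator_module = R: abelian_group R + Q: loop Q
  for R :: "('m, 'r) ring_scheme" (structure) and Q :: "('q, 's) monoid_scheme" +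
  fixes act :: "'m \<Rightarrow> 'q \<Rightarrow> 'm" (infixl "\<bullet>" 75) and f :: "'q \<Rightarrow> 'q \<Rightarrow> 'q \<Rightarrow> 'm"
  assumes act_closed [simp]: "\<lbrakk>a \<in> carrier R; x \<in> carrier Q\<rbrakk> \<Longrightarrow> a \<bullet> x \<in> carrier R"
    and act_add: "\<lbrakk>a \<in> carrier R; b \<in> carrier R; x \<in> carrier Q\<rbrakk> \<Longrightarrow> (a \<oplus> b) \<bullet> x = a \<bullet> x \<oplus> b \<bullet> x"
    and act_mult: "\<lbrakk>a \<in> carrier R; x \<in> carrier Q; y \<in> carrier Q\<rbrakk> \<Longrightarrow> a \<bullet> (x \<otimes>\<^bsub>Q\<^esub> y) = a \<bullet> x \<bullet> y"
    and act_one: "a \<in> carrier R \<Longrightarrow> a \<bullet> \<one>\<^bsub>Q\<^esub> = a"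
    and f_closed [simp]: "\<lbrakk>x \<in> carrier Q; y \<in> carrier Q; z \<in> carrier Q\<rbrakk> \<Longrightarrow> f x y z \<in> carrier R"
    and f_mult3: "\<lbrakk>x \<in> carrier Q; y \<in> carrier Q; z \<in> carrier Q; w \<in> carrier Q\<rbrakk> \<Longrightarrow>
      f x y (z \<otimes>\<^bsub>Q\<^esub> w) = f x y w \<oplus> f x y z \<bullet> w"
    and f_rot: "\<lbrakk>x \<in> carrier Q; y \<in> carrier Q; z \<in> carrier Q\<rbrakk> \<Longrightarrow> f y z x = \<ominus> (f x y z \<bullet> x)"
    and f_pent: "\<lbrakk>x \<in> carrier Q; y \<in> carrier Q; z \<in> carrier Q; w \<in> carrier Q\<rbrakk> \<Longrightarrow>
      f (x \<otimes>\<^bsub>Q\<^esub> y) z w \<oplus> f x y w = f y z w \<oplus> f x (y \<otimes>\<^bsub>Q\<^esub> z) w"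
begin

abbreviation Qmult (infixl "\<star>" 80) where "x \<star> y \<equiv> x \<otimes>\<^bsub>Q\<^esub> y"

declare Q.m_closed [simp] Q.one_closed [simp] Q.l_one [simp] Q.r_one [simp] Q.ldiv_closed [simp]
  Q.rdiv_closed [simp] Q.mult_ldiv [simp] Q.rdiv_mult [simp] Q.ldiv_mult [simp] Q.mult_rdiv [simp]

lemma eq_by_diff: "\<lbrakk>a \<ominus> b = \<zero>; a \<in> carrier R; b \<in> carrier R\<rbrakk> \<Longrightarrow> a = b"
  by (metis R.add.inv_closed R.minus_eq R.minus_equality R.minus_minus)

lemma neg_zero [simp]: "\<ominus> \<zero> = \<zero>"
  using R.minus_equality[of \<zero> \<zero>] by simp

lemma diff_self [simp]: "a \<in> carrier R \<Longrightarrow> a \<ominus> a = \<zero>"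
  by (simp add: R.minus_eq R.r_neg)

lemma act_zero [simp]: "x \<in> carrier Q \<Longrightarrow> \<zero> \<bullet> x = \<zero>"
  using act_add[of \<zero> \<zero> x] R.add.r_cancel_one[of "\<zero> \<bullet> x" "\<zero> \<bullet> x"] by simp

lemma act_neg: "\<lbrakk>a \<in> carrier R; x \<in> carrier Q\<rbrakk> \<Longrightarrow> (\<ominus> a) \<bullet> x = \<ominus> (a \<bullet> x)"
  using act_add[of "\<ominus> a" a x] by (simp add: R.l_neg R.minus_equality)

lemma act_minus: "\<lbrakk>a \<in> carrier R; b \<in> carrier R; x \<in> carrier Q\<rbrakk> \<Longrightarrow> (a \<ominus> b) \<bullet> x = a \<bullet> x \<ominus> b \<bullet> x"
  by (simp add: R.minus_eq act_add act_neg)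

lemmas act_simps = act_add act_neg act_minus act_mult

lemma act_inverse: "\<lbrakk>a \<in> carrier R; x \<in> carrier Q\<rbrakk> \<Longrightarrow> a \<bullet> x \<bullet> ldiv Q x \<one>\<^bsub>Q\<^esub> = a"
  using act_mult[of a x "ldiv Q x \<one>\<^bsub>Q\<^esub>"] by (simp add: act_one)

lemma act_cancel: "\<lbrakk>a \<bullet> x = b \<bullet> x; a \<in> carrier R; b \<in> carrier R; x \<in> carrier Q\<rbrakk> \<Longrightarrow> a = b"
  using act_inverse by metis

lemma f_mult1_twisted:
  assumes Q: "x \<in> carrier Q" "y \<in> carrier Q" "z \<in> carrier Q" "w \<in> carrier Q"
  shows "f (x \<star> y) z w \<bullet> x \<bullet> y = f y z w \<bullet> y \<oplus> f x z w \<bullet> x \<bullet> y"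
proof -
  have "\<ominus> (f (x \<star> y) z w \<bullet> (x \<star> y)) = f z w y \<oplus> f z w x \<bullet> y"
    using f_mult3[of z w x y] f_rot[of "x \<star> y" z w] Q by simp
  also have "\<dots> = \<ominus> (f y z w \<bullet> y \<oplus> f x z w \<bullet> x \<bullet> y)"
    using f_rot[of y z w] f_rot[of x z w] Q by (simp add: act_simps R.minus_add)
  finally show ?thesis
    using Q by (metis R.a_closed R.minus_minus act_closed act_mult f_closed Q.m_closed)
qed

lemma f_mult2_twisted:
  assumes Q: "x \<in> carrier Q" "y \<in> carrier Q" "z \<in> carrier Q" "w \<in> carrier Q"
  shows "f y (z \<star> w) x = f y w x \<ominus> f x y z \<bullet> w \<bullet> x"
  using f_rot[of x y "z \<star> w"] f_mult3[of x y z w] f_rot[of x y w] Q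
  by (simp add: act_simps R.minus_add R.minus_eq)

text \<open>The rotation rule turns additivity in the third argument into additivity in the other two, at the
  price of extra twists; substituting both into the pentagon leaves this relation.\<close>

lemma f_exchange_twisted:
  assumes Q: "x \<in> carrier Q" "y \<in> carrier Q" "z \<in> carrier Q" "w \<in> carrier Q"
  shows "f w y z \<bullet> w \<ominus> f w y z \<bullet> w \<bullet> x = f w x y \<bullet> z \<bullet> w \<bullet> x \<ominus> f w x y \<bullet> w \<bullet> x"
proof -
  have 1: "f (x \<star> y) z w = f y z w \<oplus> f x z w \<ominus> f w x y \<bullet> z \<bullet> w \<oplus> f w x y \<bullet> w"
  proof -
    have a: "f x (y \<star> z) w = f x z w \<ominus> f w x y \<bullet> z \<bullet> w" using f_mult2_twisted[of w x y z] Q by simp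
    have b: "f x y w = \<ominus> (f w x y \<bullet> w)" using f_rot[of w x y] Q by simp
    have c: "f (x \<star> y) z w = (f (x \<star> y) z w \<oplus> f x y w) \<ominus> f x y w"
      using Q R.add.inv_solve_right by (simp add: R.minus_eq R.a_assoc R.r_neg)
    show ?thesis
      apply (subst c, subst f_pent[OF Q], subst a, subst b)
      using Q f_closed act_closed by algebra
  qed
  have 2: "(f y z w \<oplus> f x z w \<ominus> f w x y \<bullet> z \<bullet> w \<oplus> f w x y \<bullet> w) \<bullet> x \<bullet> y = (f y z w \<oplus> f x z w \<bullet> x) \<bullet> y"
    using f_mult1_twisted[OF Q, unfolded 1] Q by (simp add: act_simps)
  have 3: "(f y z w \<oplus> f x z w \<ominus> f w x y \<bullet> z \<bullet> w \<oplus> f w x y \<bullet> w) \<bullet> x = f y z w \<oplus> f x z w \<bullet> x"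
    by (rule act_cancel[OF 2]) (use Q in simp_all)
  have 4: "f y z w = \<ominus> (f w y z \<bullet> w)" using f_rot[of w y z] Q by simp
  define a where "a = f w y z \<bullet> w"
  define b where "b = f w y z \<bullet> w \<bullet> x"
  define c where "c = f w x y \<bullet> z \<bullet> w \<bullet> x"
  define d where "d = f w x y \<bullet> w \<bullet> x"
  define e where "e = f x z w \<bullet> x"
  have abcd: "a \<in> carrier R" "b \<in> carrier R" "c \<in> carrier R" "d \<in> carrier R" "e \<in> carrier R"
    using Q by (simp_all add: a_def b_def c_def d_def e_def)
  have "\<ominus> b \<oplus> e \<ominus> c \<oplus> d = \<ominus> a \<oplus> e"
    using 3 Q unfolding 4 by (simp add: act_simps a_def b_def c_def d_def e_def)
  then have "(\<ominus> b \<oplus> e \<ominus> c \<oplus> d) \<ominus> (\<ominus> a \<oplus> e) = \<zero>" using abcd by simp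
  also have "(\<ominus> b \<oplus> e \<ominus> c \<oplus> d) \<ominus> (\<ominus> a \<oplus> e) = (a \<ominus> b) \<ominus> (c \<ominus> d)" using abcd by algebra
  finally have "a \<ominus> b = c \<ominus> d" by (rule eq_by_diff) (use abcd in simp_all)
  then show ?thesis by (simp only: a_def b_def c_def d_def)
qed

text \<open>With \<open>w = x\<close>, \<open>p = f w y z\<close> and a suitable associator \<open>g\<close>, the exchange relation reads
  \<open>g\<^sup>z = g + p\<^sup>u - p\<close>.  Acting with \<open>v\<close> expresses \<open>g\<^bsup>zv\<^esup>\<close> by \<open>p\<^bsup>uv\<^esup>\<close>, whereas replacing \<open>z\<close> by \<open>zv\<close> in the
  relation expresses it by \<open>p\<^bsup>vu\<^esup>\<close>.\<close>

lemma f_act_commute: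
  assumes Q: "x \<in> carrier Q" "y \<in> carrier Q" "z \<in> carrier Q" "v \<in> carrier Q" "u \<in> carrier Q"
  shows "f x y z \<bullet> v \<bullet> u = f x y z \<bullet> u \<bullet> v"
proof -
  \<comment> \<open>\<open>t\<close> is chosen such that \<open>w t\<^sup>-\<^sup>1 w\<^sup>-\<^sup>1\<close> acts as \<open>u\<close>\<close>
  define w where "w = x"
  define l where "l = ldiv Q w \<one>\<^bsub>Q\<^esub>"
  define k where "k = (l \<star> u) \<star> w"
  define t where "t = rdiv Q \<one>\<^bsub>Q\<^esub> k"
  have C: "w \<in> carrier Q" "l \<in> carrier Q" "k \<in> carrier Q" "t \<in> carrier Q"
    using Q by (simp_all add: w_def l_def k_def t_def)
  have wl: "a \<bullet> w \<bullet> l = a" if "a \<in> carrier R" for a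
    using act_inverse[OF that C(1)] by (simp add: l_def)
  have tk: "a \<bullet> t \<bullet> k = a" if "a \<in> carrier R" for a
    using act_mult[OF that C(4,3)] that C act_one by (simp add: t_def)
  have wkl: "a \<bullet> w \<bullet> k \<bullet> l = a \<bullet> u" if "a \<in> carrier R" for a
    using that C Q wl by (simp add: k_def act_mult)
  define p where "p = f w y z"
  define g where "g = f w t y"
  have pg: "p \<in> carrier R" "g \<in> carrier R" using Q C by (simp_all add: p_def g_def)
  note T = f_exchange_twisted[OF C(4) Q(2) _ C(1)]
  have T1: "p \<bullet> w \<ominus> p \<bullet> w \<bullet> t = g \<bullet> z \<bullet> w \<bullet> t \<ominus> g \<bullet> w \<bullet> t"
    using T[OF Q(3)] by (simp add: p_def g_def)
  have T2: "f w y v \<bullet> w \<ominus> f w y v \<bullet> w \<bullet> t = g \<bullet> v \<bullet> w \<bullet> t \<ominus> g \<bullet> w \<bullet> t"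
    using T[OF Q(4)] by (simp add: g_def)
  have T3: "(f w y v \<oplus> p \<bullet> v) \<bullet> w \<ominus> (f w y v \<oplus> p \<bullet> v) \<bullet> w \<bullet> t = g \<bullet> z \<bullet> v \<bullet> w \<bullet> t \<ominus> g \<bullet> w \<bullet> t"
    using T[of "z \<star> v"] f_mult3[OF C(1) Q(2) Q(3) Q(4)] pg Q C by (simp add: g_def p_def act_mult)
  \<comment> \<open>the difference of the instances for \<open>zv\<close> and \<open>v\<close>\<close>
  have A: "p \<bullet> v \<bullet> w \<ominus> p \<bullet> v \<bullet> w \<bullet> t = g \<bullet> z \<bullet> v \<bullet> w \<bullet> t \<ominus> g \<bullet> v \<bullet> w \<bullet> t"
  proof (rule eq_by_diff)
    define a where "a = f w y v \<bullet> w"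
    define b where "b = f w y v \<bullet> w \<bullet> t"
    define c where "c = p \<bullet> v \<bullet> w"
    define d where "d = p \<bullet> v \<bullet> w \<bullet> t"
    define e where "e = g \<bullet> z \<bullet> v \<bullet> w \<bullet> t"
    define h where "h = g \<bullet> v \<bullet> w \<bullet> t"
    define i where "i = g \<bullet> w \<bullet> t"
    have cl: "a \<in> carrier R" "b \<in> carrier R" "c \<in> carrier R" "d \<in> carrier R" "e \<in> carrier R"
      "h \<in> carrier R" "i \<in> carrier R"
      using Q C pg by (simp_all add: a_def b_def c_def d_def e_def h_def i_def)
    have "(a \<oplus> c) \<ominus> (b \<oplus> d) = e \<ominus> i"
      using T3 Q C pg by (simp add: act_simps a_def b_def c_def d_def e_def i_def)
    moreover have "a \<ominus> b = h \<ominus> i" using T2 by (simp add: a_def b_def h_def i_def)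
    ultimately have "((a \<oplus> c) \<ominus> (b \<oplus> d) \<ominus> (e \<ominus> i)) \<ominus> (a \<ominus> b \<ominus> (h \<ominus> i)) = \<zero>"
      using cl by simp
    then have "(c \<ominus> d) \<ominus> (e \<ominus> h) = \<zero>" using cl by algebra
    then show "(p \<bullet> v \<bullet> w \<ominus> p \<bullet> v \<bullet> w \<bullet> t) \<ominus> (g \<bullet> z \<bullet> v \<bullet> w \<bullet> t \<ominus> g \<bullet> v \<bullet> w \<bullet> t) = \<zero>"
      by (simp add: c_def d_def e_def h_def)
  qed (use Q C pg in simp_all)
  have B: "g \<bullet> z = g \<oplus> p \<bullet> u \<ominus> p"
  proof -
    have "(p \<bullet> w \<ominus> p \<bullet> w \<bullet> t) \<bullet> k \<bullet> l = (g \<bullet> z \<bullet> w \<bullet> t \<ominus> g \<bullet> w \<bullet> t) \<bullet> k \<bullet> l" using T1 by simp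
    then have "p \<bullet> u \<ominus> p = g \<bullet> z \<ominus> g"
      using pg C Q by (simp add: act_simps wkl tk wl)
    moreover have "g \<bullet> z \<ominus> (g \<oplus> p \<bullet> u \<ominus> p) = (g \<bullet> z \<ominus> g) \<ominus> (p \<bullet> u \<ominus> p)"
      using pg Q act_closed by algebra
    ultimately have "g \<bullet> z \<ominus> (g \<oplus> p \<bullet> u \<ominus> p) = \<zero>" using pg Q by simp
    then show ?thesis by (rule eq_by_diff) (use pg Q in simp_all)
  qed
  have "(p \<bullet> v \<bullet> w \<ominus> p \<bullet> v \<bullet> w \<bullet> t) \<bullet> k \<bullet> l = (g \<bullet> z \<bullet> v \<bullet> w \<bullet> t \<ominus> g \<bullet> v \<bullet> w \<bullet> t) \<bullet> k \<bullet> l" using A by simp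
  then have "p \<bullet> v \<bullet> u \<ominus> p \<bullet> v = g \<bullet> z \<bullet> v \<ominus> g \<bullet> v"
    using pg C Q by (simp add: act_simps wkl tk wl)
  also have "\<dots> = p \<bullet> u \<bullet> v \<ominus> p \<bullet> v"
    unfolding B using pg C Q by (simp add: act_simps) (use pg C Q act_closed in algebra)
  finally have "p \<bullet> v \<bullet> u \<ominus> p \<bullet> v = p \<bullet> u \<bullet> v \<ominus> p \<bullet> v" .
  then show ?thesis using pg Q by (simp add: R.minus_eq p_def w_def)
qed

lemma f_act_commute2:
  assumes Q: "x \<in> carrier Q" "y \<in> carrier Q" "z \<in> carrier Q" "v \<in> carrier Q" "u \<in> carrier Q"
    and t: "t \<in> carrier Q"
  shows "f x y z \<bullet> t \<bullet> v \<bullet> u = f x y z \<bullet> t \<bullet> u \<bullet> v"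
proof -
  have "f x y z \<bullet> t = f x y (z \<star> t) \<ominus> f x y t"
    using f_mult3[OF Q(1-3) t] Q t f_closed act_closed by algebra
  then show ?thesis
    using f_act_commute[OF Q(1,2) _ Q(4,5), of "z \<star> t"] f_act_commute[OF Q(1,2) t Q(4,5)] Q t
    by (simp add: act_simps)
qed

lemma f_act_commute3:
  assumes Q: "x \<in> carrier Q" "y \<in> carrier Q" "z \<in> carrier Q" "v \<in> carrier Q" "u \<in> carrier Q"
    and t: "t \<in> carrier Q" "s \<in> carrier Q"
  shows "f x y z \<bullet> t \<bullet> s \<bullet> v \<bullet> u = f x y z \<bullet> t \<bullet> s \<bullet> u \<bullet> v"
  using f_act_commute2[OF Q, of "t \<star> s"] Q t by (simp add: act_mult)

lemmas f_act_ac = f_act_commute f_act_commute2 f_act_commute3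

text \<open>Since the action of \<open>Q\<close> on associators is commutative, the twists that \<open>f_rot\<close> introduces cancel, and
  the other two arguments are additive in the same form as the third.\<close>

lemma f_mult2:
  assumes "x \<in> carrier Q" "y \<in> carrier Q" "z \<in> carrier Q" "w \<in> carrier Q"
  shows "f x (y \<star> z) w = f x z w \<oplus> f x y w \<bullet> z"
  using f_mult2_twisted[of w x y z] f_rot[of w x y] f_act_commute[of w x y z w] assms
  by (simp add: act_simps R.minus_eq)

lemma f_mult1:
  assumes "x \<in> carrier Q" "y \<in> carrier Q" "z \<in> carrier Q" "w \<in> carrier Q"
  shows "f (x \<star> y) z w = f y z w \<oplus> f x z w \<bullet> y"
  using f_rot[of w "x \<star> y" z] f_rot[of w x z] f_rot[of w y z] f_mult2[of w x y z] f_act_commute[of w x z y w] assms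
  by (simp add: act_simps R.minus_add)

lemma f_twist1:
  assumes Q: "x \<in> carrier Q" "y \<in> carrier Q" "z \<in> carrier Q" "w \<in> carrier Q"
  shows "f y z w \<bullet> x \<oplus> f x z w \<bullet> y \<bullet> x = f y z w \<oplus> f x z w \<bullet> x"
proof -
  have "(f y z w \<bullet> x \<oplus> f x z w \<bullet> y \<bullet> x) \<bullet> y = (f y z w \<oplus> f x z w \<bullet> x) \<bullet> y"
    using f_mult1_twisted[OF Q] f_mult1[OF Q] Q by (simp add: act_simps)
  then show ?thesis by (rule act_cancel) (use Q in simp_all)
qed

lemma f_twist2:
  assumes Q: "x \<in> carrier Q" "y \<in> carrier Q" "z \<in> carrier Q" "w \<in> carrier Q"
  shows "f w y z \<bullet> x \<oplus> f w x z \<bullet> y \<bullet> x = f w y z \<oplus> f w x z \<bullet> x"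
proof -
  have "\<ominus> ((f w y z \<bullet> x \<oplus> f w x z \<bullet> y \<bullet> x) \<bullet> w) = \<ominus> ((f w y z \<oplus> f w x z \<bullet> x) \<bullet> w)"
    using f_twist1[OF Q] f_rot[of w y z] f_rot[of w x z] f_act_ac[of _ _ _ w] Q
    by (simp add: act_simps R.minus_add)
  then have "(f w y z \<bullet> x \<oplus> f w x z \<bullet> y \<bullet> x) \<bullet> w = (f w y z \<oplus> f w x z \<bullet> x) \<bullet> w"
    using Q by (metis R.minus_minus R.a_closed act_closed f_closed)
  then show ?thesis by (rule act_cancel) (use Q in simp_all)
qed

lemma f_exchange12:
  assumes Q: "x \<in> carrier Q" "y \<in> carrier Q" "z \<in> carrier Q" "w \<in> carrier Q"
  shows "f w y z \<ominus> f w y z \<bullet> x = f w x y \<bullet> z \<bullet> x \<ominus> f w x y \<bullet> x"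
proof -
  have "(f w y z \<ominus> f w y z \<bullet> x) \<bullet> w = (f w x y \<bullet> z \<bullet> x \<ominus> f w x y \<bullet> x) \<bullet> w"
    using f_exchange_twisted[OF Q] f_act_commute[of w y z w x] f_act_commute[of w x y w x]
      f_act_commute2[of w x y w x z] Q
    by (simp add: act_simps)
  then show ?thesis by (rule act_cancel) (use Q in simp_all)
qed

text \<open>The two forms of additivity in the second argument (\<open>f_twist2\<close>) and the exchange
  relation (\<open>f_exchange12\<close>) combine to this symmetry, the source of the commutativity of \<open>Q/N\<close>.\<close>

lemma f_sym3:
  assumes Q: "x \<in> carrier Q" "y \<in> carrier Q" "z \<in> carrier Q" "w \<in> carrier Q"
  shows "f x y (z \<star> w) = f x y (w \<star> z)"
proof -
  define a where "a = f x z w"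
  define b where "b = f x y w"
  define c where "c = f x y z"
  have cl: "a \<in> carrier R" "b \<in> carrier R" "c \<in> carrier R" using Q by (simp_all add: a_def b_def c_def)
  have 1: "a \<ominus> a \<bullet> y = c \<bullet> w \<bullet> y \<ominus> c \<bullet> y"
    using f_exchange12[of y z w x] Q by (simp add: a_def c_def)
  have 2: "a \<bullet> y \<oplus> b \<bullet> z \<bullet> y = a \<oplus> b \<bullet> y"
    using f_twist2[of y z w x] Q by (simp add: a_def b_def)
  have "(b \<bullet> y \<oplus> c \<bullet> w \<bullet> y) \<ominus> (c \<bullet> y \<oplus> b \<bullet> z \<bullet> y) =
      \<ominus> (a \<bullet> y \<oplus> b \<bullet> z \<bullet> y \<ominus> (a \<oplus> b \<bullet> y)) \<ominus> (a \<ominus> a \<bullet> y \<ominus> (c \<bullet> w \<bullet> y \<ominus> c \<bullet> y))"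
    using cl Q act_closed by algebra
  also have "\<dots> = \<zero>" unfolding 1 2 using cl Q by (simp add: R.minus_eq R.r_neg)
  finally have "(b \<oplus> c \<bullet> w) \<bullet> y = (c \<oplus> b \<bullet> z) \<bullet> y"
    using cl Q by - (rule eq_by_diff, simp_all add: act_simps)
  then have "b \<oplus> c \<bullet> w = c \<oplus> b \<bullet> z" by (rule act_cancel) (use cl Q in simp_all)
  then show ?thesis using f_mult3[OF Q] f_mult3[OF Q(1,2,4,3)] by (simp add: b_def c_def)
qed

lemma f_sym1:
  assumes Q: "x \<in> carrier Q" "y \<in> carrier Q" "z \<in> carrier Q" "w \<in> carrier Q"
  shows "f (z \<star> w) x y = f (w \<star> z) x y"
proof (rule act_cancel)
  have "\<ominus> (f (z \<star> w) x y \<bullet> z \<bullet> w) = \<ominus> (f (w \<star> z) x y \<bullet> z \<bullet> w)"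
    using f_sym3[OF Q] f_rot[of "z \<star> w" x y] f_rot[of "w \<star> z" x y] f_act_commute[of "w \<star> z" x y z w] Q
    by (simp add: act_mult)
  then show "f (z \<star> w) x y \<bullet> (z \<star> w) = f (w \<star> z) x y \<bullet> (z \<star> w)"
    using Q by (simp add: act_mult) (metis R.minus_minus act_closed f_closed Q.m_closed)
qed (use Q in simp_all)

lemma f_sym2:
  assumes Q: "x \<in> carrier Q" "y \<in> carrier Q" "z \<in> carrier Q" "w \<in> carrier Q"
  shows "f x (z \<star> w) y = f x (w \<star> z) y"
  using f_sym1[OF Q(2,1,3,4)] f_rot[of x "z \<star> w" y] f_rot[of x "w \<star> z" y] Q
  by (metis R.minus_minus Q.m_closed act_cancel act_closed f_closed f_sym1)

lemma f_exchange3: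
  assumes Q: "x \<in> carrier Q" "y \<in> carrier Q" "z \<in> carrier Q" "w \<in> carrier Q"
  shows "f x y w \<oplus> f x y z \<bullet> w = f x y z \<oplus> f x y w \<bullet> z"
  using f_sym3[OF Q] f_mult3[OF Q] f_mult3[OF Q(1,2,4,3)] by simp

lemma f_act_square:
  assumes Q: "x \<in> carrier Q" "y \<in> carrier Q" "z \<in> carrier Q" "w \<in> carrier Q"
  shows "f x y z \<bullet> w \<bullet> w = f x y z"
proof -
  define a where "a = f x y z"
  define b where "b = f w y z"
  have cl: "a \<in> carrier R" "b \<in> carrier R" using Q by (simp_all add: a_def b_def)
  have 1: "a \<oplus> b \<bullet> x = b \<oplus> a \<bullet> w"
    using f_sym1[OF Q(2,3,4,1)] f_mult1[OF Q(4,1,2,3)] f_mult1[OF Q(1,4,2,3)] by (simp add: a_def b_def)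
  have "(a \<oplus> b \<bullet> x) \<bullet> w = (b \<oplus> a \<bullet> w) \<bullet> w" using 1 by simp
  moreover have "a \<bullet> w \<oplus> b \<bullet> x \<bullet> w = a \<oplus> b \<bullet> w"
    using f_twist1[OF Q(4,1,2,3)] by (simp add: a_def b_def)
  ultimately have "b \<bullet> w \<oplus> a = b \<bullet> w \<oplus> a \<bullet> w \<bullet> w"
    using cl Q by (simp add: act_simps R.a_comm)
  then show ?thesis using cl Q by (simp add: a_def)
qed

text \<open>Rotate three times.\<close>

lemma f_cycle:
  assumes Q: "x \<in> carrier Q" "y \<in> carrier Q" "z \<in> carrier Q"
  shows "f x y z \<bullet> x \<bullet> y \<bullet> z = \<ominus> f x y z"
proof -
  have "f z x y = f x y z \<bullet> x \<bullet> y"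
    by (subst f_rot[OF Q(2,3,1)], subst f_rot[OF Q]) (use Q in \<open>simp add: act_simps\<close>)
  then show ?thesis using f_rot[OF Q(3,1,2)] Q by (metis R.minus_minus act_closed f_closed)
qed

text \<open>Associators with a square as an argument are invariant under the action; by \<open>f_cycle\<close> they then have
  order two, and additivity kills the fourth powers.\<close>

lemma f_square_fixed:
  assumes Q: "x \<in> carrier Q" "y \<in> carrier Q" "z \<in> carrier Q" "w \<in> carrier Q"
  shows "f x y (z \<star> z) \<bullet> w = f x y (z \<star> z)"
proof -
  define a where "a = f x y z"
  define b where "b = f x y w"
  have cl: "a \<in> carrier R" "b \<in> carrier R" using Q by (simp_all add: a_def b_def)
  have 1: "b \<oplus> a \<bullet> w = a \<oplus> b \<bullet> z" using f_exchange3[OF Q] by (simp add: a_def b_def)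
  have 2: "b \<bullet> z \<oplus> a \<bullet> z \<bullet> w = a \<bullet> z \<oplus> b"
    using arg_cong[OF 1, of "\<lambda>t. t \<bullet> z"] cl Q f_act_square[OF Q(1,2,4,3)] f_act_commute[OF Q(1,2,3,4,3)]
    by (simp add: act_simps a_def b_def)
  have "(a \<bullet> w \<oplus> a \<bullet> z \<bullet> w) \<ominus> (a \<oplus> a \<bullet> z) =
      (b \<oplus> a \<bullet> w \<ominus> (a \<oplus> b \<bullet> z)) \<oplus> (b \<bullet> z \<oplus> a \<bullet> z \<bullet> w \<ominus> (a \<bullet> z \<oplus> b))"
    using cl Q act_closed by algebra
  also have "\<dots> = \<zero>" unfolding 1 2 using cl Q by simp
  finally have "a \<bullet> w \<oplus> a \<bullet> z \<bullet> w = a \<oplus> a \<bullet> z"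
    by (rule eq_by_diff) (use cl Q in simp_all)
  then show ?thesis using f_mult3[OF Q(1,2,3,3)] cl Q by (simp add: act_simps a_def)
qed

lemma f_square_double:
  assumes Q: "x \<in> carrier Q" "y \<in> carrier Q" "z \<in> carrier Q"
  shows "f x y (z \<star> z) \<oplus> f x y (z \<star> z) = \<zero>"
proof -
  have e: "f x y (z \<star> z) = \<ominus> f x y (z \<star> z)"
    using f_cycle[of x y "z \<star> z"] f_square_fixed[OF Q] Q by simp
  show ?thesis by (subst (2) e) (use Q in \<open>simp add: R.r_neg\<close>)
qed

lemma f_fourth_power:
  assumes Q: "x \<in> carrier Q" "y \<in> carrier Q" "z \<in> carrier Q"
  shows "f x y ((z \<star> z) \<star> (z \<star> z)) = \<zero>"
  using f_mult3[of x y "z \<star> z" "z \<star> z"] f_square_double[OF Q] f_square_fixed[OF Q, of "z \<star> z"] Q by simp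

end

section \<open>Nuclear associators\<close>

context buchsteiner_loop
begin

definition conj :: "'a \<Rightarrow> 'a \<Rightarrow> 'a"
  where "conj n x = x \<setminus> (n \<otimes> x)"

definition Z where "Z = {n \<in> N. \<forall>m \<in> N. n \<otimes> m = m \<otimes> n}"

text \<open>The centre of the nucleus, written additively.\<close>

definition Zmod :: "'a ring"
  where "Zmod = \<lparr>carrier = Z, mult = (\<otimes>), one = \<one>, zero = \<one>, add = (\<otimes>)\<rparr>"

lemma ZN: "n \<in> Z \<Longrightarrow> n \<in> N" and Z_carrier: "n \<in> Z \<Longrightarrow> n \<in> carrier Q"
  and Z_comm: "\<lbrakk>n \<in> Z; m \<in> N\<rbrakk> \<Longrightarrow> n \<otimes> m = m \<otimes> n"
  by (auto simp: Z_def N_carrier)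

lemma conj_N: "\<lbrakk>n \<in> N; x \<in> carrier Q\<rbrakk> \<Longrightarrow> conj n x \<in> N"
  by (simp add: conj_def N_conj)

lemma mult_conj: "\<lbrakk>n \<in> N; x \<in> carrier Q\<rbrakk> \<Longrightarrow> x \<otimes> conj n x = n \<otimes> x"
  by (simp add: conj_def N_carrier)

lemma conj_eqI:
  assumes "x \<otimes> m = n \<otimes> x" "n \<in> N" "x \<in> carrier Q" "m \<in> carrier Q"
  shows "conj n x = m"
  using assms by (simp add: conj_def N_carrier ldiv_eqI)

lemma N_assoc:
  assumes "n \<in> N" "x \<in> carrier Q" "y \<in> carrier Q"
  shows "n \<otimes> x \<otimes> y = n \<otimes> (x \<otimes> y)" "x \<otimes> n \<otimes> y = x \<otimes> (n \<otimes> y)" "x \<otimes> y \<otimes> n = x \<otimes> (y \<otimes> n)"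
  using nucleusD(2-4)[OF assms] by simp_all

lemma conj_add:
  assumes mn: "m \<in> N" "n \<in> N" and x: "x \<in> carrier Q"
  shows "conj (m \<otimes> n) x = conj m x \<otimes> conj n x"
proof (rule conj_eqI)
  note c = mn[THEN N_carrier] conj_N[OF mn(1) x] conj_N[OF mn(2) x]
  have "x \<otimes> (conj m x \<otimes> conj n x) = (x \<otimes> conj m x) \<otimes> conj n x"
    using N_assoc(2)[OF c(3) x N_carrier[OF c(4)]] by simp
  also have "\<dots> = m \<otimes> (x \<otimes> conj n x)"
    using mult_conj[OF mn(1) x] N_assoc(1)[OF mn(1) x N_carrier[OF c(4)]] by simp
  also have "\<dots> = (m \<otimes> n) \<otimes> x"
    using mult_conj[OF mn(2) x] N_assoc(1)[OF mn(1) c(2) x] by simp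
  finally show "x \<otimes> (conj m x \<otimes> conj n x) = (m \<otimes> n) \<otimes> x" .
qed (use mn x N_mult conj_N N_carrier in auto)

lemma conj_mult:
  assumes n: "n \<in> N" and xy: "x \<in> carrier Q" "y \<in> carrier Q"
  shows "conj n (x \<otimes> y) = conj (conj n x) y"
proof (rule conj_eqI)
  note c = conj_N[OF n xy(1)] conj_N[OF conj_N[OF n xy(1)] xy(2)]
  have "x \<otimes> y \<otimes> conj (conj n x) y = x \<otimes> (conj n x \<otimes> y)"
    using N_assoc(3)[OF c(2) xy] mult_conj[OF c(1) xy(2)] by simp
  also have "\<dots> = n \<otimes> (x \<otimes> y)"
    using N_assoc(2)[OF c(1) xy] mult_conj[OF n xy(1)] N_assoc(1)[OF n xy] by simp
  finally show "x \<otimes> y \<otimes> conj (conj n x) y = n \<otimes> (x \<otimes> y)" .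
qed (use n xy conj_N N_carrier in auto)

lemma conj_one: "n \<in> N \<Longrightarrow> conj n \<one> = n"
  by (rule conj_eqI) (simp_all add: N_carrier)

lemma conj_Z:
  assumes n: "n \<in> Z" and x: "x \<in> carrier Q"
  shows "conj n x \<in> Z"
proof -
  have "conj n x \<otimes> m = m \<otimes> conj n x" if m: "m \<in> N" for m
  proof -
    define k where "k = (x \<otimes> m) \<div> x"
    have k: "k \<in> N" unfolding k_def by (rule N_conj(1)[OF m x])
    have "conj k x = m" by (rule conj_eqI) (use k x m N_carrier in \<open>auto simp: k_def\<close>)
    then show ?thesis
      using conj_add[OF ZN[OF n] k x] conj_add[OF k ZN[OF n] x] Z_comm[OF n k] by simp
  qed
  then show ?thesis using conj_N[OF ZN[OF n] x] by (simp add: Z_def)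
qed

lemma conj_Z_N: "\<lbrakk>n \<in> Z; m \<in> N\<rbrakk> \<Longrightarrow> conj n m = n"
  by (rule conj_eqI) (use Z_comm ZN Z_carrier N_carrier in auto)

lemma Z_abelian_group: "abelian_group Zmod"
proof (rule abelian_groupI)
  show "x \<oplus>\<^bsub>Zmod\<^esub> y \<in> carrier Zmod" if "x \<in> carrier Zmod" "y \<in> carrier Zmod" for x y
  proof -
    have xy: "x \<in> Z" "y \<in> Z" using that by (simp_all add: Zmod_def)
    have "x \<otimes> y \<otimes> m = m \<otimes> (x \<otimes> y)" if m: "m \<in> N" for m
    proof -
      note c = xy[THEN ZN] m
      note d = c[THEN N_carrier]
      have "x \<otimes> y \<otimes> m = (x \<otimes> m) \<otimes> y"
        using N_assoc(1)[OF c(1) d(2,3)] N_assoc(1)[OF c(1) d(3,2)] Z_comm[OF xy(2) m] by simp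
      also have "\<dots> = m \<otimes> (x \<otimes> y)"
        using Z_comm[OF xy(1) m] N_assoc(1)[OF c(3) d(1,2)] by simp
      finally show ?thesis .
    qed
    then show ?thesis using xy[THEN ZN] N_mult by (simp add: Zmod_def Z_def)
  qed
  show "\<zero>\<^bsub>Zmod\<^esub> \<in> carrier Zmod" using N_one N_carrier by (simp add: Zmod_def Z_def)
  fix x y z assume "x \<in> carrier Zmod" "y \<in> carrier Zmod" "z \<in> carrier Zmod"
  then have xyz: "x \<in> Z" "y \<in> Z" "z \<in> Z" by (simp_all add: Zmod_def)
  note c = xyz[THEN ZN] xyz[THEN Z_carrier]
  show "x \<oplus>\<^bsub>Zmod\<^esub> y \<oplus>\<^bsub>Zmod\<^esub> z = x \<oplus>\<^bsub>Zmod\<^esub> (y \<oplus>\<^bsub>Zmod\<^esub> z)"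
    using N_assoc(1)[OF c(1) c(5,6)] by (simp add: Zmod_def)
  show "x \<oplus>\<^bsub>Zmod\<^esub> y = y \<oplus>\<^bsub>Zmod\<^esub> x"
    using Z_comm[OF xyz(1) c(2)] by (simp add: Zmod_def)
  show "\<zero>\<^bsub>Zmod\<^esub> \<oplus>\<^bsub>Zmod\<^esub> x = x" using c by (simp add: Zmod_def)
  have i: "x \<setminus> \<one> \<in> N" using N_ldiv[OF c(1) N_one] .
  have "(x \<setminus> \<one>) \<otimes> m = m \<otimes> (x \<setminus> \<one>)" if m: "m \<in> N" for m
  proof -
    have mQ: "m \<in> carrier Q" using m by (rule N_carrier)
    have "x \<otimes> ((x \<setminus> \<one>) \<otimes> m) = m" using N_assoc(1)[OF c(1), of "x \<setminus> \<one>" m] mQ c by simp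
    moreover have "x \<otimes> (m \<otimes> (x \<setminus> \<one>)) = m"
      using N_assoc(1)[OF c(1), of m "x \<setminus> \<one>"] N_assoc(1)[OF m, of x "x \<setminus> \<one>"] Z_comm[OF xyz(1) m] mQ c by simp
    ultimately show ?thesis using c mQ by (metis l_cancel ldiv_closed m_closed one_closed)
  qed
  then have "x \<setminus> \<one> \<in> Z" using i by (simp add: Z_def)
  moreover have "(x \<setminus> \<one>) \<otimes> x = \<one>"
    using Z_comm[OF xyz(1) i] c by simp
  ultimately show "\<exists>y \<in> carrier Zmod. y \<oplus>\<^bsub>Zmod\<^esub> x = \<zero>\<^bsub>Zmod\<^esub>" by (auto simp: Zmod_def)
qed

sublocale Zm: abelian_group Zmod by (rule Z_abelian_group)

lemma Zmod_simps: "carrier Zmod = Z" "x \<oplus>\<^bsub>Zmod\<^esub> y = x \<otimes> y" "\<zero>\<^bsub>Zmod\<^esub> = \<one>"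
  by (simp_all add: Zmod_def)

lemma Z_neg:
  assumes "n \<in> Z"
  shows "\<ominus>\<^bsub>Zmod\<^esub> n = n \<setminus> \<one>"
proof -
  have "n \<otimes> \<ominus>\<^bsub>Zmod\<^esub> n = \<one>" using Zm.r_neg[of n] assms by (simp add: Zmod_simps)
  then show ?thesis using assms Zm.a_inv_closed[of n] Z_carrier by (simp add: Zmod_simps ldiv_eqI)
qed

lemma assoc_eqI:
  assumes "(x \<otimes> (y \<otimes> z)) \<otimes> a = (x \<otimes> y) \<otimes> z"
    and "x \<in> carrier Q" "y \<in> carrier Q" "z \<in> carrier Q" "a \<in> carrier Q"
  shows "assoc x y z = a"
  using assms by (simp add: assoc_def ldiv_eqI)

lemma assoc_N_left:
  assumes n: "n \<in> N" and Q: "x \<in> carrier Q" "y \<in> carrier Q" "z \<in> carrier Q"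
  shows "assoc (n \<otimes> x) y z = assoc x y z"
  by (rule assoc_eqI) (use Q n in \<open>simp_all add: N_carrier N_assoc(1) mult_assoc\<close>)

lemma assoc_N_middle:
  assumes n: "n \<in> N" and Q: "x \<in> carrier Q" "y \<in> carrier Q" "z \<in> carrier Q"
  shows "assoc (x \<otimes> n) y z = assoc x (n \<otimes> y) z" "assoc x (y \<otimes> n) z = assoc x y (n \<otimes> z)"
  using Q n by (simp_all add: assoc_def N_carrier N_assoc(1,2) N_assoc(3)[symmetric])

lemma N_swap:
  assumes n: "n \<in> N" and x: "x \<in> carrier Q"
  obtains m where "m \<in> N" "x \<otimes> n = m \<otimes> x"
  using N_conj(1)[OF assms] assms N_carrier that[of "(x \<otimes> n) \<div> x"] by simp

lemma assoc_N:
  assumes n: "n \<in> N" and Q: "x \<in> carrier Q" "y \<in> carrier Q" "z \<in> carrier Q"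
  shows "assoc (x \<otimes> n) y z = assoc x y z" "assoc x (y \<otimes> n) z = assoc x y z" "assoc x y (z \<otimes> n) = assoc x y z"
proof -
  have 1: "assoc (x \<otimes> n) y z = assoc x y z" if n: "n \<in> N" for n
  proof -
    obtain m where "m \<in> N" "x \<otimes> n = m \<otimes> x" using N_swap[OF n Q(1)] .
    then show ?thesis using assoc_N_left Q by simp
  qed
  have 2: "assoc x (y \<otimes> n) z = assoc x y z" if n: "n \<in> N" for n
  proof -
    obtain m where "m \<in> N" "y \<otimes> n = m \<otimes> y" using N_swap[OF n Q(2)] .
    then show ?thesis using assoc_N_middle(1)[of m x y z] 1 Q by simp
  qed
  have 3: "assoc x y (z \<otimes> n) = assoc x y z"
  proof -
    obtain m where "m \<in> N" "z \<otimes> n = m \<otimes> z" using N_swap[OF n Q(3)] .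
    then show ?thesis using assoc_N_middle(2)[of m x y z] 2 Q by simp
  qed
  show "assoc (x \<otimes> n) y z = assoc x y z" "assoc x (y \<otimes> n) z = assoc x y z" "assoc x y (z \<otimes> n) = assoc x y z"
    using 1 2 3 n by simp_all
qed

lemma assoc_pi_cong:
  assumes eq: "\<pi> x = \<pi> x'" "\<pi> y = \<pi> y'" "\<pi> z = \<pi> z'"
    and Q: "x \<in> carrier Q" "y \<in> carrier Q" "z \<in> carrier Q" "x' \<in> carrier Q" "y' \<in> carrier Q" "z' \<in> carrier Q"
  shows "assoc x y z = assoc x' y' z'"
proof -
  obtain l where l: "l \<in> N" "x = x' \<otimes> l" using pi_eqE[OF eq(1) Q(1,4)] .
  obtain m where m: "m \<in> N" "y = y' \<otimes> m" using pi_eqE[OF eq(2) Q(2,5)] .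
  obtain n where n: "n \<in> N" "z = z' \<otimes> n" using pi_eqE[OF eq(3) Q(3,6)] .
  show ?thesis
    using Q l m n assoc_N(1)[OF l(1), of x' y z] assoc_N(2)[OF m(1), of x' y' z] assoc_N(3)[OF n(1), of x' y' z'] by simp
qed

text \<open>Right multiplication of \<open>z\<close> by \<open>n\<close> does not change the associator, so \<open>n\<close> can be pulled out of
  \<open>xy\<cdot>zn\<close> on either side of it.\<close>

lemma assoc_commute_N:
  assumes n: "n \<in> N" and Q: "x \<in> carrier Q" "y \<in> carrier Q" "z \<in> carrier Q"
  shows "n \<otimes> assoc x y z = assoc x y z \<otimes> n"
proof -
  let ?p = "x \<otimes> (y \<otimes> z)"
  note nQ = N_carrier[OF n]
  have "?p \<otimes> (n \<otimes> assoc x y z) = (x \<otimes> (y \<otimes> (z \<otimes> n))) \<otimes> assoc x y (z \<otimes> n)"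
    using assoc_N(3)[OF n Q] Q nQ by (simp add: N_assoc(2)[OF n, symmetric] N_assoc(3)[OF n, symmetric])
  also have "\<dots> = (x \<otimes> y) \<otimes> (z \<otimes> n)" using Q nQ by (simp add: mult_assoc)
  also have "\<dots> = ?p \<otimes> (assoc x y z \<otimes> n)"
    using Q nQ by (simp add: N_assoc(3)[OF n, symmetric] mult_assoc)
  finally show ?thesis using Q nQ by simp
qed

lemma assoc_in_Z:
  assumes "assoc x y z \<in> N" "x \<in> carrier Q" "y \<in> carrier Q" "z \<in> carrier Q"
  shows "assoc x y z \<in> Z"
  using assoc_commute_N[OF _ assms(2-)] assms(1) by (simp add: Z_def)

lemma inner_mult_assoc:
  assumes "assoc x y z \<in> N" "x \<in> carrier Q" "y \<in> carrier Q" "z \<in> carrier Q"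
  shows "inner x y z \<otimes> assoc x y z = z"
proof -
  have "(x \<otimes> y) \<otimes> (inner x y z \<otimes> assoc x y z) = (x \<otimes> y) \<otimes> z"
    using N_assoc(3)[OF assms(1), of "x \<otimes> y" "inner x y z"] inner_mult assms mult_assoc by simp
  then show ?thesis using assms by simp
qed

text \<open>As \<open>inner x y\<close> is a homomorphism, it suffices to multiply the decompositions
  \<open>z = inner x y z \<cdot> assoc x y z\<close> of the two factors.\<close>

lemma assoc_mult3:
  assumes N: "assoc x y z \<in> N" "assoc x y w \<in> N" and d: "defect x y \<in> N"
    and Q: "x \<in> carrier Q" "y \<in> carrier Q" "z \<in> carrier Q" "w \<in> carrier Q"
  shows "assoc x y (z \<otimes> w) = assoc x y w \<otimes> conj (assoc x y z) w"
proof -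
  define a where "a = assoc x y z"
  define b where "b = assoc x y w"
  define i where "i = inner x y z"
  define j where "j = inner x y w"
  have ab: "a \<in> Z" "b \<in> Z" unfolding a_def b_def using assoc_in_Z N Q by simp_all
  have c: "a \<in> N" "b \<in> N" "a \<in> carrier Q" "b \<in> carrier Q" "i \<in> carrier Q" "j \<in> carrier Q"
    using ab ZN Z_carrier Q by (simp_all add: i_def j_def)
  have zw: "z = i \<otimes> a" "w = j \<otimes> b"
    using inner_mult_assoc N Q by (simp_all add: a_def b_def i_def j_def)
  have ca: "conj a w = conj a j"
    using conj_mult[OF c(1) c(6,4)] conj_Z_N[OF conj_Z[OF ab(1) c(6)] c(2)] zw by simp
  have caN: "conj a j \<in> N" using conj_N c by simp
  have "z \<otimes> w = ((i \<otimes> a) \<otimes> j) \<otimes> b"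
    unfolding zw using N_assoc(3)[OF c(2), of "i \<otimes> a" j] c by simp
  also have "(i \<otimes> a) \<otimes> j = (i \<otimes> j) \<otimes> conj a j"
    using N_assoc(2)[OF c(1), of i j] N_assoc(3)[OF caN, of i j] mult_conj[OF c(1), of j] c by simp
  also have "\<dots> \<otimes> b = (i \<otimes> j) \<otimes> (conj a j \<otimes> b)"
    using N_assoc(3)[OF c(2), of "i \<otimes> j" "conj a j"] c caN N_carrier by simp
  also have "conj a j \<otimes> b = b \<otimes> conj a w" using Z_comm[OF ab(2) caN] ca by simp
  also have "i \<otimes> j = inner x y (z \<otimes> w)" using inner_hom[OF Q(1,2) d Q(3,4)] by (simp add: i_def j_def)
  finally have e: "inner x y (z \<otimes> w) \<otimes> (b \<otimes> conj a w) = z \<otimes> w" by simp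
  have bN: "b \<otimes> conj a w \<in> N" using c conj_N Q by (simp add: N_mult)
  have "(x \<otimes> (y \<otimes> (z \<otimes> w))) \<otimes> (b \<otimes> conj a w) = (x \<otimes> y) \<otimes> (z \<otimes> w)"
    using N_assoc(3)[OF bN, of "x \<otimes> y" "inner x y (z \<otimes> w)"] e inner_mult[of x y "z \<otimes> w"] Q by simp
  then show ?thesis unfolding a_def[symmetric] b_def[symmetric]
    by (rule assoc_eqI) (use Q bN N_carrier in simp_all)
qed

text \<open>The Buchsteiner law with the associator of \<open>x, y, z\<close> inserted on its left-hand side.\<close>

lemma assoc_rotate:
  assumes F: "assoc x y z \<in> N" and Q: "x \<in> carrier Q" "y \<in> carrier Q" "z \<in> carrier Q"
  shows "assoc y z x \<in> N" "assoc y z x = \<ominus>\<^bsub>Zmod\<^esub> (conj (assoc x y z) x)"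
proof -
  define a where "a = assoc x y z"
  define c where "c = conj a x"
  have aZ: "a \<in> Z" unfolding a_def using assoc_in_Z F Q by simp
  have cZ: "c \<in> Z" unfolding c_def using conj_Z aZ Q by simp
  note N = ZN[OF aZ] ZN[OF cZ] Z_carrier[OF aZ] Z_carrier[OF cZ]
  have "x \<setminus> ((x \<otimes> y) \<otimes> z) = (y \<otimes> z) \<otimes> a"
    using mult_assoc[OF Q] N_assoc(3)[OF N(1), of x "y \<otimes> z"] Q N by (intro ldiv_eqI) (simp_all add: a_def)
  then have "((y \<otimes> z) \<otimes> a) \<otimes> x = y \<otimes> (z \<otimes> x)"
    using buchsteiner[OF Q] Q rdiv_mult[of x "y \<otimes> (z \<otimes> x)"] by simp
  moreover have "((y \<otimes> z) \<otimes> a) \<otimes> x = ((y \<otimes> z) \<otimes> x) \<otimes> c"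
    using N_assoc(2)[OF N(1), of "y \<otimes> z" x] N_assoc(3)[OF N(2), of "y \<otimes> z" x] mult_conj[OF N(1) Q(1)] Q by (simp add: c_def)
  ultimately have 1: "(y \<otimes> (z \<otimes> x)) \<otimes> (assoc y z x \<otimes> c) = y \<otimes> (z \<otimes> x)"
    using N_assoc(3)[OF N(2), of "y \<otimes> (z \<otimes> x)" "assoc y z x"] mult_assoc[OF Q(2,3,1)] Q N by simp
  then have "(y \<otimes> (z \<otimes> x)) \<otimes> (assoc y z x \<otimes> c) = (y \<otimes> (z \<otimes> x)) \<otimes> \<one>" using Q by simp
  then have 2: "assoc y z x \<otimes> c = \<one>" by (subst (asm) l_cancel) (use Q N in simp_all)
  have n: "\<ominus>\<^bsub>Zmod\<^esub> c \<in> Z" "\<ominus>\<^bsub>Zmod\<^esub> c \<otimes> c = \<one>"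
    using Zm.a_inv_closed[of c] Zm.l_neg[of c] cZ by (simp_all add: Zmod_simps)
  then have "assoc y z x = \<ominus>\<^bsub>Zmod\<^esub> c" using 2 N Q Z_carrier r_cancel by (metis assoc_closed)
  then show "assoc y z x \<in> N" "assoc y z x = \<ominus>\<^bsub>Zmod\<^esub> (conj (assoc x y z) x)"
    using n ZN by (simp_all add: c_def a_def)
qed

end

text \<open>Every Buchsteiner loop is of this kind (\<open>buchsteiner_nuclear\<close>); until that is established, the calculus
  is needed for factor loops that are already known to have nuclear associators.\<close>

locale nuclear_buchsteiner_loop = buchsteiner_loop +
  assumes assoc_nuclear: "\<lbrakk>x \<in> carrier Q; y \<in> carrier Q; z \<in> carrier Q\<rbrakk> \<Longrightarrow> assoc x y z \<in> N"
begin

lemma assoc_Z: "\<lbrakk>x \<in> carrier Q; y \<in> carrier Q; z \<in> carrier Q\<rbrakk> \<Longrightarrow> assoc x y z \<in> Z"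
  using assoc_in_Z assoc_nuclear by simp

lemma defect_nuclear:
  assumes "x \<in> carrier Q" "y \<in> carrier Q"
  shows "defect x y \<in> N"
proof -
  define p where "p = (\<one> \<div> y) \<div> x"
  have p: "p \<in> carrier Q" "p \<otimes> x \<otimes> y = \<one>" using assms by (simp_all add: p_def)
  then have "\<one> \<div> assoc p x y = defect x y"
    using mult_assoc[of p x y] assms by (intro rdiv_eqI) (simp_all add: defect_def p_def)
  then show ?thesis using N_rdiv[OF N_one assoc_nuclear] p assms by metis
qed

lemma assoc_pentagon:
  assumes Q: "x \<in> carrier Q" "y \<in> carrier Q" "z \<in> carrier Q" "w \<in> carrier Q"
  shows "assoc (x \<otimes> y) z w \<otimes> assoc x y w = assoc y z w \<otimes> assoc x (y \<otimes> z) w"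
proof -
  define p where "p = x \<otimes> (y \<otimes> (z \<otimes> w))"
  define a where "a = conj (assoc x y z) w"
  have p: "p \<in> carrier Q" using Q by (simp add: p_def)
  have Zs: "assoc (x \<otimes> y) z w \<in> Z" "assoc x y w \<in> Z" "assoc y z w \<in> Z" "assoc x (y \<otimes> z) w \<in> Z" "a \<in> Z" "assoc x y (z \<otimes> w) \<in> Z"
    using Q assoc_Z conj_Z by (simp_all add: a_def)
  note Ns = Zs[THEN ZN] and Qs = Zs[THEN Z_carrier]
  have "((x \<otimes> y) \<otimes> z) \<otimes> w = ((x \<otimes> y) \<otimes> (z \<otimes> w)) \<otimes> assoc (x \<otimes> y) z w" using Q by (simp add: mult_assoc)
  also have "(x \<otimes> y) \<otimes> (z \<otimes> w) = p \<otimes> assoc x y (z \<otimes> w)" using Q by (simp add: mult_assoc p_def)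
  also have "\<dots> \<otimes> assoc (x \<otimes> y) z w = p \<otimes> (assoc x y (z \<otimes> w) \<otimes> assoc (x \<otimes> y) z w)"
    using N_assoc(3)[OF Ns(1) p Qs(6)] by simp
  finally have 1: "((x \<otimes> y) \<otimes> z) \<otimes> w = p \<otimes> (assoc x y (z \<otimes> w) \<otimes> assoc (x \<otimes> y) z w)" .
  have "((x \<otimes> y) \<otimes> z) \<otimes> w = (x \<otimes> (y \<otimes> z) \<otimes> assoc x y z) \<otimes> w" using Q by (simp add: mult_assoc)
  also have "\<dots> = (x \<otimes> (y \<otimes> z) \<otimes> w) \<otimes> a"
    using N_assoc(2)[OF assoc_nuclear[OF Q(1-3)], of "x \<otimes> (y \<otimes> z)" w] N_assoc(3)[OF Ns(5), of "x \<otimes> (y \<otimes> z)" w]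
      mult_conj[OF assoc_nuclear[OF Q(1-3)] Q(4)] Q by (simp add: a_def)
  also have "x \<otimes> (y \<otimes> z) \<otimes> w = (x \<otimes> (y \<otimes> z \<otimes> w)) \<otimes> assoc x (y \<otimes> z) w" using Q by (simp add: mult_assoc)
  also have "y \<otimes> z \<otimes> w = (y \<otimes> (z \<otimes> w)) \<otimes> assoc y z w" using Q by (simp add: mult_assoc)
  also have "x \<otimes> ((y \<otimes> (z \<otimes> w)) \<otimes> assoc y z w) = p \<otimes> assoc y z w"
    using N_assoc(3)[OF Ns(3), of x "y \<otimes> (z \<otimes> w)"] Q by (simp add: p_def)
  also have "p \<otimes> assoc y z w \<otimes> assoc x (y \<otimes> z) w \<otimes> a = p \<otimes> (assoc y z w \<otimes> assoc x (y \<otimes> z) w \<otimes> a)"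
    using N_assoc(3)[OF Ns(4) p Qs(3)] N_assoc(3)[OF Ns(5) p, of "assoc y z w \<otimes> assoc x (y \<otimes> z) w"] Qs by simp
  finally have "assoc x y (z \<otimes> w) \<otimes> assoc (x \<otimes> y) z w = assoc y z w \<otimes> assoc x (y \<otimes> z) w \<otimes> a"
    using 1 p Qs by simp
  then have "assoc x y w \<oplus>\<^bsub>Zmod\<^esub> a \<oplus>\<^bsub>Zmod\<^esub> assoc (x \<otimes> y) z w = assoc y z w \<oplus>\<^bsub>Zmod\<^esub> assoc x (y \<otimes> z) w \<oplus>\<^bsub>Zmod\<^esub> a"
    using assoc_mult3[OF _ _ defect_nuclear, of x y z w] assoc_nuclear Q by (simp add: Zmod_simps a_def)
  then have "a \<oplus>\<^bsub>Zmod\<^esub> (assoc (x \<otimes> y) z w \<oplus>\<^bsub>Zmod\<^esub> assoc x y w) = a \<oplus>\<^bsub>Zmod\<^esub> (assoc y z w \<oplus>\<^bsub>Zmod\<^esub> assoc x (y \<otimes> z) w)"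
    using Zs by (simp add: Zm.a_ac flip: Zmod_simps(1))
  then have "assoc (x \<otimes> y) z w \<oplus>\<^bsub>Zmod\<^esub> assoc x y w = assoc y z w \<oplus>\<^bsub>Zmod\<^esub> assoc x (y \<otimes> z) w"
    using Qs by (simp add: Zmod_simps)
  then show ?thesis by (simp add: Zmod_simps)
qed

sublocale F: associator_module Zmod Q conj assoc
proof
  fix a x assume a: "a \<in> carrier Zmod" and x: "x \<in> carrier Q"
  have aZ: "a \<in> Z" using a by (simp add: Zmod_simps)
  show "conj a x \<in> carrier Zmod" using conj_Z[OF aZ x] by (simp add: Zmod_simps)
  show "conj (a \<oplus>\<^bsub>Zmod\<^esub> b) x = conj a x \<oplus>\<^bsub>Zmod\<^esub> conj b x" if "b \<in> carrier Zmod" for b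
    using conj_add[OF ZN[OF aZ] ZN x] that by (simp add: Zmod_simps)
  show "conj a (x \<otimes> y) = conj (conj a x) y" if "y \<in> carrier Q" for y
    by (rule conj_mult[OF ZN[OF aZ] x that])
next
  fix a assume "a \<in> carrier Zmod"
  then show "conj a \<one> = a" using conj_one ZN by (simp add: Zmod_simps)
next
  fix x y z assume Q: "x \<in> carrier Q" "y \<in> carrier Q" "z \<in> carrier Q"
  show "assoc x y z \<in> carrier Zmod" using assoc_Z[OF Q] by (simp add: Zmod_simps)
  show "assoc y z x = \<ominus>\<^bsub>Zmod\<^esub> conj (assoc x y z) x" by (rule assoc_rotate(2)[OF assoc_nuclear[OF Q] Q])
  show "assoc x y (z \<otimes> w) = assoc x y w \<oplus>\<^bsub>Zmod\<^esub> conj (assoc x y z) w" if w: "w \<in> carrier Q" for w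
    using assoc_mult3[OF assoc_nuclear[OF Q] assoc_nuclear[OF Q(1,2) w] defect_nuclear[OF Q(1,2)] Q w]
    by (simp add: Zmod_simps)
  show "assoc (x \<otimes> y) z w \<oplus>\<^bsub>Zmod\<^esub> assoc x y w = assoc y z w \<oplus>\<^bsub>Zmod\<^esub> assoc x (y \<otimes> z) w"
    if w: "w \<in> carrier Q" for w
    using assoc_pentagon[OF Q w] by (simp add: Zmod_simps)
qed

end

section \<open>Associators symmetric in the last two arguments\<close>

context associator_module
begin

text \<open>Comparing the symmetry with two rotations gives the second equation; the third follows by symmetry, and
  the first from \<open>f_cycle\<close>.\<close>

lemma f_symmetric_act:
  assumes sym: "\<And>x y z. \<lbrakk>x \<in> carrier Q; y \<in> carrier Q; z \<in> carrier Q\<rbrakk> \<Longrightarrow> f x y z = f x z y"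
    and Q: "x \<in> carrier Q" "y \<in> carrier Q" "z \<in> carrier Q"
  shows "f x y z \<bullet> x = \<ominus> f x y z" "f x y z \<bullet> y = \<ominus> f x y z" "f x y z \<bullet> z = \<ominus> f x y z"
proof -
  have neg2: "f x y z \<bullet> y = \<ominus> f x y z" if Q: "x \<in> carrier Q" "y \<in> carrier Q" "z \<in> carrier Q" for x y z
  proof (rule act_cancel)
    have "f z x y = f x y z \<bullet> x \<bullet> y"
      by (subst f_rot[OF Q(2,3,1)], subst f_rot[OF Q]) (use Q in \<open>simp add: act_simps\<close>)
    moreover have "f z x y = \<ominus> (f x y z \<bullet> x)"
      using sym[OF Q(3,1,2)] f_rot[OF Q(1,3,2)] sym[OF Q] by simp
    ultimately show "f x y z \<bullet> y \<bullet> x = (\<ominus> f x y z) \<bullet> x"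
      using f_act_commute[OF Q Q(2,1)] Q by (simp add: act_simps)
  qed (use Q in simp_all)
  show 2: "f x y z \<bullet> y = \<ominus> f x y z" by (rule neg2[OF Q])
  show 3: "f x y z \<bullet> z = \<ominus> f x y z" using neg2[OF Q(1,3,2)] sym[OF Q] by simp
  have "f x y z \<bullet> x \<bullet> y \<bullet> z = f x y z \<bullet> y \<bullet> z \<bullet> x"
    using f_act_commute[OF Q Q(1,2)] f_act_commute2[OF Q Q(1,3,2)] by simp
  also have "\<dots> = f x y z \<bullet> x" using Q by (simp add: 2 3 act_neg)
  finally show "f x y z \<bullet> x = \<ominus> f x y z" using f_cycle[OF Q] by simp
qed

text \<open>In the symmetric case \<open>y \<mapsto> f x y (x \<star> y)\<close> is additive.  In general its failure to be so is only
  symmetric in \<open>y\<close> and \<open>z\<close>, by \<open>f_quadratic_comm\<close>.\<close>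

lemma f_symmetric_quadratic:
  assumes sym: "\<And>x y z. \<lbrakk>x \<in> carrier Q; y \<in> carrier Q; z \<in> carrier Q\<rbrakk> \<Longrightarrow> f x y z = f x z y"
    and Q: "x \<in> carrier Q" "y \<in> carrier Q" "z \<in> carrier Q"
  shows "f x y (x \<star> y) \<ominus> f x (y \<star> z) (x \<star> (y \<star> z)) \<oplus> f x z (x \<star> z) = \<zero>"
proof -
  have neg: "f x y z \<bullet> x = \<ominus> f x y z" "f x y z \<bullet> y = \<ominus> f x y z" "f x y z \<bullet> z = \<ominus> f x y z"
    if "x \<in> carrier Q" "y \<in> carrier Q" "z \<in> carrier Q" for x y z
    using f_symmetric_act[OF _ that] sym by simp_all
  define a where "a = f x y y"
  define b where "b = f x y x"
  define c where "c = f x z z"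
  define d where "d = f x z x"
  define e where "e = f x y z"
  have cl: "a \<in> carrier R" "b \<in> carrier R" "c \<in> carrier R" "d \<in> carrier R" "e \<in> carrier R"
    using Q by (simp_all add: a_def b_def c_def d_def e_def)
  have 1: "f x y (x \<star> y) = a \<ominus> b" "f x z (x \<star> z) = c \<ominus> d"
    using f_mult3[of x y x y] f_mult3[of x z x z] neg(2)[of x y x] neg(2)[of x z x] Q
    by (simp_all add: a_def b_def c_def d_def R.minus_eq)
  have bz: "b \<bullet> z = b \<ominus> e \<ominus> e"
  proof -
    have "e \<oplus> b \<bullet> z = b \<ominus> e"
      using f_exchange3[of x y x z] neg(1)[OF Q] Q by (simp add: b_def e_def R.minus_eq)
    moreover have "b \<bullet> z = (e \<oplus> b \<bullet> z) \<ominus> e" using cl Q act_closed by algebra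
    ultimately show ?thesis by simp
  qed
  have xyz: "f x (y \<star> z) x = d \<oplus> b \<bullet> z" using f_mult2[of x y z x] Q by (simp add: b_def d_def)
  have "f x (y \<star> z) z = c \<ominus> e"
    using f_mult3[of x z y z] sym[of x "y \<star> z" z] sym[of x z y] neg(3)[OF Q] Q
    by (simp add: c_def e_def R.minus_eq)
  moreover have "f x (y \<star> z) y = e \<oplus> a \<bullet> z"
    using f_mult3[of x y y z] sym[of x "y \<star> z" y] Q by (simp add: a_def e_def)
  moreover have "(e \<oplus> a \<bullet> z) \<bullet> z = \<ominus> e \<oplus> a"
    using cl Q neg(3)[OF Q] f_act_square[of x y y z] by (simp add: act_simps a_def e_def)
  ultimately have yzyz: "f x (y \<star> z) (y \<star> z) = (c \<ominus> e) \<oplus> (\<ominus> e \<oplus> a)"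
    using f_mult3[of x "y \<star> z" y z] Q by simp
  have "f x (y \<star> z) (x \<star> (y \<star> z)) = f x (y \<star> z) (y \<star> z) \<ominus> f x (y \<star> z) x"
    using f_mult3[of x "y \<star> z" x "y \<star> z"] neg(2)[of x "y \<star> z" x] Q by (simp add: R.minus_eq)
  also have "\<dots> = ((c \<ominus> e) \<oplus> (\<ominus> e \<oplus> a)) \<ominus> (d \<oplus> (b \<ominus> e \<ominus> e))"
    unfolding yzyz xyz bz ..
  finally have 2: "f x (y \<star> z) (x \<star> (y \<star> z)) = ((c \<ominus> e) \<oplus> (\<ominus> e \<oplus> a)) \<ominus> (d \<oplus> (b \<ominus> e \<ominus> e))" .
  show ?thesis unfolding 1 2 using cl by algebra
qed

lemma f_quadratic_comm:
  assumes Q: "x \<in> carrier Q" "y \<in> carrier Q" "z \<in> carrier Q"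
  shows "f x (y \<star> z) (x \<star> (y \<star> z)) = f x (z \<star> y) (x \<star> (z \<star> y))"
proof -
  have "f x (y \<star> z) x = f x (z \<star> y) x" "f x (y \<star> z) (y \<star> z) = f x (z \<star> y) (z \<star> y)"
    using f_sym2[OF Q(1) _ Q(2,3)] f_sym3[OF Q(1) _ Q(2,3)] Q by simp_all
  then show ?thesis
    using f_mult3[of x "y \<star> z" x "y \<star> z"] f_mult3[of x "z \<star> y" x "z \<star> y"]
      f_act_commute[of x "z \<star> y" x y z] Q by (simp add: act_mult)
qed

end

section \<open>Conjugates of inner mappings\<close>

context buchsteiner_loop
begin

text \<open>The value at \<open>1\<close> of the conjugate \<open>L\<^sub>z\<^sup>-\<^sup>1 (inner x y) L\<^sub>z\<close>.\<close>

definition shift :: "'a \<Rightarrow> 'a \<Rightarrow> 'a \<Rightarrow> 'a"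
  where "shift x y z = z \<setminus> inner x y z"

text \<open>The conjugate \<open>L\<^sub>z\<^sup>-\<^sup>1 (inner x y) L\<^sub>z\<close> is still a first and a second component, but it moves \<open>1\<close> to the
  shift \<open>s\<close>.  Combining the two autotopisms gives one of the form \<open>(R\<^sub>s, \<psi>, R\<^sub>tR\<^sub>s)\<close>
  (\<open>shift_coshift_autotopism\<close>), and the coshift is this \<open>t\<close>.\<close>

definition coshift :: "'a \<Rightarrow> 'a \<Rightarrow> 'a \<Rightarrow> 'a"
  where "coshift x y z = (shift x y z \<setminus> ((inner x y (\<one> \<div> z) \<otimes> defect x y) \<otimes> z)) \<div>
    ((x \<otimes> z) \<otimes> (z \<setminus> ((y \<otimes> z) \<otimes> (((x \<otimes> y) \<otimes> z) \<setminus> \<one>))))"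

lemma shift_closed [simp]:
  "\<lbrakk>x \<in> carrier Q; y \<in> carrier Q; z \<in> carrier Q\<rbrakk> \<Longrightarrow> shift x y z \<in> carrier Q"
  by (simp add: shift_def)

lemma coshift_closed [simp]:
  "\<lbrakk>x \<in> carrier Q; y \<in> carrier Q; z \<in> carrier Q\<rbrakk> \<Longrightarrow> coshift x y z \<in> carrier Q"
  by (simp add: coshift_def)

lemma Z_ldiv: "\<lbrakk>m \<in> Z; n \<in> Z\<rbrakk> \<Longrightarrow> m \<setminus> n = n \<ominus>\<^bsub>Zmod\<^esub> m"
  and Z_rdiv: "\<lbrakk>m \<in> Z; n \<in> Z\<rbrakk> \<Longrightarrow> n \<div> m = n \<ominus>\<^bsub>Zmod\<^esub> m"
proof -
  assume mn: "m \<in> Z" "n \<in> Z"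
  have "m \<oplus>\<^bsub>Zmod\<^esub> (n \<ominus>\<^bsub>Zmod\<^esub> m) = n" "(n \<ominus>\<^bsub>Zmod\<^esub> m) \<oplus>\<^bsub>Zmod\<^esub> m = n"
    unfolding Zmod_simps(1)[symmetric] using mn[folded Zmod_simps(1)] by algebra+
  moreover have "n \<ominus>\<^bsub>Zmod\<^esub> m \<in> Z" using mn Zm.minus_closed by (simp flip: Zmod_simps(1))
  ultimately show "m \<setminus> n = n \<ominus>\<^bsub>Zmod\<^esub> m" "n \<div> m = n \<ominus>\<^bsub>Zmod\<^esub> m"
    using mn Z_carrier by (auto simp: Zmod_simps intro!: ldiv_eqI rdiv_eqI)
qed

end

context nuclear_buchsteiner_loop
begin

lemma shift_eq:
  assumes Q: "x \<in> carrier Q" "y \<in> carrier Q" "z \<in> carrier Q"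
  shows "shift x y z = \<ominus>\<^bsub>Zmod\<^esub> assoc x y z"
proof -
  define a where "a = assoc x y z"
  have a: "a \<in> N" "a \<in> Z" "a \<in> carrier Q" using assoc_Z[OF Q] ZN Z_carrier by (simp_all add: a_def)
  have "z \<otimes> (shift x y z \<otimes> a) = z"
    using inner_mult_assoc[OF assoc_nuclear[OF Q] Q] N_assoc(3)[OF a(1), of z "shift x y z"] Q
    by (simp add: a_def shift_def)
  then have "z \<otimes> (shift x y z \<otimes> a) = z \<otimes> \<one>" using Q by simp
  then have "shift x y z \<otimes> a = \<one>" by (subst (asm) l_cancel) (use Q a in simp_all)
  then have "shift x y z = \<one> \<div> a" using Q a by (intro sym[OF rdiv_eqI]) simp_all
  also have "\<dots> = \<ominus>\<^bsub>Zmod\<^esub> a"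
    using Z_rdiv[of a \<one>] a Zm.zero_closed by (simp add: Zmod_simps Zm.minus_eq) (simp add: Zm.l_zero flip: Zmod_simps)
  finally show ?thesis by (simp add: a_def)
qed

lemma defect_eq_assoc:
  assumes Q: "x \<in> carrier Q" "y \<in> carrier Q"
  shows "defect x y = assoc x y (x \<otimes> y)"
proof -
  have "inner x y (x \<otimes> y) \<otimes> defect x y = inner x y (x \<otimes> y) \<otimes> assoc x y (x \<otimes> y)"
    using defect_eq[OF Q, of "x \<otimes> y"] inner_mult_assoc[OF assoc_nuclear] Q by simp
  then show ?thesis by (subst (asm) l_cancel) (use Q in simp_all)
qed

lemma assoc_one: "\<lbrakk>x \<in> carrier Q; y \<in> carrier Q\<rbrakk> \<Longrightarrow> assoc x y \<one> = \<one>"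
  by (rule assoc_eqI) simp_all

text \<open>The elements \<open>q u v = assoc u v (u \<otimes> v)\<close> are the defects, hence invariant; with nuclear associators
  every factor in the definition of the coshift is a combination of these and of \<open>assoc x y z\<close>.\<close>

lemma shift_coshift:
  assumes central: "\<And>x y. \<lbrakk>x \<in> carrier Q; y \<in> carrier Q\<rbrakk> \<Longrightarrow> defect x y \<in> center Q"
    and Q: "x \<in> carrier Q" "y \<in> carrier Q" "z \<in> carrier Q"
  shows "coshift x y z = assoc x y z \<oplus>\<^bsub>Zmod\<^esub> (assoc x y (x \<otimes> y) \<ominus>\<^bsub>Zmod\<^esub> assoc x (y \<otimes> z) (x \<otimes> (y \<otimes> z))
    \<oplus>\<^bsub>Zmod\<^esub> assoc x z (x \<otimes> z))"
proof -
  define f where "f = assoc x y z"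
  define q where "q u v = assoc u v (u \<otimes> v)" for u v
  have qZ: "q u v \<in> Z" if "u \<in> carrier Q" "v \<in> carrier Q" for u v
    using that assoc_Z by (simp add: q_def)
  have q_conj: "conj (q u v) w = q u v" if "u \<in> carrier Q" "v \<in> carrier Q" "w \<in> carrier Q" for u v w
  proof -
    have "q u v \<otimes> w = w \<otimes> q u v"
      using central[OF that(1,2)] defect_eq_assoc[OF that(1,2)] that(3) by (simp add: center_def q_def)
    then show ?thesis using qZ[OF that(1,2)] ZN Z_carrier that by (intro conj_eqI) simp_all
  qed
  have fZ: "f \<in> Z" using assoc_Z Q by (simp add: f_def)
  note Zc = Zmod_simps(1)[symmetric] and zero = Zmod_simps(3)[symmetric]
  \<comment> \<open>the first factor, \<open>(inner x y (1/z) \<cdot> defect x y) z\<close>\<close>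
  define i where "i = \<one> \<div> z"
  have i: "i \<in> carrier Q" "i \<otimes> z = \<one>" using Q by (simp_all add: i_def)
  have f_i: "conj (shift x y i) z = f"
  proof -
    have "\<one> = f \<oplus>\<^bsub>Zmod\<^esub> conj (assoc x y i) z"
      using F.f_mult3[of x y i z] i Q assoc_one by (simp add: f_def)
    then have "conj (assoc x y i) z = \<ominus>\<^bsub>Zmod\<^esub> f"
      using Zm.minus_equality[of "conj (assoc x y i) z" f] fZ i Q conj_Z assoc_Z
      by (metis Zmod_simps(1,3) Zm.minus_minus Zm.minus_equality Zm.a_inv_closed)
    then show ?thesis
      using shift_eq[OF Q(1,2) i(1)] F.act_neg[of "assoc x y i" z] fZ i Q assoc_Z by (simp add: Zc)
  qed
  have t: "(inner x y i \<otimes> defect x y) \<otimes> z = f \<oplus>\<^bsub>Zmod\<^esub> q x y"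
  proof -
    define n where "n = shift x y i"
    have n: "n \<in> Z" using shift_eq[OF Q(1,2) i(1)] assoc_Z[OF Q(1,2) i(1)] Zm.a_inv_closed by (simp add: n_def Zc)
    have b: "defect x y = q x y" using defect_eq_assoc[OF Q(1,2)] by (simp add: q_def)
    have nb: "n \<otimes> q x y \<in> Z" using Zm.a_closed[of n "q x y"] n qZ Q by (simp add: Zmod_simps)
    have "inner x y i \<otimes> q x y = i \<otimes> (n \<otimes> q x y)"
      using i Q qZ[OF Q(1,2)] N_assoc(3)[OF ZN[OF qZ[OF Q(1,2)]], of i n] n Z_carrier by (simp add: n_def shift_def)
    also have "\<dots> \<otimes> z = i \<otimes> z \<otimes> conj (n \<otimes> q x y) z"
      using N_assoc(2)[OF ZN[OF nb] i(1) Q(3)] N_assoc(3)[OF ZN[OF conj_Z[OF nb Q(3)]] i(1) Q(3)]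
        mult_conj[OF ZN[OF nb] Q(3)] by simp
    also have "\<dots> = conj (n \<otimes> q x y) z" using i conj_Z[OF nb Q(3)] Z_carrier by simp
    also have "\<dots> = f \<otimes> q x y"
      using conj_add[OF ZN[OF n] ZN[OF qZ[OF Q(1,2)]] Q(3)] q_conj Q f_i by (simp add: n_def)
    finally show ?thesis using b by (simp add: Zmod_simps)
  qed
  \<comment> \<open>the divisor, \<open>(xz)(z\<setminus>((yz)(((xy)z)\<setminus>1)))\<close>\<close>
  define w where "w = (x \<otimes> y) \<otimes> z"
  define p where "p = w \<setminus> \<one>"
  define r where "r = z \<setminus> ((y \<otimes> z) \<otimes> p)"
  define d where "d = (x \<otimes> z) \<otimes> r"
  have C: "w \<in> carrier Q" "p \<in> carrier Q" "r \<in> carrier Q" "w \<otimes> p = \<one>" "z \<otimes> r = (y \<otimes> z) \<otimes> p"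
    using Q by (simp_all add: w_def p_def r_def)
  have fQ: "f \<in> N" "f \<in> carrier Q" using fZ ZN Z_carrier by simp_all
  have cfp: "\<ominus>\<^bsub>Zmod\<^esub> conj f p = f"
  proof -
    have "conj f w = \<ominus>\<^bsub>Zmod\<^esub> f"
      using F.f_cycle[OF Q] conj_mult fQ conj_N Q by (simp add: w_def f_def)
    moreover have "conj (conj f w) p = f" using conj_mult[OF fQ(1) C(1,2)] C conj_one fQ by simp
    ultimately show ?thesis using F.act_neg[of f p] fZ C by (simp add: Zc)
  qed
  have "(x \<otimes> (y \<otimes> z)) \<otimes> p \<otimes> conj f p = \<one>"
  proof -
    have "(x \<otimes> (y \<otimes> z) \<otimes> f) \<otimes> p = \<one>" using mult_assoc[OF Q] C by (simp add: f_def w_def)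
    then show ?thesis
      using N_assoc(2)[OF fQ(1), of "x \<otimes> (y \<otimes> z)" p] N_assoc(3)[OF conj_N[OF fQ(1) C(2)], of "x \<otimes> (y \<otimes> z)" p]
        mult_conj[OF fQ(1) C(2)] Q C by simp
  qed
  then have "\<one> \<div> conj f p = (x \<otimes> (y \<otimes> z)) \<otimes> p"
    using Q C conj_N[OF fQ(1) C(2)] N_carrier by (intro rdiv_eqI) simp_all
  then have xyzp: "(x \<otimes> (y \<otimes> z)) \<otimes> p = f"
    using Z_rdiv[OF conj_Z[OF fZ C(2)], of \<one>] cfp fZ Zm.zero_closed conj_Z[OF fZ C(2)] Zm.minus_eq Zm.l_zero Zm.a_inv_closed
    by (simp add: Zc zero)
  have q1: "assoc x (y \<otimes> z) p = \<ominus>\<^bsub>Zmod\<^esub> q x (y \<otimes> z)"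
  proof -
    have w: "w = x \<otimes> (y \<otimes> z) \<otimes> f" using mult_assoc[OF Q] by (simp add: f_def w_def)
    have "assoc x (y \<otimes> z) w = q x (y \<otimes> z)"
      unfolding w q_def using assoc_N(3)[OF fQ(1)] Q by simp
    then have "\<zero>\<^bsub>Zmod\<^esub> = assoc x (y \<otimes> z) p \<oplus>\<^bsub>Zmod\<^esub> q x (y \<otimes> z)"
      using F.f_mult3[of x "y \<otimes> z" w p] C Q assoc_one q_conj by (simp add: zero)
    then show ?thesis
      using Zm.minus_equality[of "assoc x (y \<otimes> z) p" "q x (y \<otimes> z)"] C Q qZ assoc_Z by (simp add: Zc)
  qed
  have xr: "x \<otimes> (z \<otimes> r) = f \<oplus>\<^bsub>Zmod\<^esub> q x (y \<otimes> z)"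
  proof -
    have a: "assoc x (y \<otimes> z) p \<in> Z" using assoc_Z Q C by simp
    have "x \<otimes> (z \<otimes> r) = f \<div> assoc x (y \<otimes> z) p"
      using mult_assoc[of x "y \<otimes> z" p] xyzp C Q by (intro sym[OF rdiv_eqI]) simp_all
    then show ?thesis using Z_rdiv[OF a fZ] q1 qZ[of x "y \<otimes> z"] Q Zm.minus_eq Zm.minus_minus by (simp add: Zc)
  qed
  have xrZ: "x \<otimes> (z \<otimes> r) \<in> Z" unfolding xr using Zm.a_closed fZ qZ Q by (simp add: Zc)
  have dZ: "d \<in> Z" "d = x \<otimes> (z \<otimes> r) \<oplus>\<^bsub>Zmod\<^esub> assoc x z r"
  proof -
    show 1: "d = x \<otimes> (z \<otimes> r) \<oplus>\<^bsub>Zmod\<^esub> assoc x z r" using mult_assoc[of x z r] Q C by (simp add: d_def Zmod_simps)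
    show "d \<in> Z" unfolding 1 using xrZ assoc_Z[OF Q(1,3) C(3)] Zm.a_closed by (simp add: Zc)
  qed
  have q2: "assoc x z r = \<ominus>\<^bsub>Zmod\<^esub> q x z"
  proof -
    have "assoc x z d = \<one>" using assoc_N(3)[OF ZN[OF dZ(1)] Q(1,3) one_closed] assoc_one Q Z_carrier[OF dZ(1)] by simp
    then have "\<zero>\<^bsub>Zmod\<^esub> = assoc x z r \<oplus>\<^bsub>Zmod\<^esub> q x z"
      using F.f_mult3[of x z "x \<otimes> z" r] C Q q_conj by (simp add: d_def q_def zero)
    then show ?thesis
      using Zm.minus_equality[of "assoc x z r" "q x z"] C Q qZ assoc_Z by (simp add: Zc)
  qed
  have d: "d = f \<oplus>\<^bsub>Zmod\<^esub> q x (y \<otimes> z) \<ominus>\<^bsub>Zmod\<^esub> q x z"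
    unfolding dZ(2) xr q2 by (simp add: Zm.minus_eq)
  have s: "shift x y z = \<ominus>\<^bsub>Zmod\<^esub> f" using shift_eq[OF Q] by (simp add: f_def)
  have cl: "f \<in> carrier Zmod" "q x y \<in> carrier Zmod" "q x z \<in> carrier Zmod" "q x (y \<otimes> z) \<in> carrier Zmod"
    using fZ qZ Q by (simp_all add: Zmod_simps)
  have "coshift x y z = (shift x y z \<setminus> (f \<oplus>\<^bsub>Zmod\<^esub> q x y)) \<div> d"
    unfolding coshift_def d_def r_def p_def w_def t[unfolded i_def] ..
  also have "shift x y z \<setminus> (f \<oplus>\<^bsub>Zmod\<^esub> q x y) = (f \<oplus>\<^bsub>Zmod\<^esub> q x y) \<ominus>\<^bsub>Zmod\<^esub> (\<ominus>\<^bsub>Zmod\<^esub> f)"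
    unfolding s using cl by (intro Z_ldiv) (simp_all flip: Zmod_simps(1))
  also have "\<dots> \<div> d = ((f \<oplus>\<^bsub>Zmod\<^esub> q x y) \<ominus>\<^bsub>Zmod\<^esub> (\<ominus>\<^bsub>Zmod\<^esub> f)) \<ominus>\<^bsub>Zmod\<^esub> (f \<oplus>\<^bsub>Zmod\<^esub> q x (y \<otimes> z) \<ominus>\<^bsub>Zmod\<^esub> q x z)"
    unfolding d[symmetric] using cl dZ(1) by (intro Z_rdiv) (simp_all flip: Zmod_simps(1))
  also have "\<dots> = f \<oplus>\<^bsub>Zmod\<^esub> (q x y \<ominus>\<^bsub>Zmod\<^esub> q x (y \<otimes> z) \<oplus>\<^bsub>Zmod\<^esub> q x z)"
    using cl by algebra
  finally show ?thesis by (simp add: f_def q_def)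
qed

end

context buchsteiner_loop
begin

text \<open>If \<open>W\<close> is a first component of \<open>X\<close> and a second component of \<open>Y\<close>, then \<open>X Y\<^sup>-\<^sup>1\<close>, followed by the
  Buchsteiner autotopism of \<open>d\<close>, has the right translation by \<open>s = W 1\<close> as first component.\<close>

lemma right_translation_autotopism:
  assumes X: "autotopism W \<beta> \<gamma>" and Y: "autotopism \<delta> W' \<epsilon>"
    and eq: "\<And>x. x \<in> carrier Q \<Longrightarrow> W' x = W x"
  defines "s \<equiv> W \<one>" and "t \<equiv> \<beta> \<one>" and "d \<equiv> \<delta> \<one>"
  obtains \<psi> where "\<And>w. w \<in> carrier Q \<Longrightarrow> \<psi> w \<in> carrier Q"
    "\<And>w. w \<in> carrier Q \<Longrightarrow> s \<otimes> \<psi> w = (w \<otimes> s) \<otimes> ((s \<setminus> t) \<div> d)"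
    "\<And>v w. \<lbrakk>v \<in> carrier Q; w \<in> carrier Q\<rbrakk> \<Longrightarrow> (v \<otimes> s) \<otimes> \<psi> w = ((v \<otimes> w) \<otimes> s) \<otimes> ((s \<setminus> t) \<div> d)"
proof -
  have std: "s \<in> carrier Q" "t \<in> carrier Q" "d \<in> carrier Q"
    unfolding s_def t_def d_def using autotopismD[OF X one_closed] autotopismD[OF Y one_closed] by simp_all
  define i where "i = inv_into (carrier Q) \<delta>"
  define j where "j = inv_into (carrier Q) W'"
  have ij: "\<delta> (i x) = x" "i x \<in> carrier Q" "W (j x) = x" "j x \<in> carrier Q" if "x \<in> carrier Q" for x
    using autotopism_inv_apply[OF Y that] eq by (simp_all add: i_def j_def)
  obtain \<chi> where Z: "autotopism (\<lambda>v. d \<otimes> W (i v)) (\<lambda>w. \<beta> (j w) \<div> d) \<chi>"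
    using autotopism_comp[OF autotopism_B[OF std(3)] autotopism_comp[OF X autotopism_inv[OF Y]]]
    unfolding i_def j_def by blast
  have first: "d \<otimes> W (i v) = v \<otimes> s" if v: "v \<in> carrier Q" for v
    using autotopismD(4)[OF Y ij(2)[OF v] one_closed] autotopismD(4)[OF Y one_closed ij(2)[OF v]] ij v
    by (simp add: eq s_def d_def)
  have \<beta>: "\<beta> q = s \<setminus> (W q \<otimes> t)" if q: "q \<in> carrier Q" for q
    using autotopismD(4)[OF X q one_closed] autotopismD(4)[OF X one_closed q] q std autotopismD[OF X q]
    by (intro sym[OF ldiv_eqI]) (simp_all add: s_def t_def)
  define \<psi> where "\<psi> w = \<beta> (j w) \<div> d" for w
  have \<psi>Q: "\<psi> w \<in> carrier Q" if "w \<in> carrier Q" for w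
    using autotopismD(2)[OF Z that] by (simp add: \<psi>_def)
  have \<psi>1: "\<psi> \<one> = (s \<setminus> t) \<div> d"
    using \<beta>[of "j \<one>"] ij std by (simp add: \<psi>_def)
  have a: "(v \<otimes> s) \<otimes> \<psi> w = \<chi> (v \<otimes> w)" if "v \<in> carrier Q" "w \<in> carrier Q" for v w
    using autotopismD(4)[OF Z that] first[OF that(1)] by (simp add: \<psi>_def)
  have \<chi>: "\<chi> v = (v \<otimes> s) \<otimes> ((s \<setminus> t) \<div> d)" if "v \<in> carrier Q" for v
    using a[OF that one_closed] \<psi>1 that by simp
  show thesis
    by (rule that[of \<psi>]) (use \<psi>Q a a[OF one_closed] \<chi> std in simp_all)
qed

text \<open>The conjugate \<open>L\<^sub>z\<^sup>-\<^sup>1 (inner x y) L\<^sub>z\<close> is a first component by construction.  The fact \<open>eq\<close> rewrites it as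
  \<open>R\<^bsub>xz\<^esub>\<^sup>-\<^sup>1 R\<^sub>z R\<^bsub>yz\<^esub>\<^sup>-\<^sup>1 R\<^bsub>xy\<cdot>z\<^esub>\<close>, which is a second component.\<close>

lemma shift_coshift_autotopism:
  assumes Q: "x \<in> carrier Q" "y \<in> carrier Q" "z \<in> carrier Q"
  obtains \<psi> where "\<And>w. w \<in> carrier Q \<Longrightarrow> \<psi> w \<in> carrier Q"
    "\<And>w. w \<in> carrier Q \<Longrightarrow> shift x y z \<otimes> \<psi> w = (w \<otimes> shift x y z) \<otimes> coshift x y z"
    "\<And>v w. \<lbrakk>v \<in> carrier Q; w \<in> carrier Q\<rbrakk> \<Longrightarrow>
      (v \<otimes> shift x y z) \<otimes> \<psi> w = ((v \<otimes> w) \<otimes> shift x y z) \<otimes> coshift x y z"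
proof -
  define u where "u = (x \<otimes> y) \<otimes> z"
  have u: "u \<in> carrier Q" using Q by (simp add: u_def)
  obtain \<gamma> where A: "autotopism (inner x y) (\<lambda>v. ((v \<div> y) \<div> x) \<otimes> (x \<otimes> y)) \<gamma>"
    using inner_autotopism1[OF Q(1,2)] .
  note X = autotopism_comp[OF autotopism_B_inv[OF Q(3)] autotopism_comp[OF A autotopism_B[OF Q(3)]]]
  note Y = autotopism_comp[OF autotopism_B[OF m_closed[OF Q(1,3)]] autotopism_comp[OF autotopism_B_inv[OF Q(3)]
    autotopism_comp[OF autotopism_B[OF m_closed[OF Q(2,3)]] autotopism_B_inv[OF u]]]]
  have eq: "(((v \<otimes> u) \<div> (y \<otimes> z)) \<otimes> z) \<div> (x \<otimes> z) = z \<setminus> inner x y (z \<otimes> v)" if v: "v \<in> carrier Q" for v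
  proof -
    define q where "q = z \<setminus> inner x y (z \<otimes> v)"
    define r where "r = (q \<otimes> (x \<otimes> z)) \<div> z"
    have qr: "q \<in> carrier Q" "r \<in> carrier Q" using Q v by (simp_all add: q_def r_def)
    have zq: "z \<otimes> q = (((z \<otimes> v) \<otimes> (x \<otimes> y)) \<div> y) \<div> x"
      using inner_right[OF Q(1,2), of "z \<otimes> v"] Q v by (simp add: q_def)
    have zr: "(z \<otimes> q) \<otimes> x = z \<otimes> r"
      using buchsteiner[OF Q(3) qr(1) Q(1)] Q qr by (metis r_def m_closed mult_ldiv)
    have "(z \<otimes> r) \<otimes> y = (z \<otimes> v) \<otimes> (x \<otimes> y)"
      using zr[unfolded zq] rdiv_mult[of y "(z \<otimes> v) \<otimes> (x \<otimes> y)"] Q v by simp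
    then have "(r \<otimes> (y \<otimes> z)) \<div> z = (v \<otimes> u) \<div> z"
      using buchsteiner[OF Q(3) qr(2) Q(2)] buchsteiner[OF Q(3) v, of "x \<otimes> y"] Q by (simp add: u_def)
    then have "r \<otimes> (y \<otimes> z) = v \<otimes> u" using Q v u qr by (metis m_closed rdiv_mult)
    then have "(v \<otimes> u) \<div> (y \<otimes> z) = r" using Q v u qr by (intro rdiv_eqI) simp_all
    moreover have "(r \<otimes> z) \<div> (x \<otimes> z) = q" using Q qr by (intro rdiv_eqI) (simp_all add: r_def)
    ultimately show ?thesis by (simp add: q_def)
  qed
  have s: "z \<setminus> inner x y (z \<otimes> \<one>) = shift x y z" using Q by (simp add: shift_def)
  have t: "((((\<one> \<div> z) \<div> y) \<div> x) \<otimes> (x \<otimes> y)) \<otimes> z = (inner x y (\<one> \<div> z) \<otimes> defect x y) \<otimes> z"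
    using defect_eq[OF Q(1,2), of "\<one> \<div> z"] Q by simp
  have c: "(shift x y z \<setminus> ((inner x y (\<one> \<div> z) \<otimes> defect x y) \<otimes> z)) \<div>
    ((x \<otimes> z) \<otimes> (z \<setminus> ((y \<otimes> z) \<otimes> (u \<setminus> \<one>)))) = coshift x y z"
    by (simp add: coshift_def u_def)
  show thesis
  proof (rule right_translation_autotopism[OF X Y eq, unfolded s t c])
    fix \<psi>
    assume a: "\<And>w. w \<in> carrier Q \<Longrightarrow> \<psi> w \<in> carrier Q"
      "\<And>w. w \<in> carrier Q \<Longrightarrow> shift x y z \<otimes> \<psi> w = (w \<otimes> shift x y z) \<otimes> coshift x y z"
      "\<And>v w. \<lbrakk>v \<in> carrier Q; w \<in> carrier Q\<rbrakk> \<Longrightarrow>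
        (v \<otimes> shift x y z) \<otimes> \<psi> w = ((v \<otimes> w) \<otimes> shift x y z) \<otimes> coshift x y z"
    show thesis by (rule that[of \<psi>, OF a])
  qed
qed

end

section \<open>Lifting nuclearity from the factor loop\<close>

context buchsteiner_loop
begin

lemma defect_eq_one:
  assumes "u \<in> N" "x \<in> carrier Q"
  shows "defect u x = \<one>" "defect x u = \<one>"
proof -
  note u = N_carrier[OF assms(1)]
  show "defect u x = \<one>"
    using N_assoc(2)[OF assms(1), of "(\<one> \<div> x) \<div> u" x] u assms(2) by (simp add: defect_def)
  show "defect x u = \<one>"
    using N_assoc(3)[OF assms(1), of "(\<one> \<div> u) \<div> x" x] u assms(2) by (simp add: defect_def)
qed

lemma assoc_eq_one:
  assumes "u \<in> N" "x \<in> carrier Q" "y \<in> carrier Q"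
  shows "assoc u x y = \<one>" "assoc x u y = \<one>" "assoc x y u = \<one>"
  using N_assoc[OF assms] N_carrier[OF assms(1)] assms by (auto intro!: assoc_eqI)

lemma pi_assoc: "\<lbrakk>x \<in> carrier Q; y \<in> carrier Q; z \<in> carrier Q\<rbrakk> \<Longrightarrow> \<pi> (assoc x y z) = loop.assoc Q\<^sub>N (\<pi> x) (\<pi> y) (\<pi> z)"
  by (simp add: assoc_def loop.assoc_def[OF Q\<^sub>N_loop] pi_hom)

lemma pi_inner: "\<lbrakk>x \<in> carrier Q; y \<in> carrier Q; z \<in> carrier Q\<rbrakk> \<Longrightarrow>
  \<pi> (inner x y z) = buchsteiner_loop.inner Q\<^sub>N (\<pi> x) (\<pi> y) (\<pi> z)"
  by (simp add: inner_def buchsteiner_loop.inner_def[OF Q\<^sub>N_buchsteiner] pi_hom)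

lemma pi_defect: "\<lbrakk>x \<in> carrier Q; y \<in> carrier Q\<rbrakk> \<Longrightarrow> \<pi> (defect x y) = buchsteiner_loop.defect Q\<^sub>N (\<pi> x) (\<pi> y)"
  by (simp add: defect_def buchsteiner_loop.defect_def[OF Q\<^sub>N_buchsteiner] pi_hom)

lemma pi_shift: "\<lbrakk>x \<in> carrier Q; y \<in> carrier Q; z \<in> carrier Q\<rbrakk> \<Longrightarrow>
  \<pi> (shift x y z) = buchsteiner_loop.shift Q\<^sub>N (\<pi> x) (\<pi> y) (\<pi> z)"
  by (simp add: shift_def buchsteiner_loop.shift_def[OF Q\<^sub>N_buchsteiner] pi_inner pi_hom)

lemma pi_coshift: "\<lbrakk>x \<in> carrier Q; y \<in> carrier Q; z \<in> carrier Q\<rbrakk> \<Longrightarrow>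
  \<pi> (coshift x y z) = buchsteiner_loop.coshift Q\<^sub>N (\<pi> x) (\<pi> y) (\<pi> z)"
  by (simp add: coshift_def buchsteiner_loop.coshift_def[OF Q\<^sub>N_buchsteiner] pi_inner pi_shift pi_defect pi_hom)

end

text \<open>For \<open>u\<close> in \<open>M\<close>, the preimage of the nucleus of the factor loop \<open>Q/N\<close>, the associators involving \<open>u\<close>
  are nuclear, so the calculus above is available for them.\<close>

locale nuclear_factor = buchsteiner_loop +
  assumes nuclear_factor: "nuclear_buchsteiner_loop (Q Mod nucleus Q)"
begin

sublocale K: nuclear_buchsteiner_loop Q\<^sub>N
  by (rule nuclear_factor)

definition M where "M = {u \<in> carrier Q. \<pi> u \<in> K.N}"

lemma M_carrier: "u \<in> M \<Longrightarrow> u \<in> carrier Q"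
  by (simp add: M_def)

lemma N_M: "n \<in> N \<Longrightarrow> n \<in> M"
  using pi_eq_one_iff[OF N_carrier, of n] K.N_one N_carrier by (simp add: M_def)

lemma M_mult: "\<lbrakk>u \<in> M; v \<in> M\<rbrakk> \<Longrightarrow> u \<otimes> v \<in> M"
  by (simp add: M_def pi_mult K.N_mult)

lemma M_ldiv: "\<lbrakk>u \<in> M; v \<in> M\<rbrakk> \<Longrightarrow> u \<setminus> v \<in> M"
  by (simp add: M_def pi_hom K.N_ldiv)

lemma assoc_M: "\<lbrakk>x \<in> carrier Q; y \<in> carrier Q; z \<in> carrier Q\<rbrakk> \<Longrightarrow> assoc x y z \<in> M"
  using K.assoc_nuclear by (simp add: M_def pi_assoc)

lemma assoc_M_nuclear:
  assumes u: "u \<in> M" and Q: "x \<in> carrier Q" "y \<in> carrier Q"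
  shows "assoc u x y \<in> N" "assoc x u y \<in> N" "assoc x y u \<in> N"
  using K.assoc_eq_one[of "\<pi> u" "\<pi> x" "\<pi> y"] u Q
  by (simp_all add: M_def pi_assoc flip: pi_eq_one_iff)

lemmas assoc_M_Z = assoc_in_Z[OF assoc_M_nuclear(1)] assoc_in_Z[OF assoc_M_nuclear(2)] assoc_in_Z[OF assoc_M_nuclear(3)]

lemma defect_M_nuclear:
  assumes u: "u \<in> M" and x: "x \<in> carrier Q"
  shows "defect u x \<in> N" "defect x u \<in> N"
  using K.defect_eq_one[of "\<pi> u" "\<pi> x"] u x by (simp_all add: M_def pi_defect flip: pi_eq_one_iff)

lemma assoc_M_mult3:
  assumes u: "u \<in> M" and Q: "x \<in> carrier Q" "z \<in> carrier Q" "w \<in> carrier Q"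
  shows "assoc u x (z \<otimes> w) = assoc u x w \<otimes> conj (assoc u x z) w"
    "assoc x u (z \<otimes> w) = assoc x u w \<otimes> conj (assoc x u z) w"
  using assoc_mult3[of u x z w] assoc_mult3[of x u z w] assoc_M_nuclear defect_M_nuclear M_carrier u Q by simp_all

text \<open>Here \<open>inner x y\<close> is a homomorphism that is trivial modulo \<open>N\<close>, and associators depend on their
  arguments only modulo \<open>N\<close>; so it fixes all associators.\<close>

lemma inner_fixes_assoc:
  assumes xy: "x \<in> carrier Q" "y \<in> carrier Q" and d: "defect x y \<in> N"
    and n: "\<And>z. z \<in> carrier Q \<Longrightarrow> assoc x y z \<in> N"
    and Q: "p \<in> carrier Q" "q \<in> carrier Q" "r \<in> carrier Q"
  shows "assoc x y (assoc p q r) = \<one>"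
proof -
  define \<alpha> where "\<alpha> = inner x y"
  have \<alpha>Q: "\<alpha> v \<in> carrier Q" if "v \<in> carrier Q" for v using that xy by (simp add: \<alpha>_def)
  have hom: "\<alpha> (v \<otimes> w) = \<alpha> v \<otimes> \<alpha> w" if "v \<in> carrier Q" "w \<in> carrier Q" for v w
    using inner_hom[OF xy d that] by (simp add: \<alpha>_def)
  have \<pi>\<alpha>: "\<pi> (\<alpha> v) = \<pi> v" if "v \<in> carrier Q" for v
    using pi_mult_N[of "\<alpha> v" "assoc x y v"] inner_mult_assoc[OF n[OF that] xy that] n[OF that] \<alpha>Q[OF that]
    by (simp add: \<alpha>_def)
  have "assoc (\<alpha> p) (\<alpha> q) (\<alpha> r) = \<alpha> (assoc p q r)"
    using mult_assoc[OF Q] Q \<alpha>Q by (intro assoc_eqI) (simp_all flip: hom)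
  moreover have "assoc (\<alpha> p) (\<alpha> q) (\<alpha> r) = assoc p q r"
    by (rule assoc_pi_cong) (use Q \<alpha>Q \<pi>\<alpha> in simp_all)
  ultimately have "assoc p q r \<otimes> assoc x y (assoc p q r) = assoc p q r \<otimes> \<one>"
    using inner_mult_assoc[OF n xy, of "assoc p q r"] Q by (simp add: \<alpha>_def)
  then show ?thesis by (subst (asm) l_cancel) (use Q xy in simp_all)
qed

text \<open>The associators of \<open>Q\<close> lie in \<open>S\<close>, and for \<open>s\<close> in \<open>S\<close> the map \<open>(v,w) \<mapsto> assoc s v w\<close> depends on \<open>v\<close> and \<open>w\<close>
  only modulo \<open>M\<close>, up to the action, and is additive in \<open>s\<close>; it vanishes precisely when \<open>s\<close> is nuclear.\<close>

definition S where "S = {v \<in> M. (\<forall>n \<in> Z. conj n v = n) \<and> (\<forall>u \<in> M. \<forall>x \<in> carrier Q. assoc u x v = \<one> \<and> assoc x u v = \<one>)}"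

lemma S_M: "v \<in> S \<Longrightarrow> v \<in> M" and S_carrier: "v \<in> S \<Longrightarrow> v \<in> carrier Q"
  and S_conj: "\<lbrakk>v \<in> S; n \<in> Z\<rbrakk> \<Longrightarrow> conj n v = n"
  and S_assoc: "\<lbrakk>v \<in> S; u \<in> M; x \<in> carrier Q\<rbrakk> \<Longrightarrow> assoc u x v = \<one>" "\<lbrakk>v \<in> S; u \<in> M; x \<in> carrier Q\<rbrakk> \<Longrightarrow> assoc x u v = \<one>"
  by (auto simp: S_def M_def)

lemma assoc_S:
  assumes Q: "x \<in> carrier Q" "y \<in> carrier Q" "z \<in> carrier Q"
  shows "assoc x y z \<in> S"
proof -
  have "conj n (assoc x y z) = n" if n: "n \<in> Z" for n
  proof -
    define p where "p = x \<otimes> (y \<otimes> z)"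
    define m where "m = conj n (\<one> \<div> p)"
    have p: "p \<in> carrier Q" using Q by (simp add: p_def)
    have m: "m \<in> Z" using conj_Z n p by (simp add: m_def)
    have mp: "conj m p = n"
      using conj_mult[OF ZN[OF n], of "\<one> \<div> p" p] p conj_one[OF ZN[OF n]] by (simp add: m_def)
    have "conj (conj m p) (assoc x y z) = conj m ((x \<otimes> y) \<otimes> z)"
      using conj_mult[OF ZN[OF m] p, of "assoc x y z"] mult_assoc[OF Q] Q by (simp add: p_def)
    also have "\<dots> = conj m p"
      using Q m ZN conj_N by (simp add: p_def conj_mult)
    finally show ?thesis using mp by simp
  qed
  moreover have "assoc u v (assoc x y z) = \<one> \<and> assoc v u (assoc x y z) = \<one>" if "u \<in> M" "v \<in> carrier Q" for u v
    using inner_fixes_assoc[of u v x y z] inner_fixes_assoc[of v u x y z] that Q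
      assoc_M_nuclear defect_M_nuclear M_carrier by simp
  ultimately show ?thesis using assoc_M[OF Q] by (simp add: S_def)
qed

lemma conj_one_left: "x \<in> carrier Q \<Longrightarrow> conj \<one> x = \<one>"
  by (rule conj_eqI) (simp_all add: N_one)

lemma S_mult:
  assumes "v \<in> S" "w \<in> S"
  shows "v \<otimes> w \<in> S"
proof -
  note c = assms[THEN S_carrier]
  have "conj n (v \<otimes> w) = n" if n: "n \<in> Z" for n
    using conj_mult[OF ZN[OF n] c] S_conj assms n by simp
  moreover have "assoc u x (v \<otimes> w) = \<one> \<and> assoc x u (v \<otimes> w) = \<one>" if "u \<in> M" "x \<in> carrier Q" for u x
    using assoc_M_mult3[OF that c] S_assoc[OF assms(1) that] S_assoc[OF assms(2) that] conj_one_left c by simp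
  ultimately show ?thesis using M_mult[OF assms[THEN S_M]] by (simp add: S_def)
qed

lemma N_S:
  assumes "n \<in> N" shows "n \<in> S"
  using assms N_M conj_Z_N assoc_eq_one(3)[OF assms] M_carrier by (simp add: S_def)

lemma S_inverse:
  assumes v: "v \<in> S"
  shows "v \<setminus> \<one> \<in> S"
proof -
  note c = S_carrier[OF v]
  have "conj n (v \<setminus> \<one>) = n" if n: "n \<in> Z" for n
    using conj_mult[OF ZN[OF n] c, of "v \<setminus> \<one>"] S_conj[OF v n] conj_one ZN n c by simp
  moreover have "assoc u x (v \<setminus> \<one>) = \<one> \<and> assoc x u (v \<setminus> \<one>) = \<one>" if "u \<in> M" "x \<in> carrier Q" for u x
    using assoc_M_mult3[OF that c, of "v \<setminus> \<one>"] S_assoc[OF v that] conj_one_left c that M_carrier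
      S_assoc[OF N_S[OF N_one] that] by simp
  ultimately show ?thesis using M_ldiv[OF S_M[OF v] N_M[OF N_one]] by (simp add: S_def)
qed

lemma S_pi:
  assumes "v \<in> S" "w \<in> carrier Q" "\<pi> w = \<pi> v"
  shows "w \<in> S"
  using pi_eqE[OF assms(3,2) S_carrier[OF assms(1)]] S_mult[OF assms(1)] N_S by metis

text \<open>Rotation with an argument that acts trivially.\<close>

lemma S_rotate:
  assumes s: "s \<in> S" and Q: "p \<in> carrier Q" "q \<in> carrier Q"
  shows "assoc p q s = \<ominus>\<^bsub>Zmod\<^esub> assoc s p q" "assoc q s p = conj (assoc s p q) p"
    "assoc s p q \<in> Z" "assoc q s p \<in> Z" "assoc p q s \<in> Z"
proof -
  note sQ = S_carrier[OF s] and sM = S_M[OF s]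
  show Zs: "assoc s p q \<in> Z" "assoc q s p \<in> Z" "assoc p q s \<in> Z"
    using assoc_M_Z[OF sM] Q sQ by simp_all
  show 1: "assoc p q s = \<ominus>\<^bsub>Zmod\<^esub> assoc s p q"
    using assoc_rotate(2)[OF ZN[OF Zs(1)] sQ Q] S_conj[OF s Zs(1)] by simp
  have "conj (\<ominus>\<^bsub>Zmod\<^esub> assoc s p q) p \<oplus>\<^bsub>Zmod\<^esub> conj (assoc s p q) p = \<one>"
    using conj_add[of "\<ominus>\<^bsub>Zmod\<^esub> assoc s p q" "assoc s p q" p] Zs ZN Zm.l_neg[of "assoc s p q"] 1[symmetric] Q conj_one_left
    by (simp add: Zmod_simps)
  then have "\<ominus>\<^bsub>Zmod\<^esub> (conj (assoc p q s) p) = conj (assoc s p q) p"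
    using Zm.minus_equality[of "conj (assoc s p q) p" "conj (assoc p q s) p"] 1[symmetric] conj_Z Zs Q Zm.a_comm
    by (simp add: Zmod_simps)
  then show "assoc q s p = conj (assoc s p q) p"
    using assoc_rotate(2)[OF ZN[OF Zs(3)] Q sQ] by simp
qed

lemma S_vanish:
  assumes s: "s \<in> S" and u: "u \<in> M" and x: "x \<in> carrier Q"
  shows "assoc s u x = \<one>" "assoc s x u = \<one>" "assoc x s u = \<one>" "assoc u s x = \<one>"
proof -
  note C = S_carrier[OF s] M_carrier[OF u]
  have z: "\<ominus>\<^bsub>Zmod\<^esub> \<one> = \<one>" using Zm.minus_equality[of "\<zero>\<^bsub>Zmod\<^esub>" "\<zero>\<^bsub>Zmod\<^esub>"] Zm.zero_closed Zm.l_zero by (simp add: Zmod_simps)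
  note rot = assoc_rotate(2) and one = conj_one_left N_one z
  show 1: "assoc x s u = \<one>" using rot[of u x s] S_assoc[OF s u x] C x one by simp
  show "assoc s u x = \<one>" using rot[of x s u] 1 C x one by simp
  show 2: "assoc u s x = \<one>" using rot[of x u s] S_assoc[OF s u x] C x one by simp
  show "assoc s x u = \<one>" using rot[of u s x] 2 C x one by simp
qed

lemma S_mult2:
  assumes s: "s \<in> S" and t: "t \<in> M" and Q: "v \<in> carrier Q" "w \<in> carrier Q"
  shows "assoc s v (w \<otimes> t) = conj (assoc s v w) t" "assoc s v (t \<otimes> w) = assoc s v w"
    "assoc s (v \<otimes> t) w = assoc s v w"
proof -
  note tQ = M_carrier[OF t] and sQ = S_carrier[OF s]
  note sZ = S_rotate(3)[OF s]
  show "assoc s v (w \<otimes> t) = conj (assoc s v w) t"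
    using assoc_M_mult3(1)[OF S_M[OF s] Q tQ] S_vanish(2)[OF s t Q(1)] conj_N[OF ZN[OF sZ] tQ] N_carrier Q by simp
  show "assoc s v (t \<otimes> w) = assoc s v w"
    using assoc_M_mult3(1)[OF S_M[OF s] Q(1) tQ Q(2)] S_vanish(2)[OF s t Q(1)] conj_one_left sQ Q by simp
  have "conj (assoc s (v \<otimes> t) w) (v \<otimes> t) = assoc w s (v \<otimes> t)" using S_rotate(2)[OF s, of "v \<otimes> t" w] Q tQ by simp
  also have "\<dots> = assoc w s t \<otimes> conj (assoc w s v) t"
    using assoc_M_mult3(2)[OF S_M[OF s] Q(2,1) tQ] .
  also have "\<dots> = conj (conj (assoc s v w) v) t"
    using S_vanish(3)[OF s t Q(2)] S_rotate(2)[OF s Q] conj_N[OF conj_N[OF ZN[OF sZ[OF Q]] Q(1)] tQ] N_carrier by simp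
  also have "\<dots> = conj (assoc s v w) (v \<otimes> t)" using conj_mult[OF ZN[OF sZ[OF Q]] Q(1) tQ] by simp
  finally have "(v \<otimes> t) \<setminus> (assoc s (v \<otimes> t) w \<otimes> (v \<otimes> t)) = (v \<otimes> t) \<setminus> (assoc s v w \<otimes> (v \<otimes> t))"
    by (simp add: conj_def)
  then have "assoc s (v \<otimes> t) w \<otimes> (v \<otimes> t) = assoc s v w \<otimes> (v \<otimes> t)"
    using Q tQ sQ mult_ldiv by (metis assoc_closed m_closed)
  then show "assoc s (v \<otimes> t) w = assoc s v w" using Q tQ sQ by simp
qed

lemma S_add:
  assumes s: "s \<in> S" "t \<in> S" and Q: "v \<in> carrier Q" "w \<in> carrier Q"
  shows "assoc (s \<otimes> t) v w = assoc t v w \<otimes> assoc s v w"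
proof (rule assoc_eqI)
  note sQ = s[THEN S_carrier]
  define k where "k = v \<setminus> (t \<otimes> v)"
  have k: "k \<in> M" "k \<in> carrier Q" "v \<otimes> k = t \<otimes> v"
    using s[THEN S_M] Q sQ K.N_conj(2)[of "\<pi> t" "\<pi> v"] by (simp_all add: k_def M_def pi_hom)
  have "assoc s (t \<otimes> v) w = assoc s v w" using S_mult2(3)[OF s(1) k(1) Q] k by simp
  then have "((s \<otimes> t) \<otimes> v) \<otimes> w = (s \<otimes> ((t \<otimes> v) \<otimes> w)) \<otimes> assoc s v w"
    using mult_assoc[of s t v] mult_assoc[of s "t \<otimes> v" w] S_vanish(1)[OF s(1) S_M[OF s(2)] Q(1)] sQ Q by simp
  also have "(t \<otimes> v) \<otimes> w = (t \<otimes> (v \<otimes> w)) \<otimes> assoc t v w" using mult_assoc sQ Q by simp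
  also have "s \<otimes> ((t \<otimes> (v \<otimes> w)) \<otimes> assoc t v w) = ((s \<otimes> t) \<otimes> (v \<otimes> w)) \<otimes> assoc t v w"
    using N_assoc(3)[OF ZN[OF S_rotate(3)[OF s(2) Q]], of s "t \<otimes> (v \<otimes> w)"] mult_assoc[of s t "v \<otimes> w"]
      S_vanish(1)[OF s(1) S_M[OF s(2)], of "v \<otimes> w"] sQ Q by simp
  also have "\<dots> \<otimes> assoc s v w = ((s \<otimes> t) \<otimes> (v \<otimes> w)) \<otimes> (assoc t v w \<otimes> assoc s v w)"
    using N_assoc(3)[OF ZN[OF S_rotate(3)[OF s(1) Q]], of "(s \<otimes> t) \<otimes> (v \<otimes> w)" "assoc t v w"] sQ Q by simp
  finally show "((s \<otimes> t) \<otimes> (v \<otimes> w)) \<otimes> (assoc t v w \<otimes> assoc s v w) = ((s \<otimes> t) \<otimes> v) \<otimes> w" by simp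
qed (use assms S_carrier in simp_all)

lemma S_nuclear:
  assumes "s \<in> S" "\<And>v w. \<lbrakk>v \<in> carrier Q; w \<in> carrier Q\<rbrakk> \<Longrightarrow> assoc s v w = \<one>"
  shows "s \<in> N"
proof (rule nucleus_if_left[OF S_carrier[OF assms(1)]])
  fix x y assume "x \<in> carrier Q" "y \<in> carrier Q"
  then show "s \<otimes> (x \<otimes> y) = s \<otimes> x \<otimes> y"
    using mult_assoc[of s x y] assms S_carrier by simp
qed

text \<open>The autotopism \<open>(R\<^sub>s, \<psi>, R\<^sub>tR\<^sub>s)\<close> compares two bracketings of \<open>v, s, w, t\<close>.  Written with associators, it
  says that the map attached to \<open>s\<close> is, transposed and twisted by the action, the negative of the map attached to \<open>st\<close>.\<close>

lemma transpose:
  assumes s: "s \<in> S" and t: "t \<in> S"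
    and \<psi>: "\<And>w. w \<in> carrier Q \<Longrightarrow> \<psi> w \<in> carrier Q"
      "\<And>w. w \<in> carrier Q \<Longrightarrow> s \<otimes> \<psi> w = (w \<otimes> s) \<otimes> t"
      "\<And>v w. \<lbrakk>v \<in> carrier Q; w \<in> carrier Q\<rbrakk> \<Longrightarrow> (v \<otimes> s) \<otimes> \<psi> w = ((v \<otimes> w) \<otimes> s) \<otimes> t"
    and Q: "v \<in> carrier Q" "w \<in> carrier Q"
  shows "conj (assoc s w v) w = \<ominus>\<^bsub>Zmod\<^esub> assoc (s \<otimes> t) v w"
proof -
  note sQ = S_carrier[OF s] S_M[OF s] and tQ = S_carrier[OF t] S_M[OF t]
  define w' where "w' = s \<setminus> (w \<otimes> s)"
  have w': "w' \<in> carrier Q" "s \<otimes> w' = w \<otimes> s" using Q sQ by (simp_all add: w'_def)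
  have "s \<otimes> \<psi> w = s \<otimes> (w' \<otimes> t)"
    using \<psi>(2)[OF Q(2)] mult_assoc[of s w' t] S_vanish(2)[OF s tQ(2) w'(1)] w' sQ tQ by simp
  then have \<psi>w: "\<psi> w = w' \<otimes> t" by (subst (asm) l_cancel) (use sQ w' tQ \<psi>(1)[OF Q(2)] in simp_all)
  define a where "a = assoc v s w'"
  define b where "b = assoc v w s"
  define e where "e = assoc (v \<otimes> s) w' t"
  have Zs: "a \<in> Z" "b \<in> Z" "e \<in> Z"
    unfolding a_def b_def e_def
    using assoc_M_Z(2)[OF sQ(2), of v w'] S_rotate(5)[OF s, of v w] S_rotate(5)[OF t, of "v \<otimes> s" w'] Q sQ w' by simp_all
  note Ns = Zs[THEN ZN] and Zc = Zs[THEN Z_carrier]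
  define P where "P = v \<otimes> (w \<otimes> s)"
  have P: "P \<in> carrier Q" using Q sQ by (simp add: P_def)
  have swap: "P \<otimes> n \<otimes> t = P \<otimes> t \<otimes> n" if n: "n \<in> Z" for n
    using N_assoc(2)[OF ZN[OF n] P tQ(1)] N_assoc(3)[OF ZN[OF n] P tQ(1)] mult_conj[OF ZN[OF n] tQ(1)] S_conj[OF t n] by simp
  have "(v \<otimes> s) \<otimes> w' = P \<otimes> a" using mult_assoc[of v s w'] w' Q sQ by (simp add: P_def a_def)
  then have "P \<otimes> a \<otimes> t = ((v \<otimes> s) \<otimes> \<psi> w) \<otimes> e"
    using mult_assoc[of "v \<otimes> s" w' t] w' Q sQ tQ by (simp add: e_def \<psi>w)
  also have "(v \<otimes> s) \<otimes> \<psi> w = P \<otimes> b \<otimes> t"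
    using \<psi>(3)[OF Q] mult_assoc[of v w s] Q sQ by (simp add: P_def b_def)
  finally have "P \<otimes> t \<otimes> a = P \<otimes> t \<otimes> (b \<otimes> e)"
    using swap[OF Zs(1)] swap[OF Zs(2)] N_assoc(3)[OF Ns(3), of "P \<otimes> t" b] P tQ Zc by simp
  then have abe: "a = b \<oplus>\<^bsub>Zmod\<^esub> e"
    unfolding Zmod_simps by (subst (asm) l_cancel) (use P tQ Zc in simp_all)
  have "a = conj (assoc s w v) w"
  proof -
    have n: "assoc v s s = \<one>" using S_vanish(4)[OF s sQ(2) Q(1)] S_vanish(3)[OF s sQ(2) Q(1)] by simp
    have nN: "assoc v s w' \<in> N" "assoc v s w \<in> N" using assoc_M_nuclear(2)[OF sQ(2)] Q w' by simp_all
    have "assoc v s (s \<otimes> w') = assoc v s w'"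
      using assoc_M_mult3(2)[OF sQ(2) Q(1) sQ(1) w'(1)] n conj_one_left w' nN N_carrier by simp
    moreover have "assoc v s (w \<otimes> s) = assoc v s w"
      using assoc_M_mult3(2)[OF sQ(2) Q sQ(1)] n S_conj[OF s] assoc_M_Z(2)[OF sQ(2) _ sQ(1)] Q N_carrier[OF nN(2)]
        assoc_in_Z[OF nN(2)] sQ by simp
    ultimately have "a = assoc v s w" using w' by (simp add: a_def)
    then show ?thesis using S_rotate(2)[OF s Q(2,1)] by simp
  qed
  moreover have "e = \<ominus>\<^bsub>Zmod\<^esub> assoc t v w"
  proof -
    have "assoc t v w' = assoc t v (s \<otimes> w')" using S_mult2(2)[OF t sQ(2) Q(1) w'(1)] by simp
    also have "\<dots> = assoc t v w"
      using S_mult2(1)[OF t sQ(2) Q] S_conj[OF s S_rotate(3)[OF t Q]] w' by simp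
    finally show ?thesis
      using S_rotate(1)[OF t, of "v \<otimes> s" w'] S_mult2(3)[OF t sQ(2) Q(1) w'(1)] Q sQ w' by (simp add: e_def)
  qed
  moreover have "b = \<ominus>\<^bsub>Zmod\<^esub> assoc s v w" using S_rotate(1)[OF s Q] by (simp add: b_def)
  moreover have "assoc (s \<otimes> t) v w = assoc t v w \<oplus>\<^bsub>Zmod\<^esub> assoc s v w"
    using S_add[OF s t Q] by (simp add: Zmod_simps)
  ultimately show ?thesis
    using abe S_rotate(3)[OF s Q] S_rotate(3)[OF t Q] Zm.minus_add Zm.a_comm
    by (simp flip: Zmod_simps(1))
qed

lemma K_defect_central:
  assumes "X \<in> carrier Q\<^sub>N" "Y \<in> carrier Q\<^sub>N"
  shows "K.defect X Y \<in> center Q\<^sub>N"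
  using assms defect_central pi_defect by (metis pi_cases)

lemma
  assumes Q: "x \<in> carrier Q" "y \<in> carrier Q" "z \<in> carrier Q"
  shows shift_S: "shift x y z \<in> S" and coshift_S: "coshift x y z \<in> S"
    and pi_shift_coshift: "\<pi> (shift x y z \<otimes> coshift x y z) =
      K.assoc (\<pi> x) (\<pi> y) (\<pi> x \<otimes>\<^bsub>Q\<^sub>N\<^esub> \<pi> y) \<ominus>\<^bsub>K.Zmod\<^esub>
      K.assoc (\<pi> x) (\<pi> y \<otimes>\<^bsub>Q\<^sub>N\<^esub> \<pi> z) (\<pi> x \<otimes>\<^bsub>Q\<^sub>N\<^esub> (\<pi> y \<otimes>\<^bsub>Q\<^sub>N\<^esub> \<pi> z)) \<oplus>\<^bsub>K.Zmod\<^esub>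
      K.assoc (\<pi> x) (\<pi> z) (\<pi> x \<otimes>\<^bsub>Q\<^sub>N\<^esub> \<pi> z)"
proof -
  define f where "f = assoc x y z"
  define g where "g = assoc x y (x \<otimes> y)"
  define h where "h = assoc x (y \<otimes> z) (x \<otimes> (y \<otimes> z))"
  define k where "k = assoc x z (x \<otimes> z)"
  have Ss: "f \<in> S" "g \<in> S" "h \<in> S" "k \<in> S" using assoc_S Q by (simp_all add: f_def g_def h_def k_def)
  note Sc = Ss[THEN S_carrier]
  have p: "\<pi> f = K.assoc (\<pi> x) (\<pi> y) (\<pi> z)" "\<pi> g = K.assoc (\<pi> x) (\<pi> y) (\<pi> x \<otimes>\<^bsub>Q\<^sub>N\<^esub> \<pi> y)"
    "\<pi> h = K.assoc (\<pi> x) (\<pi> y \<otimes>\<^bsub>Q\<^sub>N\<^esub> \<pi> z) (\<pi> x \<otimes>\<^bsub>Q\<^sub>N\<^esub> (\<pi> y \<otimes>\<^bsub>Q\<^sub>N\<^esub> \<pi> z))"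
    "\<pi> k = K.assoc (\<pi> x) (\<pi> z) (\<pi> x \<otimes>\<^bsub>Q\<^sub>N\<^esub> \<pi> z)"
    using Q by (simp_all add: f_def g_def h_def k_def pi_assoc pi_mult)
  have cl: "\<pi> f \<in> carrier K.Zmod" "\<pi> g \<in> carrier K.Zmod" "\<pi> h \<in> carrier K.Zmod" "\<pi> k \<in> carrier K.Zmod"
    unfolding p using K.assoc_Z Q by (simp_all add: K.Zmod_simps)
  have s: "\<pi> (shift x y z) = \<ominus>\<^bsub>K.Zmod\<^esub> \<pi> f"
    using pi_shift[OF Q] K.shift_eq[of "\<pi> x" "\<pi> y" "\<pi> z"] Q by (simp add: p)
  have t: "\<pi> (coshift x y z) = \<pi> f \<oplus>\<^bsub>K.Zmod\<^esub> (\<pi> g \<ominus>\<^bsub>K.Zmod\<^esub> \<pi> h \<oplus>\<^bsub>K.Zmod\<^esub> \<pi> k)"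
    using pi_coshift[OF Q] K.shift_coshift[OF K_defect_central, of "\<pi> x" "\<pi> y" "\<pi> z"] Q by (simp add: p)
  have inv: "\<pi> (u \<setminus> \<one>) = \<ominus>\<^bsub>K.Zmod\<^esub> \<pi> u" if "u \<in> carrier Q" "\<pi> u \<in> carrier K.Zmod" for u
    using K.Z_neg[of "\<pi> u"] that by (simp add: pi_hom K.Zmod_simps)
  show "shift x y z \<in> S"
    by (rule S_pi[OF S_inverse[OF Ss(1)]]) (use Q Sc s inv cl in simp_all)
  show "coshift x y z \<in> S"
  proof (rule S_pi)
    show "f \<otimes> ((g \<otimes> (h \<setminus> \<one>)) \<otimes> k) \<in> S" using Ss S_mult S_inverse by simp
    show "\<pi> (coshift x y z) = \<pi> (f \<otimes> ((g \<otimes> (h \<setminus> \<one>)) \<otimes> k))"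
      unfolding t using Sc inv[OF Sc(3) cl(3)] by (simp add: pi_mult K.Zmod_simps K.Zm.minus_eq)
  qed (use Q in simp)
  have "\<pi> (shift x y z \<otimes> coshift x y z) =
      (\<ominus>\<^bsub>K.Zmod\<^esub> \<pi> f) \<oplus>\<^bsub>K.Zmod\<^esub> (\<pi> f \<oplus>\<^bsub>K.Zmod\<^esub> (\<pi> g \<ominus>\<^bsub>K.Zmod\<^esub> \<pi> h \<oplus>\<^bsub>K.Zmod\<^esub> \<pi> k))"
    using Q by (simp add: pi_mult s t K.Zmod_simps)
  also have "\<dots> = \<pi> g \<ominus>\<^bsub>K.Zmod\<^esub> \<pi> h \<oplus>\<^bsub>K.Zmod\<^esub> \<pi> k"
    using cl by (simp add: K.Zm.r_neg1)
  finally show "\<pi> (shift x y z \<otimes> coshift x y z) =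
      K.assoc (\<pi> x) (\<pi> y) (\<pi> x \<otimes>\<^bsub>Q\<^sub>N\<^esub> \<pi> y) \<ominus>\<^bsub>K.Zmod\<^esub>
      K.assoc (\<pi> x) (\<pi> y \<otimes>\<^bsub>Q\<^sub>N\<^esub> \<pi> z) (\<pi> x \<otimes>\<^bsub>Q\<^sub>N\<^esub> (\<pi> y \<otimes>\<^bsub>Q\<^sub>N\<^esub> \<pi> z)) \<oplus>\<^bsub>K.Zmod\<^esub>
      K.assoc (\<pi> x) (\<pi> z) (\<pi> x \<otimes>\<^bsub>Q\<^sub>N\<^esub> \<pi> z)" by (simp add: p)
qed

lemma conj_shift:
  assumes Q: "x \<in> carrier Q" "y \<in> carrier Q" "z \<in> carrier Q" "v \<in> carrier Q" "w \<in> carrier Q"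
  shows "conj (assoc (shift x y z) w v) w = \<ominus>\<^bsub>Zmod\<^esub> assoc (shift x y z \<otimes> coshift x y z) v w"
proof (rule shift_coshift_autotopism[OF Q(1-3)])
  fix \<psi>
  assume a: "\<And>w. w \<in> carrier Q \<Longrightarrow> \<psi> w \<in> carrier Q"
    "\<And>w. w \<in> carrier Q \<Longrightarrow> shift x y z \<otimes> \<psi> w = (w \<otimes> shift x y z) \<otimes> coshift x y z"
    "\<And>v w. \<lbrakk>v \<in> carrier Q; w \<in> carrier Q\<rbrakk> \<Longrightarrow>
      (v \<otimes> shift x y z) \<otimes> \<psi> w = ((v \<otimes> w) \<otimes> shift x y z) \<otimes> coshift x y z"
  show ?thesis
  proof (rule transpose[where \<psi> = \<psi>])
    show "shift x y z \<in> S" "coshift x y z \<in> S" using shift_S coshift_S Q by simp_all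
  qed (fact a Q)+
qed

lemma conj_inj:
  assumes "conj a x = conj b x" "a \<in> N" "b \<in> N" "x \<in> carrier Q"
  shows "a = b"
proof -
  have "a \<otimes> x = b \<otimes> x"
    unfolding mult_conj[OF assms(2,4), symmetric] mult_conj[OF assms(3,4), symmetric] assms(1) ..
  then show ?thesis using assms N_carrier by simp
qed

text \<open>Modulo \<open>N\<close> the product of shift and coshift is symmetric in \<open>y\<close> and \<open>z\<close>, so by \<open>conj_shift\<close> the shifts
  of \<open>x, y, z\<close> and \<open>x, z, y\<close> have the same associator maps.  Their quotient is then nuclear, and modulo
  \<open>N\<close> a shift is minus an associator.\<close>

lemma K_assoc_symmetric:
  assumes "X \<in> carrier Q\<^sub>N" "Y \<in> carrier Q\<^sub>N" "W \<in> carrier Q\<^sub>N"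
  shows "K.assoc X Y W = K.assoc X W Y"
proof -
  obtain x y z where Q: "x \<in> carrier Q" "y \<in> carrier Q" "z \<in> carrier Q"
    and XYW: "X = \<pi> x" "Y = \<pi> y" "W = \<pi> z"
    using assms by (metis pi_cases)
  define s where "s = shift x y z"
  define t where "t = shift x z y"
  define s' where "s' = s \<otimes> coshift x y z"
  define t' where "t' = t \<otimes> coshift x z y"
  have st: "s \<in> S" "t \<in> S" "s' \<in> carrier Q" "t' \<in> carrier Q"
    using Q shift_S S_carrier by (simp_all add: s_def t_def s'_def t'_def)
  have p: "\<pi> s' = \<pi> t'"
    using pi_shift_coshift[OF Q] pi_shift_coshift[OF Q(1,3,2)] K.F.f_quadratic_comm[of "\<pi> x" "\<pi> y" "\<pi> z"] K.assoc_Z Q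
    by (simp add: s'_def t'_def s_def t_def K.Zm.minus_eq K.Zm.a_ac K.Zmod_simps(1)[symmetric])
  have D: "assoc s w v = assoc t w v" if vw: "v \<in> carrier Q" "w \<in> carrier Q" for v w
  proof (rule conj_inj)
    have "assoc s' v w = assoc t' v w" by (rule assoc_pi_cong[OF p refl refl]) (use st vw in simp_all)
    then show "conj (assoc s w v) w = conj (assoc t w v) w"
      using conj_shift[OF Q vw] conj_shift[OF Q(1,3,2) vw] by (simp add: s_def t_def s'_def t'_def)
  qed (use st vw S_rotate(3) ZN in auto)
  have i: "t \<setminus> \<one> \<in> S" using S_inverse[OF st(2)] .
  have "s \<otimes> (t \<setminus> \<one>) \<in> N"
  proof (rule S_nuclear)
    show "s \<otimes> (t \<setminus> \<one>) \<in> S" using S_mult[OF st(1) i] .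
    fix v w assume vw: "v \<in> carrier Q" "w \<in> carrier Q"
    have "assoc (s \<otimes> (t \<setminus> \<one>)) v w = assoc (t \<otimes> (t \<setminus> \<one>)) v w"
      using S_add[OF st(1) i vw] S_add[OF st(2) i vw] D[OF vw(2,1)] by simp
    then show "assoc (s \<otimes> (t \<setminus> \<one>)) v w = \<one>"
      using assoc_eq_one(1)[OF N_one vw] S_carrier[OF st(2)] by simp
  qed
  then have "\<pi> s \<otimes>\<^bsub>Q\<^sub>N\<^esub> \<pi> (t \<setminus> \<one>) = \<pi> t \<otimes>\<^bsub>Q\<^sub>N\<^esub> \<pi> (t \<setminus> \<one>)"
    using pi_eq_one_iff st S_carrier by (simp flip: pi_mult add: pi_one)
  then have "\<pi> s = \<pi> t" by (subst (asm) K.r_cancel) (use st S_carrier in simp_all)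
  then have "\<ominus>\<^bsub>K.Zmod\<^esub> K.assoc X Y W = \<ominus>\<^bsub>K.Zmod\<^esub> K.assoc X W Y"
    using pi_shift[OF Q] pi_shift[OF Q(1,3,2)] K.shift_eq assms by (simp add: s_def t_def XYW)
  then show ?thesis using K.assoc_Z assms K.Zm.minus_minus by (metis K.Zmod_simps(1))
qed

text \<open>By the symmetry, the product of shift and coshift is trivial modulo \<open>N\<close>
  (\<open>f_symmetric_quadratic\<close>).  So by \<open>conj_shift\<close> the associator map of the shift vanishes and the
  shift is nuclear, which means that \<open>assoc x y z\<close> is trivial modulo \<open>N\<close>.\<close>

lemma assoc_nuclear_step:
  assumes Q: "x \<in> carrier Q" "y \<in> carrier Q" "z \<in> carrier Q"
  shows "assoc x y z \<in> N"
proof -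
  define s where "s = shift x y z"
  have s: "s \<in> S" using shift_S[OF Q] by (simp add: s_def)
  have "\<pi> (shift x y z \<otimes> coshift x y z) = \<one>\<^bsub>Q\<^sub>N\<^esub>"
    using pi_shift_coshift[OF Q] K.F.f_symmetric_quadratic[OF K_assoc_symmetric, of "\<pi> x" "\<pi> y" "\<pi> z"] Q
    by (simp add: K.Zmod_simps)
  then have n: "shift x y z \<otimes> coshift x y z \<in> N" using pi_eq_one_iff Q by simp
  have "s \<in> N"
  proof (rule S_nuclear[OF s])
    fix w v assume vw: "w \<in> carrier Q" "v \<in> carrier Q"
    have "conj (assoc s w v) w = conj \<one> w"
      using conj_shift[OF Q vw(2,1)] assoc_eq_one(1)[OF n vw(2,1)] K.F.neg_zero
        Zm.minus_equality[of "\<zero>\<^bsub>Zmod\<^esub>" "\<zero>\<^bsub>Zmod\<^esub>"] Zm.zero_closed Zm.l_zero conj_one_left vw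
      by (simp add: s_def Zmod_simps)
    then show "assoc s w v = \<one>" by (rule conj_inj) (use s vw S_rotate(3) ZN N_one in auto)
  qed
  then have "\<ominus>\<^bsub>K.Zmod\<^esub> K.assoc (\<pi> x) (\<pi> y) (\<pi> z) = \<zero>\<^bsub>K.Zmod\<^esub>"
    using pi_shift[OF Q] K.shift_eq[of "\<pi> x" "\<pi> y" "\<pi> z"] Q pi_eq_one_iff[of s] N_carrier by (simp add: s_def K.Zmod_simps)
  then have "K.assoc (\<pi> x) (\<pi> y) (\<pi> z) = \<zero>\<^bsub>K.Zmod\<^esub>"
    using K.assoc_Z[of "\<pi> x" "\<pi> y" "\<pi> z"] Q K.Zm.minus_minus K.F.neg_zero by (metis K.Zmod_simps(1) pi_closed)
  then show ?thesis using pi_assoc[OF Q] pi_eq_one_iff Q by (simp add: K.Zmod_simps)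
qed

end

section \<open>All associators are nuclear\<close>

lemma (in buchsteiner_loop) nuclear_from_factor:
  assumes "nuclear_buchsteiner_loop Q\<^sub>N"
  shows "nuclear_buchsteiner_loop Q"
proof -
  interpret nuclear_factor Q
    by (intro nuclear_factor.intro nuclear_factor_axioms.intro buchsteiner_loop_axioms assms)
  show ?thesis
    by (intro nuclear_buchsteiner_loop.intro nuclear_buchsteiner_loop_axioms.intro buchsteiner_loop_axioms
        assoc_nuclear_step)
qed

text \<open>Defects are central modulo the nucleus, so they disappear in the second factor loop.\<close>

theorem buchsteiner_nuclear:
  assumes "buchsteiner_loop Q"
  shows "nuclear_buchsteiner_loop Q"
proof -
  interpret Q0: buchsteiner_loop Q by (rule assms)
  interpret Q1: buchsteiner_loop "Q Mod nucleus Q" by (rule Q0.Q\<^sub>N_buchsteiner)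
  interpret Q2: buchsteiner_loop "Q Mod nucleus Q Mod nucleus (Q Mod nucleus Q)" by (rule Q1.Q\<^sub>N_buchsteiner)
  have wip: "Q2.defect X Y = \<one>\<^bsub>Q1.Q\<^sub>N\<^esub>" if "X \<in> carrier Q1.Q\<^sub>N" "Y \<in> carrier Q1.Q\<^sub>N" for X Y
  proof -
    have "\<exists>x \<in> carrier Q. V = Q1.\<pi> (Q0.\<pi> x)" if V: "V \<in> carrier Q1.Q\<^sub>N" for V
      by (rule Q1.pi_cases[OF V], rule Q0.pi_cases, assumption) auto
    then obtain x y where xy: "x \<in> carrier Q" "y \<in> carrier Q" "X = Q1.\<pi> (Q0.\<pi> x)" "Y = Q1.\<pi> (Q0.\<pi> y)"
      using \<open>X \<in> _\<close> \<open>Y \<in> _\<close> by blast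
    have "Q1.defect (Q0.\<pi> x) (Q0.\<pi> y) \<in> nucleus Q0.Q\<^sub>N"
      using Q0.defect_central[OF xy(1,2)] Q0.pi_defect[OF xy(1,2)] by (simp add: center_def)
    then have "Q1.\<pi> (Q1.defect (Q0.\<pi> x) (Q0.\<pi> y)) = \<one>\<^bsub>Q1.Q\<^sub>N\<^esub>"
      using Q1.pi_eq_one_iff[of "Q1.defect (Q0.\<pi> x) (Q0.\<pi> y)"] Q1.N_carrier by blast
    then show ?thesis
      using Q1.pi_defect[of "Q0.\<pi> x" "Q0.\<pi> y"] xy by simp
  qed
  have "nuclear_buchsteiner_loop Q1.Q\<^sub>N"
    by (intro nuclear_buchsteiner_loop.intro nuclear_buchsteiner_loop_axioms.intro Q1.Q\<^sub>N_buchsteiner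
        Q2.wip_assoc_nuclear[OF wip])
  then show ?thesis by (intro Q0.nuclear_from_factor Q1.nuclear_from_factor)
qed

section \<open>Finite abelian groups of exponent four\<close>

lemma (in group) ord_eq_four:
  assumes g: "g \<in> carrier G" and "g [^] (4::nat) = \<one>" "g \<otimes> g \<noteq> \<one>"
  shows "ord g = 4"
proof -
  have "ord g dvd 4" using assms pow_eq_id by simp
  moreover have "\<not> ord g dvd 2"
    using pow_eq_id[OF g, of 2] assms by (simp add: numeral_2_eq_2)
  moreover have "ord g \<in> {1,2,4}"
  proof -
    have "ord g \<le> 4" using \<open>ord g dvd 4\<close> by (simp add: dvd_imp_le)
    then have "ord g = 0 \<or> ord g = 1 \<or> ord g = 2 \<or> ord g = 3 \<or> ord g = 4" by linarith
    then show ?thesis using \<open>ord g dvd 4\<close> by auto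
  qed
  ultimately show ?thesis by auto
qed

lemma (in comm_group) iso_C4_C2:
  assumes order: "order G = 8" and exp4: "\<And>g. g \<in> carrier G \<Longrightarrow> g [^] (4::nat) = \<one>"
    and g: "g \<in> carrier G" "g \<otimes> g \<noteq> \<one>"
  shows "G \<cong> integer_mod_group 4 \<times>\<times> integer_mod_group 2"
proof -
  have fin: "finite (carrier G)" using order by (metis card.infinite order_def zero_neq_numeral)
  have og: "ord g = 4" using ord_eq_four exp4 g by simp
  define C where "C = generate G {g}"
  have C: "subgroup C G" unfolding C_def using generate_is_subgroup g by simp
  have cardC: "card C = 4" unfolding C_def using generate_pow_card[OF g(1)] og by simp
  have C_pow: "C = {g [^] k | k. k \<in> (UNIV :: int set)}" unfolding C_def by (rule generate_pow[OF g(1)])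
  have "C \<noteq> carrier G" using cardC order by (auto simp: order_def)
  then obtain u where u: "u \<in> carrier G" "u \<notin> C" using subgroup.subset[OF C] by blast
  have uu: "u \<otimes> u \<in> C"
  proof -
    interpret N: normal C G using C normal_iff_subgroup by simp
    interpret F: group "G Mod C" by (rule N.factorgroup_is_group)
    have "order (G Mod C) = 2"
      using lagrange[OF C] order cardC by (simp add: order_def FactGroup_def)
    moreover have "C #> u \<in> carrier (G Mod C)" using u by (auto simp: FactGroup_def RCOSETS_def)
    ultimately have "(C #> u) [^]\<^bsub>G Mod C\<^esub> (2::nat) = \<one>\<^bsub>G Mod C\<^esub>" using F.pow_order_eq_1 by metis
    then have "(C #> u) <#> (C #> u) = C"
      using F.l_one \<open>C #> u \<in> _\<close> by (simp add: numeral_2_eq_2 FactGroup_def)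
    then have "C #> (u \<otimes> u) = C" using N.rcos_sum u by simp
    then show ?thesis using coset_join1[of C "u \<otimes> u"] C u by (simp add: N.subset)
  qed
  then obtain k :: int where k: "u \<otimes> u = g [^] k" using C_pow by auto
  have "even k"
  proof -
    have "g [^] (k + k) = (u \<otimes> u) \<otimes> (u \<otimes> u)" using k int_pow_mult[OF g(1), of k k] by simp
    also have "\<dots> = u [^] (4::nat)" using u by (simp add: numeral_eq_Suc m_assoc)
    also have "\<dots> = \<one>" using exp4 u by simp
    finally have "4 dvd k + k" using int_pow_eq_id[OF g(1)] og by simp
    then show ?thesis by presburger
  qed
  \<comment> \<open>an involution outside \<open>C\<close>, since \<open>u\<^sup>2 = g\<^sup>k\<close>\<close>
  define v where "v = u \<otimes> g [^] (- (k div 2))"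
  have v: "v \<in> carrier G" using u g by (simp add: v_def)
  have gC: "g [^] i \<in> C" for i :: int using C_pow by auto
  have vC: "v \<notin> C"
  proof
    assume "v \<in> C"
    then have "v \<otimes> g [^] (k div 2) \<in> C" using subgroup.m_closed[OF C] gC by blast
    moreover have "v \<otimes> g [^] (k div 2) = u"
      using u g by (simp add: v_def m_assoc flip: int_pow_mult)
    ultimately show False using u by simp
  qed
  have vv: "v \<otimes> v = \<one>"
  proof -
    have "v \<otimes> v = (u \<otimes> u) \<otimes> (g [^] (- (k div 2)) \<otimes> g [^] (- (k div 2)))"
      using u g by (simp add: v_def m_ac)
    also have "\<dots> = g [^] (k + (- (k div 2) + - (k div 2)))" by (simp only: k int_pow_mult[OF g(1)])
    also have "k + (- (k div 2) + - (k div 2)) = 0" using \<open>even k\<close> by presburger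
    finally show ?thesis by simp
  qed
  have ov: "ord v dvd 2" using pow_eq_id[OF v, of 2] vv v by (simp add: numeral_2_eq_2)
  let ?H = "integer_mod_group 4 \<times>\<times> integer_mod_group 2"
  define h where "h = (\<lambda>(i :: int, j :: int). g [^] i \<otimes> v [^] j)"
  have gmod: "g [^] (i mod 4) = g [^] i" for i :: int
    using int_pow_eq[OF g(1)] og by (simp add: mod_eq_dvd_iff[symmetric])
  have vmod: "v [^] (j mod 2) = v [^] j" for j :: int
  proof -
    have "int (ord v) dvd 2" using ov by (metis int_dvd_int_iff of_nat_numeral)
    moreover have "2 dvd j - j mod 2" by (simp add: minus_mod_eq_mult_div)
    ultimately show ?thesis using int_pow_eq[OF v] dvd_trans by blast
  qed
  interpret H: group ?H by (simp add: DirProd_group)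
  have "h \<in> hom ?H G"
    by (rule homI) (use g v in \<open>auto simp: h_def gmod vmod int_pow_mult m_ac\<close>)
  then interpret h: group_hom ?H G h by (simp add: group_hom_def group_hom_axioms_def)
  have "inj_on h (carrier ?H)"
  proof (subst h.inj_on_one_iff, intro allI impI)
    fix p assume p: "p \<in> carrier ?H" and hp: "h p = \<one>"
    obtain i j where ij: "p = (i, j)" by fastforce
    have r: "0 \<le> i" "i < 4" "j = 0 \<or> j = 1" using p by (auto simp: ij carrier_integer_mod_group)
    have "j = 0"
    proof (rule ccontr)
      assume "j \<noteq> 0"
      then have "g [^] i \<otimes> v = \<one>" using hp r v by (simp add: h_def ij)
      then have "v = g [^] (- i)" using g v by (metis int_pow_closed int_pow_neg inv_unique' l_inv_ex inv_equality inv_inv inv_closed)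
      then show False using vC gC by simp
    qed
    then have "g [^] i = \<one>" using hp g by (simp add: h_def ij)
    then have "4 dvd i" using int_pow_eq_id[OF g(1)] og by simp
    then show "p = \<one>\<^bsub>?H\<^esub>" using r \<open>j = 0\<close> by (auto simp: ij elim!: dvdE)
  qed
  moreover have "h ` carrier ?H = carrier G"
  proof (rule card_subset_eq[OF fin])
    show "h ` carrier ?H \<subseteq> carrier G" by auto
    show "card (h ` carrier ?H) = card (carrier G)"
      using card_image[OF \<open>inj_on h _\<close>] order by (simp add: order_def carrier_integer_mod_group)
  qed
  ultimately have "?H \<cong> G"
    using \<open>h \<in> hom ?H G\<close> by (auto simp: is_iso_def iso_def bij_betw_def)
  then show ?thesis by (rule H.iso_sym)
qed

section \<open>Counting associators\<close>

context associator_module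
begin

lemma f_exchange1:
  assumes "x \<in> carrier Q" "y \<in> carrier Q" "z \<in> carrier Q" "w \<in> carrier Q"
  shows "f w y z \<oplus> f x y z \<bullet> w = f x y z \<oplus> f w y z \<bullet> x"
  using f_sym1[of y z x w] f_mult1[of x w y z] f_mult1[of w x y z] assms by simp

lemma f_exchange2:
  assumes "x \<in> carrier Q" "y \<in> carrier Q" "z \<in> carrier Q" "w \<in> carrier Q"
  shows "f x w z \<oplus> f x y z \<bullet> w = f x y z \<oplus> f x w z \<bullet> y"
  using f_sym2[of x z y w] f_mult2[of x y w z] f_mult2[of x w y z] assms by simp

lemma f_square_self:
  assumes z: "z \<in> carrier Q"
  shows "f z z (z \<star> z) = \<zero>"
proof -
  have "f z z z \<bullet> z = \<ominus> f z z z" using f_cycle[OF z z z] f_act_square[OF z z z z] by simp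
  then show ?thesis using f_mult3[OF z z z z] z by (simp add: R.r_neg)
qed

lemma f_square_mult:
  assumes "x \<in> carrier Q" "y \<in> carrier Q" "z \<in> carrier Q" "w \<in> carrier Q"
  shows "f (x \<star> y) w (z \<star> z) = f y w (z \<star> z) \<oplus> f x w (z \<star> z)"
    and "f w (x \<star> y) (z \<star> z) = f w y (z \<star> z) \<oplus> f w x (z \<star> z)"
  using f_mult1[of x y w "z \<star> z"] f_mult2[of w x y "z \<star> z"] assms
  by (simp_all add: f_square_fixed)

text \<open>Every \<open>w\<close> sends \<open>a\<close> to \<open>a\<close> or \<open>a + e\<close>, and \<open>f_cycle\<close> forces \<open>a\<^bsup>xy\<^esup> = a + e\<close>.  If \<open>2a = 0\<close>, then \<open>z\<close> moves
  \<open>a\<close> and the exchange rules show that \<open>x\<close> and \<open>y\<close> do as well, so \<open>a\<^bsup>xy\<^esup> = a\<close>.  If \<open>2a = e\<close>, then \<open>z\<close> fixes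
  \<open>a\<close> and the exchange rule shows that everything does.\<close>

lemma four_element_contradiction:
  assumes Q: "x \<in> carrier Q" "y \<in> carrier Q" "z \<in> carrier Q"
    and e: "e = f x y (z \<star> z)" "e \<noteq> \<zero>" and a: "a = f x y z"
    and dbl: "a \<oplus> a \<in> {\<zero>, e}"
    and f_in: "\<And>u v w. \<lbrakk>u \<in> carrier Q; v \<in> carrier Q; w \<in> carrier Q\<rbrakk> \<Longrightarrow> f u v w \<in> {\<zero>, e, a, a \<oplus> e}"
    and act_in: "\<And>w. w \<in> carrier Q \<Longrightarrow> a \<bullet> w \<in> {\<zero>, e, a, a \<oplus> e}"
    and ae: "a \<notin> {\<zero>, e}"
  shows False
proof -
  have R: "a \<in> carrier R" "e \<in> carrier R" using Q by (simp_all add: a e)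
  have ew: "e \<bullet> w = e" if "w \<in> carrier Q" for w using f_square_fixed[OF Q that] by (simp add: e)
  have ee: "e \<oplus> e = \<zero>" using f_square_double[OF Q] by (simp add: e)
  have az: "a \<oplus> a \<bullet> z = e" using f_mult3[OF Q Q(3)] by (simp add: a e)
  have aw: "a \<bullet> w = a \<or> a \<bullet> w = a \<oplus> e" if w: "w \<in> carrier Q" for w
  proof -
    have "a \<bullet> w \<noteq> \<zero>" using act_cancel[of a w \<zero>] w R ae by auto
    moreover have "a \<bullet> w \<noteq> e" using act_cancel[of a w e] ew[OF w] w R ae by auto
    ultimately show ?thesis using act_in[OF w] by auto
  qed
  have aew: "(a \<oplus> e) \<bullet> w = a \<oplus> e \<or> (a \<oplus> e) \<bullet> w = a" if w: "w \<in> carrier Q" for w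
    using aw[OF w] ew[OF w] w R ee by (auto simp: act_add R.a_assoc)
  \<comment> \<open>\<open>w\<close> fixes all associators as soon as it fixes \<open>a\<close>\<close>
  have fixed: "f u v t \<bullet> w = f u v t" if "a \<bullet> w = a" "w \<in> carrier Q" "u \<in> carrier Q" "v \<in> carrier Q" "t \<in> carrier Q" for u v t w
    using f_in[OF that(3-5)] that(1,2) ew[OF that(2)] R by (auto simp: act_add)
  have axy: "a \<bullet> x \<bullet> y = a \<oplus> e"
  proof (rule act_cancel)
    have "a \<oplus> (a \<oplus> e) \<bullet> z = a \<oplus> a \<bullet> z \<oplus> e" using R Q ew[OF Q(3)] by (simp add: act_add R.a_assoc)
    also have "\<dots> = \<zero>" using az ee by simp
    finally have "\<ominus> a = (a \<oplus> e) \<bullet> z" using R Q by (intro R.minus_equality) (simp_all add: R.a_comm)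
    then show "a \<bullet> x \<bullet> y \<bullet> z = (a \<oplus> e) \<bullet> z" using f_cycle[OF Q] by (simp add: a)
  qed (use R Q in simp_all)
  have neq: "a \<oplus> e \<noteq> a" using R e(2) by simp
  from dbl show False
  proof (cases "a \<oplus> a = \<zero>")
    case True
    have "a \<bullet> z \<noteq> a" using az True e(2) by auto
    then have z: "a \<bullet> z = a \<oplus> e" using aw Q by blast
    have x: "a \<bullet> x = a \<oplus> e"
    proof (rule ccontr)
      assume "a \<bullet> x \<noteq> a \<oplus> e"
      then have "a \<bullet> x = a" using aw Q by blast
      then have "f z y z \<oplus> (a \<oplus> e) = a \<oplus> f z y z"
        using f_exchange1[OF Q(1,2,3,3)] fixed[of x z y z] Q z by (simp add: a)
      then have "f z y z \<oplus> a \<oplus> e = f z y z \<oplus> a" using R Q by (simp add: R.a_ac)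
      then show False using R Q e(2) by simp
    qed
    have y: "a \<bullet> y = a \<oplus> e"
    proof (rule ccontr)
      assume "a \<bullet> y \<noteq> a \<oplus> e"
      then have "a \<bullet> y = a" using aw Q by blast
      then have "f x z z \<oplus> (a \<oplus> e) = a \<oplus> f x z z"
        using f_exchange2[OF Q(1,2,3,3)] fixed[of y x z z] Q z by (simp add: a)
      then have "f x z z \<oplus> a \<oplus> e = f x z z \<oplus> a" using R Q by (simp add: R.a_ac)
      then show False using R Q e(2) by simp
    qed
    have "a \<bullet> x \<bullet> y = a" using x y ew[OF Q(2)] R Q ee by (simp add: act_add R.a_assoc)
    then show False using axy neq by simp
  next
    case False
    then have "a \<oplus> a = a \<oplus> a \<bullet> z" using dbl az by simp
    then have z: "a \<bullet> z = a" using R Q by simp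
    have "a \<bullet> w = a" if w: "w \<in> carrier Q" for w
    proof -
      have "f x y w \<oplus> a \<bullet> w = a \<oplus> f x y w"
        using f_exchange3[OF Q w] fixed[of z x y w] z Q w by (simp add: a)
      then have "f x y w \<oplus> a \<bullet> w = f x y w \<oplus> a" using R Q w by (simp add: R.a_comm)
      then show ?thesis using R Q w by simp
    qed
    then show False using axy neq Q by simp
  qed
qed

text \<open>The element \<open>e\<close> has order two, so a submodule \<open>B\<close> with fewer than eight elements has two, four or six.
  The first is impossible as \<open>a \<notin> {0, e}\<close>.  With six elements \<open>t = 3a\<close> satisfies \<open>2t = 0\<close>; then \<open>t\<close> is
  \<open>0\<close> or \<open>e\<close>, hence fixed, and \<open>3e = t + t\<^sup>z = 0\<close>, contrary to \<open>3e = e\<close>.  The case of four elements is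
  excluded by \<open>four_element_contradiction\<close>.\<close>

lemma card_associators_ge_8:
  assumes B: "subgroup B (add_monoid R)" "finite B"
    and f_B: "\<And>x y z. \<lbrakk>x \<in> carrier Q; y \<in> carrier Q; z \<in> carrier Q\<rbrakk> \<Longrightarrow> f x y z \<in> B"
    and act_B: "\<And>a x. \<lbrakk>a \<in> B; x \<in> carrier Q\<rbrakk> \<Longrightarrow> a \<bullet> x \<in> B"
    and Q: "x \<in> carrier Q" "y \<in> carrier Q" "z \<in> carrier Q" and nz: "f x y (z \<star> z) \<noteq> \<zero>"
  shows "8 \<le> card B"
proof (rule ccontr)
  assume "\<not> 8 \<le> card B"
  then have less: "card B < 8" by simp
  define a where "a = f x y z"
  define e where "e = f x y (z \<star> z)"
  have aB: "a \<in> B" "e \<in> B" using f_B Q by (simp_all add: a_def e_def)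
  have BR: "B \<subseteq> carrier R" and B_zero: "\<zero> \<in> B" and B_add: "\<And>b c. \<lbrakk>b \<in> B; c \<in> B\<rbrakk> \<Longrightarrow> b \<oplus> c \<in> B"
    using subgroup.subset[OF B(1)] subgroup.one_closed[OF B(1)] subgroup.m_closed[OF B(1)] by auto
  have R: "a \<in> carrier R" "e \<in> carrier R" using aB BR by auto
  have e0: "e \<noteq> \<zero>" using nz by (simp add: e_def)
  have ew: "e \<bullet> w = e" if "w \<in> carrier Q" for w using f_square_fixed[OF Q that] by (simp add: e_def)
  have ee: "e \<oplus> e = \<zero>" using f_square_double[OF Q] by (simp add: e_def)
  have az: "a \<oplus> a \<bullet> z = e" using f_mult3[OF Q Q(3)] by (simp add: a_def e_def)
  interpret BG: group "add_monoid R\<lparr>carrier := B\<rparr>"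
    using R.add.subgroup_imp_group[OF B(1)] by simp
  have dvd: "card H dvd card B" if H: "H \<subseteq> B" "\<zero> \<in> H" "\<And>h k. \<lbrakk>h \<in> H; k \<in> H\<rbrakk> \<Longrightarrow> h \<oplus> k \<in> H" for H
  proof -
    have "\<ominus> h \<in> H" if "h \<in> H" for h
    proof -
      have fin: "finite H" using H(1) B(2) finite_subset by blast
      have "inj_on ((\<oplus>) h) H" using H(1) BR that by (auto intro!: inj_onI simp: subset_iff)
      then have "(\<oplus>) h ` H = H" using fin H(3)[OF that] by (intro endo_inj_surj) auto
      then obtain k where k: "k \<in> H" "h \<oplus> k = \<zero>" using H(2) by (metis imageE)
      then have "\<ominus> h = k" using R.minus_equality[of k h] R.a_comm[of h k] H(1) BR that by auto
      then show ?thesis using k by simp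
    qed
    then have "subgroup H (add_monoid R)"
      using H BR by (intro R.add.subgroupI) (auto simp: a_inv_def)
    then have "subgroup H (add_monoid R\<lparr>carrier := B\<rparr>)"
      using R.add.subgroup_incl[OF _ B(1)] H(1) by simp
    from BG.lagrange[OF this] show ?thesis by (metis dvd_triv_right order_def partial_object.select_convs(1) partial_object.update_convs(1))
  qed
  have four: "card B = 4 \<and> B = {\<zero>, e, t, t \<oplus> e}" if t: "t \<in> B" "t \<notin> {\<zero>, e}" "t \<oplus> t \<in> {\<zero>, e}" for t
  proof -
    let ?H = "{\<zero>, e, t, t \<oplus> e}"
    have tR: "t \<in> carrier R" using t BR by auto
    have "t \<oplus> e \<noteq> \<zero>"
    proof
      assume "t \<oplus> e = \<zero>"
      then have "t \<oplus> e \<oplus> e = e" using R by simp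
      then show False using R tR ee t(2) by (simp add: R.a_assoc)
    qed
    moreover have "t \<oplus> e \<noteq> e" "t \<oplus> e \<noteq> t" using R tR e0 t(2) by auto
    ultimately have card: "card ?H = 4" using t(2) e0 by (auto simp: card_insert_if)
    have HB: "?H \<subseteq> B" using t(1) aB(2) B_zero B_add by simp
    have e_e: "e \<oplus> (e \<oplus> s) = s" if "s \<in> carrier R" for s
      using R that ee by (simp flip: R.a_assoc)
    have hk: "h \<oplus> k \<in> ?H" if "h \<in> ?H" "k \<in> ?H" for h k
    proof (cases "t \<oplus> t = \<zero>")
      case True
      have "t \<oplus> (t \<oplus> s) = s" if "s \<in> carrier R" for s
        using tR that True by (simp flip: R.a_assoc)
      then show ?thesis using that True R tR ee by (auto simp: R.a_ac e_e)
    next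
      case False
      then have e_def: "t \<oplus> t = e" using t(3) by simp
      have "t \<oplus> (t \<oplus> s) = e \<oplus> s" if "s \<in> carrier R" for s
        using tR that e_def by (simp flip: R.a_assoc)
      then show ?thesis using that e_def R tR ee by (auto simp: R.a_ac e_e)
    qed
    have "card ?H dvd card B" by (rule dvd[OF HB]) (simp, rule hk)
    then have "4 dvd card B" using card by simp
    moreover have "card B \<ge> 4" using card_mono[OF B(2) HB] card by simp
    ultimately have "card B = 4" using less by presburger
    then show ?thesis using card_subset_eq[OF B(2) HB] card by simp
  qed
  have ae: "a \<notin> {\<zero>, e}" using az ew Q e0 ee R by auto
  have "B = {\<zero>, e, a, a \<oplus> e} \<and> a \<oplus> a \<in> {\<zero>, e}"
  proof (cases "a \<oplus> a \<in> {\<zero>, e}")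
    case True
    then show ?thesis using four[OF aB(1) ae] by simp
  next
    case False
    have "card {\<zero>, e} dvd card B" by (rule dvd) (use aB B_zero R ee in auto)
    then have "even (card B)" using e0 by (simp add: numeral_2_eq_2)
    have "a \<oplus> e \<notin> {\<zero>, e, a}"
    proof -
      have "a \<oplus> e \<noteq> \<zero>"
      proof
        assume "a \<oplus> e = \<zero>"
        then have "a \<oplus> e \<oplus> e = e" using R by simp
        then show False using R ee ae by (simp add: R.a_assoc)
      qed
      then show ?thesis using R e0 ae by auto
    qed
    moreover have "a \<oplus> a \<noteq> a" "a \<oplus> a \<noteq> a \<oplus> e" using R ae by auto
    ultimately have "card {\<zero>, e, a, a \<oplus> e, a \<oplus> a} = 5"
      using ae e0 False by (auto simp: card_insert_if)
    moreover have "{\<zero>, e, a, a \<oplus> e, a \<oplus> a} \<subseteq> B" using aB B_zero B_add by simp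
    ultimately have "5 \<le> card B" using card_mono[OF B(2)] by metis
    then have card6: "card B = 6" using less \<open>even (card B)\<close> by presburger
    define t where "t = a \<oplus> (a \<oplus> a)"
    have tR: "t \<in> carrier R" and tB: "t \<in> B" using R aB B_add by (simp_all add: t_def)
    have "a [^]\<^bsub>add_monoid R\<lparr>carrier := B\<rparr>\<^esub> (6::nat) = \<zero>"
      using BG.pow_order_eq_1[of a] aB card6 by (simp add: order_def)
    then have tt: "t \<oplus> t = \<zero>"
      using R by (simp add: t_def numeral_eq_Suc R.a_assoc)
    have "t \<in> {\<zero>, e}" using four[OF tB] tt card6 by auto
    then have "t \<bullet> z = t" using ew Q by auto
    have "(a \<oplus> a \<bullet> z) \<oplus> ((a \<oplus> a \<bullet> z) \<oplus> (a \<oplus> a \<bullet> z)) = t \<oplus> t \<bullet> z"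
      using R Q by (simp add: t_def act_add R.a_ac)
    then have "e = \<zero>" using \<open>t \<bullet> z = t\<close> tt az ee R by simp
    then show ?thesis using e0 by simp
  qed
  then show False
    using four_element_contradiction[OF Q e_def e0 a_def] f_B act_B[OF aB(1)] ae by blast
qed

end

section \<open>The factor by the nucleus and the associator subloop\<close>

context nuclear_buchsteiner_loop
begin

lemma nucleus_if_assoc_one:
  assumes "a \<in> carrier Q" "\<And>x y. \<lbrakk>x \<in> carrier Q; y \<in> carrier Q\<rbrakk> \<Longrightarrow> assoc x y a = \<one>"
  shows "a \<in> N"
  by (rule nucleus_if_right) (use assms mult_assoc in force)+

lemma assoc_zero_iff: "assoc x y z = \<zero>\<^bsub>Zmod\<^esub> \<longleftrightarrow> assoc x y z = \<one>"
  by (simp add: Zmod_simps)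

lemma factor_group: "group Q\<^sub>N"
  unfolding group_Mod_iff[OF N_normal]
proof (intro ballI)
  fix x y z assume Q: "x \<in> carrier Q" "y \<in> carrier Q" "z \<in> carrier Q"
  then show "((x \<otimes> y) \<otimes> z) \<div> (x \<otimes> (y \<otimes> z)) \<in> N"
    using N_conj(1)[OF assoc_nuclear[OF Q], of "x \<otimes> (y \<otimes> z)"] mult_assoc[OF Q] by simp
qed

text \<open>The commutator \<open>c\<close> of \<open>y\<close> and \<open>z\<close> acts trivially on associators because the action is commutative;
  then additivity and \<open>f_sym3\<close> make all associators ending in \<open>c\<close> vanish.\<close>

lemma factor_commute:
  assumes Q: "y \<in> carrier Q" "z \<in> carrier Q"
  shows "\<pi> (y \<otimes> z) = \<pi> (z \<otimes> y)"
proof -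
  define c where "c = (z \<otimes> y) \<setminus> (y \<otimes> z)"
  have c: "c \<in> carrier Q" "z \<otimes> y \<otimes> c = y \<otimes> z" using Q by (simp_all add: c_def)
  have "c \<in> N"
  proof (rule nucleus_if_assoc_one[OF c(1)])
    fix u v assume uv: "u \<in> carrier Q" "v \<in> carrier Q"
    define b where "b = assoc u v (z \<otimes> y)"
    have b: "b \<in> carrier Zmod" using uv Q by (simp add: b_def)
    have "conj (conj (conj b c) z) y = conj (conj (conj b z) y) c"
      using F.f_act_commute[OF uv _ c(1) Q(2), of "z \<otimes> y"] F.f_act_commute2[OF uv _ c(1) Q(1), of "z \<otimes> y" z] Q
      by (simp add: b_def)
    also have "\<dots> = conj b (z \<otimes> y \<otimes> c)" using b Q c(1) F.act_mult by simp
    also have "\<dots> = conj (conj b z) y"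
      unfolding c(2) using F.f_act_commute[OF uv _ Q, of "z \<otimes> y"] F.act_mult[OF b Q] Q by (simp add: b_def)
    finally have bc: "conj b c = b"
      using F.act_cancel[of "conj (conj b c) z" y "conj b z"] F.act_cancel[of "conj b c" z b] b c(1) Q by simp
    have "b = assoc u v (z \<otimes> y \<otimes> c)"
      unfolding c(2) b_def using F.f_sym3[OF uv Q] by simp
    also have "\<dots> = assoc u v c \<oplus>\<^bsub>Zmod\<^esub> b"
      using F.f_mult3[of u v "z \<otimes> y" c] uv Q c(1) bc by (simp add: b_def)
    finally have "assoc u v c = \<zero>\<^bsub>Zmod\<^esub>"
      using b uv c(1) by (metis F.f_closed Zm.add.r_cancel_one)
    then show "assoc u v c = \<one>" by (simp add: assoc_zero_iff)
  qed
  then show ?thesis using pi_mult_N[of "z \<otimes> y" c] c Q by simp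
qed

lemma factor_comm_group: "comm_group Q\<^sub>N"
proof -
  interpret group Q\<^sub>N by (rule factor_group)
  show ?thesis
  proof (rule group_comm_groupI)
    fix X Y assume XY: "X \<in> carrier Q\<^sub>N" "Y \<in> carrier Q\<^sub>N"
    obtain x where x: "x \<in> carrier Q" "X = \<pi> x" using XY(1) by (rule pi_cases)
    obtain y where y: "y \<in> carrier Q" "Y = \<pi> y" using XY(2) by (rule pi_cases)
    show "X \<otimes>\<^bsub>Q\<^sub>N\<^esub> Y = Y \<otimes>\<^bsub>Q\<^sub>N\<^esub> X" using factor_commute[OF x(1) y(1)] x y by (simp add: pi_mult)
  qed
qed

lemma factor_exponent_4:
  assumes X: "X \<in> carrier Q\<^sub>N"
  shows "X [^]\<^bsub>Q\<^sub>N\<^esub> (4::nat) = \<one>\<^bsub>Q\<^sub>N\<^esub>"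
proof -
  interpret G: group Q\<^sub>N by (rule factor_group)
  obtain x where x: "x \<in> carrier Q" "X = \<pi> x" using X by (rule pi_cases)
  have "(x \<otimes> x) \<otimes> (x \<otimes> x) \<in> N"
    by (rule nucleus_if_assoc_one) (use x F.f_fourth_power in \<open>simp_all add: Zmod_simps\<close>)
  then have "(X \<otimes>\<^bsub>Q\<^sub>N\<^esub> X) \<otimes>\<^bsub>Q\<^sub>N\<^esub> (X \<otimes>\<^bsub>Q\<^sub>N\<^esub> X) = \<one>\<^bsub>Q\<^sub>N\<^esub>"
    using pi_eq_one_iff[of "(x \<otimes> x) \<otimes> (x \<otimes> x)"] x by (simp add: pi_mult)
  then show ?thesis using X by (simp add: numeral_eq_Suc G.m_assoc)
qed

lemma not_boolean_witness:
  assumes "\<not> boolean_group Q\<^sub>N"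
  obtains x y z where "x \<in> carrier Q" "y \<in> carrier Q" "z \<in> carrier Q"
    "assoc x y (z \<otimes> z) \<noteq> \<one>" "\<pi> z \<otimes>\<^bsub>Q\<^sub>N\<^esub> \<pi> z \<noteq> \<one>\<^bsub>Q\<^sub>N\<^esub>"
proof -
  obtain g where g: "g \<in> carrier Q\<^sub>N" "g \<otimes>\<^bsub>Q\<^sub>N\<^esub> g \<noteq> \<one>\<^bsub>Q\<^sub>N\<^esub>"
    using assms factor_group by (auto simp: boolean_group_def)
  obtain z where z: "z \<in> carrier Q" "g = \<pi> z" using g(1) by (rule pi_cases)
  have "z \<otimes> z \<notin> N" using g(2) z pi_eq_one_iff[of "z \<otimes> z"] by (simp add: pi_mult)
  then obtain x y where "x \<in> carrier Q" "y \<in> carrier Q" "assoc x y (z \<otimes> z) \<noteq> \<one>"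
    using nucleus_if_assoc_one[of "z \<otimes> z"] z by auto
  then show thesis using that z g by metis
qed

text \<open>Some \<open>z\<close> has order four modulo \<open>N\<close>, so with fewer than eight cosets all of them are powers of its class.
  Since \<open>f(x,y,z\<^sup>2)\<close> is additive in \<open>x\<close> and \<open>y\<close> and zero for \<open>x = y = z\<close>, it always vanishes.\<close>

lemma card_factor_ge_8:
  assumes nb: "\<not> boolean_group Q\<^sub>N" and fin: "finite (carrier Q\<^sub>N)"
  shows "8 \<le> card (carrier Q\<^sub>N)"
proof (rule ccontr)
  assume less: "\<not> 8 \<le> card (carrier Q\<^sub>N)"
  obtain x y z where Q: "x \<in> carrier Q" "y \<in> carrier Q" "z \<in> carrier Q"
    and e: "assoc x y (z \<otimes> z) \<noteq> \<one>" and zz: "\<pi> z \<otimes>\<^bsub>Q\<^sub>N\<^esub> \<pi> z \<noteq> \<one>\<^bsub>Q\<^sub>N\<^esub>"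
    using not_boolean_witness[OF nb] .
  interpret G: comm_group Q\<^sub>N by (rule factor_comm_group)
  have g: "\<pi> z \<in> carrier Q\<^sub>N" using Q by simp
  have og: "G.ord (\<pi> z) = 4" using G.ord_eq_four[OF g factor_exponent_4[OF g] zz] .
  then have "4 dvd order Q\<^sub>N" using G.ord_dvd_group_order[OF g] by simp
  moreover have "0 < order Q\<^sub>N" using fin g by (auto simp: order_def card_gt_0_iff)
  ultimately have "order Q\<^sub>N = 4" using less by (simp add: order_def) presburger
  then have "generate Q\<^sub>N {\<pi> z} = carrier Q\<^sub>N"
    using card_subset_eq[OF fin, of "generate Q\<^sub>N {\<pi> z}"] G.generate_pow_card[OF g] G.generate_incl[of "{\<pi> z}"] g og
    by (simp add: order_def)
  then have cyclic: "\<exists>n::nat. X = \<pi> z [^]\<^bsub>Q\<^sub>N\<^esub> n" if "X \<in> carrier Q\<^sub>N" for X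
    using that G.generate_pow_nat[OF g] og by auto
  define p where "p = (\<lambda>n. ((\<otimes>) z ^^ n) \<one>)"
  have p_Suc: "p 0 = \<one>" "p (Suc n) = z \<otimes> p n" for n by (simp_all add: p_def)
  have p: "p n \<in> carrier Q" for n by (induction n) (use Q in \<open>simp_all add: p_Suc\<close>)
  have pi_p: "\<pi> (p n) = \<pi> z [^]\<^bsub>Q\<^sub>N\<^esub> n" for n
    by (induction n) (use p g Q in \<open>simp_all add: p_Suc pi_one pi_mult G.m_comm\<close>)
  have zero: "f (p n) = \<zero>\<^bsub>Zmod\<^esub>"
    if f: "f = (\<lambda>x. assoc x w (z \<otimes> z)) \<or> f = (\<lambda>x. assoc w x (z \<otimes> z))" and "f z = \<zero>\<^bsub>Zmod\<^esub>"
      and w: "w \<in> carrier Q" for f w n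
  proof -
    have f_mult: "f (u \<otimes> v) = f v \<oplus>\<^bsub>Zmod\<^esub> f u" "f u \<in> carrier Zmod" if "u \<in> carrier Q" "v \<in> carrier Q" for u v
      using F.f_square_mult[OF that Q(3) w] F.f_square_mult[OF that Q(3) w] f that Q w by auto
    have "f \<one> = f \<one> \<oplus>\<^bsub>Zmod\<^esub> f \<one>" using f_mult(1)[of \<one> \<one>] by simp
    then have "f \<one> = \<zero>\<^bsub>Zmod\<^esub>" using f_mult(2)[of \<one> \<one>] by simp
    then show ?thesis using f_mult(1)[OF Q(3) p] \<open>f z = _\<close> by (induction n) (simp_all add: p_Suc)
  qed
  obtain i where i: "\<pi> x = \<pi> (p i)" using cyclic[of "\<pi> x"] Q pi_p by auto
  obtain j where j: "\<pi> y = \<pi> (p j)" using cyclic[of "\<pi> y"] Q pi_p by auto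
  have "assoc x y (z \<otimes> z) = assoc (p i) (p j) (z \<otimes> z)"
    by (rule assoc_pi_cong[OF i j refl]) (use p Q in simp_all)
  also have "\<dots> = \<zero>\<^bsub>Zmod\<^esub>"
    using zero[of "\<lambda>x. assoc x (p j) (z \<otimes> z)" "p j" i] zero[of "\<lambda>x. assoc z x (z \<otimes> z)" z j]
      F.f_square_self[OF Q(3)] p Q by simp
  finally show False using e by (simp add: Zmod_simps)
qed

lemma assoc_subloop_N: "assoc_subloop Q \<subseteq> N"
  by (rule assoc_subloop_least(3)[OF N_normal factor_group])

lemma assoc_in_assoc_subloop:
  assumes "x \<in> carrier Q" "y \<in> carrier Q" "z \<in> carrier Q"
  shows "assoc x y z \<in> assoc_subloop Q"
proof -
  note normal = assoc_subloop_least(1)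
  have "((x \<otimes> y) \<otimes> z) \<div> (x \<otimes> (y \<otimes> z)) \<in> assoc_subloop Q"
    using assoc_subloop_least(2) assms unfolding group_Mod_iff[OF normal] by blast
  then show ?thesis
    using normal assms unfolding normal_subloop_iff assoc_def by simp
qed

text \<open>The bound for submodules of \<open>Z\<close> is applied to \<open>A(Q) \<inter> Z\<close>: it contains all associators, and it is
  stable under conjugation because \<open>A(Q)\<close> is normal.\<close>

lemma card_assoc_subloop_ge_8:
  assumes nb: "\<not> boolean_group Q\<^sub>N" and fin: "finite (assoc_subloop Q)"
  shows "8 \<le> card (assoc_subloop Q)"
proof -
  let ?A = "assoc_subloop Q"
  have A: "\<one> \<in> ?A" "\<And>x y. \<lbrakk>x \<in> ?A; y \<in> ?A\<rbrakk> \<Longrightarrow> x \<otimes> y \<in> ?A" "\<And>x y. \<lbrakk>x \<in> ?A; y \<in> ?A\<rbrakk> \<Longrightarrow> x \<setminus> y \<in> ?A"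
    using assoc_subloop_least(1) by (auto simp: normal_subloop_def subloop_def)
  obtain x y z where Q: "x \<in> carrier Q" "y \<in> carrier Q" "z \<in> carrier Q" and e: "assoc x y (z \<otimes> z) \<noteq> \<one>"
    using not_boolean_witness[OF nb] by metis
  have Z: "\<one> \<in> Z" "\<And>x y. \<lbrakk>x \<in> Z; y \<in> Z\<rbrakk> \<Longrightarrow> x \<otimes> y \<in> Z" "\<And>x. x \<in> Z \<Longrightarrow> \<ominus>\<^bsub>Zmod\<^esub> x \<in> Z"
    using Zm.zero_closed Zm.a_closed Zm.a_inv_closed by (simp_all add: Zmod_simps)
  have "8 \<le> card (?A \<inter> Z)"
  proof (rule F.card_associators_ge_8)
    show "subgroup (?A \<inter> Z) (add_monoid Zmod)"
    proof (rule Zm.add.subgroupI)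
      show "?A \<inter> Z \<noteq> {}" using A Z by blast
      fix a assume a: "a \<in> ?A \<inter> Z"
      then show "\<ominus>\<^bsub>Zmod\<^esub> a \<in> ?A \<inter> Z"
        using A(3)[of a \<one>] A(1) Z(3)[of a] Z_neg[of a] by simp
      show "a \<oplus>\<^bsub>Zmod\<^esub> b \<in> ?A \<inter> Z" if "b \<in> ?A \<inter> Z" for b
        using a that A(2) Z(2) by (simp add: Zmod_simps)
    qed (simp add: Zmod_simps)
    show "finite (?A \<inter> Z)" using fin by simp
    show "assoc u v w \<in> ?A \<inter> Z" if "u \<in> carrier Q" "v \<in> carrier Q" "w \<in> carrier Q" for u v w
      using assoc_in_assoc_subloop[OF that] assoc_Z[OF that] by simp
    show "conj a u \<in> ?A \<inter> Z" if a: "a \<in> ?A \<inter> Z" and u: "u \<in> carrier Q" for a u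
    proof -
      have "(a \<otimes> u) \<div> u \<in> ?A" using a u Z_carrier by simp
      then have "conj a u \<in> ?A"
        using assoc_subloop_least(1) u a Z_carrier m_closed unfolding normal_subloop_iff conj_def by blast
      then show ?thesis using a conj_Z u by simp
    qed
    show "assoc x y (z \<otimes> z) \<noteq> \<zero>\<^bsub>Zmod\<^esub>" using e by (simp add: Zmod_simps)
  qed (rule Q)+
  also have "\<dots> \<le> card ?A" using fin by (intro card_mono) auto
  finally show ?thesis .
qed

lemma card_factor_mult_nucleus:
  assumes fin: "finite (carrier Q)"
  shows "card (carrier Q\<^sub>N) * card N = order Q"
proof -
  have un: "\<Union> (carrier Q\<^sub>N) = carrier Q"
  proof
    show "\<Union> (carrier Q\<^sub>N) \<subseteq> carrier Q"
      using r_coset_closed[of N] N_carrier by (auto simp: FactGroup_def RCOSETS_def)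
    show "carrier Q \<subseteq> \<Union> (carrier Q\<^sub>N)"
      using N_one by (force simp: FactGroup_def RCOSETS_def r_coset_def)
  qed
  have "card N * card (carrier Q\<^sub>N) = card (\<Union> (carrier Q\<^sub>N))"
  proof (rule card_partition)
    show "finite (carrier Q\<^sub>N)" using fin by (simp add: FactGroup_def RCOSETS_def)
    from un show "finite (\<Union> (carrier Q\<^sub>N))" using fin by simp
    show "card X = card N" if X: "X \<in> carrier Q\<^sub>N" for X
    proof -
      obtain x where x: "x \<in> carrier Q" "X = \<pi> x" using X by (rule pi_cases)
      have "inj_on (\<lambda>n. n \<otimes> x) N" using x N_carrier by (intro inj_onI) simp
      moreover have "X = (\<lambda>n. n \<otimes> x) ` N" using x by (auto simp: r_coset_def)
      ultimately show ?thesis by (simp add: card_image)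
    qed
    show "X \<inter> Y = {}" if XY: "X \<in> carrier Q\<^sub>N" "Y \<in> carrier Q\<^sub>N" "X \<noteq> Y" for X Y
    proof (rule ccontr)
      assume "X \<inter> Y \<noteq> {}"
      then obtain w where w: "w \<in> X" "w \<in> Y" by blast
      have "V = \<pi> w" if V: "V \<in> carrier Q\<^sub>N" "w \<in> V" for V
      proof -
        obtain v where v: "v \<in> carrier Q" "V = \<pi> v" using V(1) by (rule pi_cases)
        have "w \<in> carrier Q" "w \<div> v \<in> N" using V(2) v N_carrier r_coset_iff[of N v w] by auto
        then show ?thesis using v r_coset_eq_iff[OF N_normal, of w v] by simp
      qed
      then show False using XY w by blast
    qed
  qed
  with un show ?thesis by (simp add: order_def mult.commute)
qed

end

theorem corollary3p5:
  fixes Q :: "('a, 'b) monoid_scheme"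
  assumes "buchsteiner_loop Q"
    and "\<not> boolean_group (Q Mod nucleus Q)"
  shows "(finite (assoc_subloop Q) \<longrightarrow> card (assoc_subloop Q) \<ge> 8) \<and>
    (finite (rcosets\<^bsub>Q\<^esub> (nucleus Q)) \<longrightarrow> card (rcosets\<^bsub>Q\<^esub> (nucleus Q)) \<ge> 8) \<and>
    (order Q = 64 \<longrightarrow>
      card (assoc_subloop Q) = 8 \<and>
      Q Mod nucleus Q \<cong> integer_mod_group 4 \<times>\<times> integer_mod_group 2)"
proof -
  interpret nuclear_buchsteiner_loop Q by (rule buchsteiner_nuclear[OF assms(1)])
  have cosets: "carrier (Q Mod N) = rcosets\<^bsub>Q\<^esub> N" by (simp add: FactGroup_def)
  have "card (assoc_subloop Q) = 8 \<and> Q\<^sub>N \<cong> integer_mod_group 4 \<times>\<times> integer_mod_group 2" if 64: "order Q = 64"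
  proof -
    have fin: "finite (carrier Q)" using 64 by (metis card.infinite order_def zero_neq_numeral)
    then have finN: "finite N" using N_carrier by (metis finite_subset subsetI)
    have finG: "finite (carrier Q\<^sub>N)" using fin by (simp add: FactGroup_def RCOSETS_def)
    have finA: "finite (assoc_subloop Q)" using finN assoc_subloop_N finite_subset by blast
    have A: "8 \<le> card (assoc_subloop Q)" "card (assoc_subloop Q) \<le> card N"
      using card_assoc_subloop_ge_8[OF assms(2) finA] card_mono[OF finN assoc_subloop_N] by simp_all
    have G: "8 \<le> card (carrier Q\<^sub>N)" by (rule card_factor_ge_8[OF assms(2) finG])
    have GN: "card (carrier Q\<^sub>N) * card N = 64" using card_factor_mult_nucleus[OF fin] 64 by simp
    have "card N \<le> 8"
    proof (rule ccontr)
      assume "\<not> card N \<le> 8"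
      then have "8 * 9 \<le> card (carrier Q\<^sub>N) * card N" using G by (intro mult_le_mono) auto
      then show False using GN by simp
    qed
    then have cards: "card (assoc_subloop Q) = 8" "card N = 8" using A by simp_all
    then have "order Q\<^sub>N = 8" using GN by (simp add: order_def)
    obtain z where "z \<in> carrier Q" "\<pi> z \<otimes>\<^bsub>Q\<^sub>N\<^esub> \<pi> z \<noteq> \<one>\<^bsub>Q\<^sub>N\<^esub>" using not_boolean_witness[OF assms(2)] by metis
    then have "Q\<^sub>N \<cong> integer_mod_group 4 \<times>\<times> integer_mod_group 2"
      by (intro comm_group.iso_C4_C2[OF factor_comm_group \<open>order Q\<^sub>N = 8\<close> factor_exponent_4]) auto
    then show ?thesis using cards by simp
  qed
  then show ?thesis
    using card_assoc_subloop_ge_8[OF assms(2)] card_factor_ge_8[OF assms(2)] by (simp add: cosets)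
qed

end
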